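(* Let $M$ be a bicircular matroid. Then $M$ is a lattice path matroid if and only if $M$ has no minor isomorphic to any of the following eight matroids: \[ C^{2,4}=B(P_2),\quad \mathcal{W}^3=B(W),\quad A^3=B(A_3),\quad R^3=B(R_3),\quad R^4=B(R_4),\quad D^4=B(D_4),\quad B^1=B(3K_3),\quad S^1=B(S_1). \]
   Context: Graphs are finite and may have loops and parallel edges. For a graph $G$ with edge set $E$, the bicircular matroid $B(G)$ is the matroid on $E$ whose independent sets are the sets $I\subseteq E$ such that every connected component of the subgraph formed by the edges of $I$ contains at most one cycle (a loop, or a pair of parallel edges, counts as a cycle). A matroid is bicircular if it is isomorphic to $B(G)$ for some graph $G$. A matroid $M$ on $E$ is a lattice path matroid if there is a linear ordering $e_1<e_2<\dots<e_n$ of $E$ and a sequence $(N_1,\dots,N_k)$ of intervals of this ordering, pairwise incomparable under inclusion, such that $M$ is isomorphic to the transversal matroid on $E$ with presentation $(N_1,\dots,N_k)$ (independent sets are the partial transversals). The graphs: $W$ is a triangle with one loop at each vertex. $R_3$ is a triangle on $u,v,w$ with two loops at $u$, two loops at $v$, and no loop at $w$. $A_3$ is a triangle on $u,v,w$ in which $uv$ is a single edge, $uw$ and $vw$ are each doubled (two parallel edges), and there is one loop at $w$. $3K_3$ is a triangle with each edge replaced by three parallel edges. $P_2$ has a vertex $c$ and three further vertices $x,y,z$, each joined to $c$ by two parallel edges (no other edges). $R_4$ has vertices $a,b,c,d$, with single edges $ab$, $ad$, $bd$, two parallel edges $ac$, and two loops at $d$. $D_4$ is obtained from a triangle on $u,v,w$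 by replacing $uw$ and $vw$ each by three parallel edges and subdividing the edge $uv$ once (so $u$ and $v$ are joined by a path of length $2$). $S_1$ has vertices $a,b,c,d,s$ with single edges $ab$, $cd$, $as$, $sd$, two parallel edges $ac$ and two parallel edges $bd$. *)

theory Defs
  imports Main
begin

section \<open>Matroids\<close>

record 'a matroid =
  ground :: "'a set"
  indeps :: "'a set set"

definition is_matroid :: "'a matroid \<Rightarrow> bool" where
  "is_matroid M \<longleftrightarrow>
     finite (ground M) \<and>
     indeps M \<subseteq> Pow (ground M) \<and>
     {} \<in> indeps M \<and>
     (\<forall>I\<in>indeps M. \<forall>J. J \<subseteq> I \<longrightarrow> J \<in> indeps M) \<and>
     (\<forall>I\<in>indeps M. \<forall>J\<in>indeps M. card J < card I \<longrightarrow> (\<exists>x\<in>I - J. insert x J \<in> indeps M))"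

definition matroid_iso :: "'a matroid \<Rightarrow> 'b matroid \<Rightarrow> bool" where
  "matroid_iso M N \<longleftrightarrow>
     (\<exists>f. bij_betw f (ground M) (ground N) \<and>
          (\<forall>X. X \<subseteq> ground M \<longrightarrow> (X \<in> indeps M \<longleftrightarrow> f ` X \<in> indeps N)))"

definition deletion :: "'a matroid \<Rightarrow> 'a set \<Rightarrow> 'a matroid" where
  "deletion M D = \<lparr>ground = ground M - D, indeps = {I \<in> indeps M. I \<inter> D = {}}\<rparr>"

definition basis_of :: "'a matroid \<Rightarrow> 'a set \<Rightarrow> 'a set \<Rightarrow> bool" where
  "basis_of M X B \<longleftrightarrow>
     B \<in> indeps M \<and> B \<subseteq> X \<and> (\<forall>B'. B' \<in> indeps M \<and> B \<subseteq> B' \<and> B' \<subseteq> X \<longrightarrow> B' = B)"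

text \<open>In a matroid, the choice of the basis \<^term>\<open>B\<close> of \<^term>\<open>C\<close> is immaterial.\<close>

definition contraction :: "'a matroid \<Rightarrow> 'a set \<Rightarrow> 'a matroid" where
  "contraction M C =
     \<lparr>ground = ground M - C,
      indeps = {I. I \<subseteq> ground M - C \<and> (\<exists>B. basis_of M C B \<and> I \<union> B \<in> indeps M)}\<rparr>"

definition minor_of :: "'a matroid \<Rightarrow> 'a matroid \<Rightarrow> bool" where
  "minor_of N M \<longleftrightarrow>
     (\<exists>C D. C \<subseteq> ground M \<and> D \<subseteq> ground M \<and> C \<inter> D = {} \<and> N = deletion (contraction M C) D)"

definition has_minor_isomorphic_to :: "'a matroid \<Rightarrow> 'b matroid \<Rightarrow> bool" where
  "has_minor_isomorphic_to M K \<longleftrightarrow> (\<exists>N. minor_of N M \<and> matroid_iso N K)"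


section \<open>Lattice path matroids\<close>

text \<open>A linear ordering \<open>e\<^sub>1 < \<dots> < e\<^sub>n\<close> of a finite set is given by a list that enumerates it
  without repetition.\<close>

definition interval_of :: "'a list \<Rightarrow> 'a set \<Rightarrow> bool" where
  "interval_of es N \<longleftrightarrow> (\<exists>i j. i \<le> j \<and> j < length es \<and> N = (\<lambda>k. es ! k) ` {i..j})"

definition partial_transversal :: "'a set list \<Rightarrow> 'a set \<Rightarrow> bool" where
  "partial_transversal Ns X \<longleftrightarrow>
     (\<exists>\<phi>. inj_on \<phi> X \<and> (\<forall>x\<in>X. \<phi> x < length Ns \<and> x \<in> Ns ! \<phi> x))"

definition transversal_matroid :: "'a set \<Rightarrow> 'a set list \<Rightarrow> 'a matroid" where
  "transversal_matroid E Ns = \<lparr>ground = E, indeps = {X. X \<subseteq> E \<and> partial_transversal Ns X}\<rparr>"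

definition lattice_path_matroid :: "'a matroid \<Rightarrow> bool" where
  "lattice_path_matroid M \<longleftrightarrow>
     is_matroid M \<and>
     (\<exists>es Ns. distinct es \<and> set es = ground M \<and>
        (\<forall>N\<in>set Ns. interval_of es N) \<and>
        (\<forall>i<length Ns. \<forall>j<length Ns. i \<noteq> j \<longrightarrow> \<not> Ns ! i \<subseteq> Ns ! j) \<and>
        matroid_iso M (transversal_matroid (ground M) Ns))"


section \<open>Graphs with loops and parallel edges\<close>

record ('v, 'e) multigraph =
  verts :: "'v set"
  edges :: "'e set"
  ends :: "'e \<Rightarrow> 'v set"

definition finite_multigraph :: "('v, 'e) multigraph \<Rightarrow> bool" where
  "finite_multigraph G \<longleftrightarrow>
     finite (verts G) \<and> finite (edges G) \<and>
     (\<forall>e\<in>edges G. ends G e \<subseteq> verts G \<and> (card (ends G e) = 1 \<or> card (ends G e) = 2))"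

definition edge_subgraph :: "('v, 'e) multigraph \<Rightarrow> 'e set \<Rightarrow> ('v, 'e) multigraph" where
  "edge_subgraph G I = \<lparr>verts = (\<Union>e\<in>I. ends G e), edges = I, ends = ends G\<rparr>"

definition adjacency :: "('v, 'e) multigraph \<Rightarrow> ('v \<times> 'v) set" where
  "adjacency G = {(u, v). \<exists>e\<in>edges G. ends G e = {u, v}}"

text \<open>Connected components are represented by their vertex sets.\<close>

definition components :: "('v, 'e) multigraph \<Rightarrow> 'v set set" where
  "components G = verts G // (adjacency G)\<^sup>*"

text \<open>A cycle is identified with its edge set.  Length \<open>1\<close> gives the loops and length \<open>2\<close> the
  pairs of parallel edges.\<close>

definition is_cycle :: "('v, 'e) multigraph \<Rightarrow> 'e set \<Rightarrow> bool" where
  "is_cycle G C \<longleftrightarrow>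
     (\<exists>vs es. es \<noteq> [] \<and> length vs = length es \<and> distinct vs \<and> distinct es \<and>
        set es \<subseteq> edges G \<and> C = set es \<and>
        (\<forall>i<length es. ends G (es ! i) = {vs ! i, vs ! (Suc i mod length es)}))"


section \<open>Bicircular matroids\<close>

definition bicircular_indep :: "('v, 'e) multigraph \<Rightarrow> 'e set \<Rightarrow> bool" where
  "bicircular_indep G I \<longleftrightarrow>
     I \<subseteq> edges G \<and>
     (\<forall>K\<in>components (edge_subgraph G I).
        \<exists>\<^sub>\<le>\<^sub>1C. is_cycle (edge_subgraph G I) C \<and> (\<forall>e\<in>C. ends G e \<subseteq> K))"

definition B_matroid :: "('v, 'e) multigraph \<Rightarrow> 'e matroid" where
  "B_matroid G = \<lparr>ground = edges G, indeps = {I. bicircular_indep G I}\<rparr>"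

text \<open>Since graphs are finite, restricting the vertices and edges to natural numbers loses no
  generality; see \<open>bicircular_matroidI\<close> below.\<close>

definition bicircular_matroid :: "'a matroid \<Rightarrow> bool" where
  "bicircular_matroid M \<longleftrightarrow>
     is_matroid M \<and> (\<exists>G :: (nat, nat) multigraph. finite_multigraph G \<and> matroid_iso M (B_matroid G))"

lemma is_cycle_map:
  assumes f: "inj_on f (verts G)" and g: "inj_on g (edges G)"
    and vG: "\<And>e. e \<in> edges G \<Longrightarrow> ends G e \<subseteq> verts G"
    and gE: "g ` edges G \<subseteq> edges H"
    and fg: "\<And>e. e \<in> edges G \<Longrightarrow> ends H (g e) = f ` ends G e"
    and C: "is_cycle G C"
  shows "is_cycle H (g ` C)"
proof -
  obtain vs es where *: "es \<noteq> []" "length vs = length es" "distinct vs" "distinct es"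
      "set es \<subseteq> edges G" "C = set es"
      "\<And>i. i < length es \<Longrightarrow> ends G (es ! i) = {vs ! i, vs ! (Suc i mod length es)}"
    using C unfolding is_cycle_def by blast
  have vs: "set vs \<subseteq> verts G"
  proof
    fix v assume "v \<in> set vs"
    then obtain i where i: "i < length es" "v = vs ! i" using *(2) by (metis in_set_conv_nth)
    then have "v \<in> ends G (es ! i)" using *(7) by simp
    moreover have "es ! i \<in> edges G" using i *(5) by auto
    ultimately show "v \<in> verts G" using vG by blast
  qed
  have "distinct (map f vs)" using *(3) f vs by (simp add: distinct_map inj_on_subset)
  moreover have "distinct (map g es)" using *(4,5) g by (simp add: distinct_map inj_on_subset)
  moreover have "set (map g es) \<subseteq> edges H" using *(5) gE by auto
  moreover have "ends H (map g es ! i) = {map f vs ! i, map f vs ! (Suc i mod length es)}"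
    if i: "i < length es" for i
  proof -
    have "Suc i mod length es < length es" using *(1) by simp
    moreover have "es ! i \<in> edges G" using i *(5) by auto
    ultimately show ?thesis using i *(2) *(7)[OF i] fg by simp
  qed
  ultimately show ?thesis unfolding is_cycle_def
    using *(1,2,6) by (intro exI[of _ "map f vs"] exI[of _ "map g es"]) simp
qed

lemma bicircular_indep_map:
  assumes f: "inj_on f (verts G)" and g: "inj_on g (edges G)"
    and vG: "\<And>e. e \<in> edges G \<Longrightarrow> ends G e \<subseteq> verts G"
    and fg: "\<And>e. e \<in> edges G \<Longrightarrow> ends H (g e) = f ` ends G e"
    and I: "I \<subseteq> edges G" and ind: "bicircular_indep H (g ` I)"
  shows "bicircular_indep G I"
  unfolding bicircular_indep_def
proof (intro conjI ballI I)
  let ?G = "edge_subgraph G I" and ?H = "edge_subgraph H (g ` I)"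
  have fgI: "ends H (g e) = f ` ends G e" if "e \<in> I" for e using that I fg by blast
  have vGI: "(\<Union>e\<in>I. ends G e) \<subseteq> verts G" using I vG by blast
  have cyc: "is_cycle ?H (g ` C)" if "is_cycle ?G C" for C
    using _ _ _ _ _ that
    by (rule is_cycle_map[where f = f])
       (use f g vGI I fgI in \<open>auto simp: edge_subgraph_def intro: inj_on_subset\<close>)
  have conn: "(f u, f v) \<in> (adjacency ?H)\<^sup>*" if "(u, v) \<in> (adjacency ?G)\<^sup>*" for u v
    using that
  proof induction
    case (step v w)
    then obtain e where "e \<in> I" "ends G e = {v, w}"
      by (auto simp: adjacency_def edge_subgraph_def)
    then have "(f v, f w) \<in> adjacency ?H"
      using fgI[of e] by (auto simp: adjacency_def edge_subgraph_def intro!: bexI[of _ e])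
    with step.IH show ?case by simp
  qed simp
  fix K assume "K \<in> components ?G"
  then obtain u where u: "u \<in> verts ?G" "K = (adjacency ?G)\<^sup>* `` {u}"
    unfolding components_def by (auto elim: quotientE)
  define L where "L = (adjacency ?H)\<^sup>* `` {f u}"
  have "f u \<in> verts ?H" using u(1) fgI by (auto simp: edge_subgraph_def)
  then have L: "L \<in> components ?H" unfolding components_def L_def by (rule quotientI)
  have KL: "f ` K \<subseteq> L" using u(2) conn by (auto simp: L_def)
  have ends: "\<forall>e\<in>g ` C. ends H e \<subseteq> L" if "C \<subseteq> I" "\<forall>e\<in>C. ends G e \<subseteq> K" for C
    using that KL fgI by (auto simp: subset_eq)
  have sub: "C \<subseteq> I" if "is_cycle ?G C" for C
    using that by (auto simp: is_cycle_def edge_subgraph_def)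
  show "\<exists>\<^sub>\<le>\<^sub>1C. is_cycle ?G C \<and> (\<forall>e\<in>C. ends G e \<subseteq> K)"
  proof (rule Uniq_I)
    fix C D
    assume C: "is_cycle ?G C \<and> (\<forall>e\<in>C. ends G e \<subseteq> K)"
      and D: "is_cycle ?G D \<and> (\<forall>e\<in>D. ends G e \<subseteq> K)"
    have "\<exists>\<^sub>\<le>\<^sub>1C. is_cycle ?H C \<and> (\<forall>e\<in>C. ends H e \<subseteq> L)"
      using ind L unfolding bicircular_indep_def by blast
    then have "g ` C = g ` D"
    proof (rule Uniq_D)
      show "is_cycle ?H (g ` C) \<and> (\<forall>e\<in>g ` C. ends H e \<subseteq> L)"
        using C cyc[of C] sub[of C] ends[of C] by blast
      show "is_cycle ?H (g ` D) \<and> (\<forall>e\<in>g ` D. ends H e \<subseteq> L)"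
        using D cyc[of D] sub[of D] ends[of D] by blast
    qed
    moreover have "C \<subseteq> edges G" "D \<subseteq> edges G" using C D sub I by auto
    ultimately show "C = D" using g by (simp add: inj_on_image_eq_iff)
  qed
qed

lemma bicircular_matroidI:
  fixes G :: "('v, 'e) multigraph"
  assumes M: "is_matroid M" and G: "finite_multigraph G" and iso: "matroid_iso M (B_matroid G)"
  shows "bicircular_matroid M"
proof -
  have fin: "finite (verts G)" "finite (edges G)"
    and vG: "\<And>e. e \<in> edges G \<Longrightarrow> ends G e \<subseteq> verts G"
    and cG: "\<And>e. e \<in> edges G \<Longrightarrow> card (ends G e) = 1 \<or> card (ends G e) = 2"
    using G by (auto simp: finite_multigraph_def)
  obtain f :: "'v \<Rightarrow> nat" where f: "inj_on f (verts G)"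
    using fin(1) finite_imp_inj_to_nat_seg by blast
  obtain g :: "'e \<Rightarrow> nat" where g: "inj_on g (edges G)"
    using fin(2) finite_imp_inj_to_nat_seg by blast
  define f' where "f' = inv_into (verts G) f"
  define g' where "g' = inv_into (edges G) g"
  define H where "H = \<lparr>verts = f ` verts G, edges = g ` edges G, ends = (\<lambda>x. f ` ends G (g' x))\<rparr>"
  have g'g: "g' (g e) = e" if "e \<in> edges G" for e using that g by (simp add: g'_def)
  have f'f: "f' (f v) = v" if "v \<in> verts G" for v using that f by (simp add: f'_def)
  have fg: "ends H (g e) = f ` ends G e" if "e \<in> edges G" for e
    using that by (simp add: H_def g'g)
  have inv_ends: "ends G (g' x) = f' ` ends H x" if x: "x \<in> edges H" for x
  proof -
    obtain e where e: "e \<in> edges G" "x = g e" using x by (auto simp: H_def)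
    have "f' ` f ` ends G e = ends G e" using f'f vG[OF e(1)] by (force simp: image_iff)
    then show ?thesis using e by (simp add: g'g fg)
  qed
  have finH: "finite_multigraph H"
    unfolding finite_multigraph_def
  proof (intro conjI ballI)
    fix x assume "x \<in> edges H"
    then obtain e where e: "e \<in> edges G" "x = g e" by (auto simp: H_def)
    have "ends H x = f ` ends G e" using e fg by simp
    also have "\<dots> \<subseteq> verts H" using vG[OF e(1)] by (auto simp: H_def)
    finally show "ends H x \<subseteq> verts H" .
    have "card (ends H x) = card (ends G e)"
      using e fg vG f by (simp add: card_image inj_on_subset)
    then show "card (ends H x) = 1 \<or> card (ends H x) = 2" using cG e by simp
  qed (use fin in \<open>simp_all add: H_def\<close>)
  have eq: "bicircular_indep G I \<longleftrightarrow> bicircular_indep H (g ` I)" if I: "I \<subseteq> edges G" for I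
  proof
    assume ind: "bicircular_indep G I"
    have "g' ` g ` I = I" using I g'g by (force simp: image_iff)
    then have ind': "bicircular_indep G (g' ` g ` I)" using ind by simp
    show "bicircular_indep H (g ` I)"
    proof (rule bicircular_indep_map[where f = f' and g = g' and H = G])
      show "inj_on f' (verts H)" by (auto simp: f'_def H_def inj_on_inv_into)
      show "inj_on g' (edges H)" by (auto simp: g'_def H_def inj_on_inv_into)
      show "ends H x \<subseteq> verts H" if "x \<in> edges H" for x
        using finH that by (simp add: finite_multigraph_def)
      show "g ` I \<subseteq> edges H" using I by (auto simp: H_def)
    qed (use ind' inv_ends in auto)
  next
    assume "bicircular_indep H (g ` I)"
    then show "bicircular_indep G I"
      using bicircular_indep_map[OF f g vG fg I] by blast
  qed
  obtain h where h: "bij_betw h (ground M) (edges G)"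
    and hI: "\<And>X. X \<subseteq> ground M \<Longrightarrow> X \<in> indeps M \<longleftrightarrow> bicircular_indep G (h ` X)"
    using iso by (auto simp: matroid_iso_def B_matroid_def)
  have "bij_betw g (edges G) (edges H)" using g by (simp add: H_def bij_betw_def)
  with h have "bij_betw (g \<circ> h) (ground M) (edges H)" by (rule bij_betw_trans)
  moreover have "X \<in> indeps M \<longleftrightarrow> bicircular_indep H ((g \<circ> h) ` X)" if X: "X \<subseteq> ground M" for X
  proof -
    have "h ` X \<subseteq> edges G" using h X by (auto simp: bij_betw_def)
    then show ?thesis using hI[OF X] eq by (simp add: image_comp)
  qed
  ultimately have "matroid_iso M (B_matroid H)" unfolding matroid_iso_def B_matroid_def by auto
  with M finH show ?thesis unfolding bicircular_matroid_def by blast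
qed


section \<open>The excluded minors\<close>

text \<open>\<open>multigraph_of n xs\<close> has vertices \<open>0, \<dots>, n - 1\<close> and one edge for each entry of \<open>xs\<close>: a pair
  \<open>(u, v)\<close> is an edge joining \<open>u\<close> and \<open>v\<close>, and \<open>(u, u)\<close> is a loop at \<open>u\<close>.\<close>

definition multigraph_of :: "nat \<Rightarrow> (nat \<times> nat) list \<Rightarrow> (nat, nat) multigraph" where
  "multigraph_of n xs =
     \<lparr>verts = {..<n}, edges = {..<length xs}, ends = (\<lambda>i. {fst (xs ! i), snd (xs ! i)})\<rparr>"

definition graph_W :: "(nat, nat) multigraph" where
  "graph_W = multigraph_of 3 [(0,1), (1,2), (0,2), (0,0), (1,1), (2,2)]"

text \<open>\<open>u, v, w = 0, 1, 2\<close>\<close>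

definition graph_R3 :: "(nat, nat) multigraph" where
  "graph_R3 = multigraph_of 3 [(0,1), (0,2), (1,2), (0,0), (0,0), (1,1), (1,1)]"

text \<open>\<open>u, v, w = 0, 1, 2\<close>\<close>

definition graph_A3 :: "(nat, nat) multigraph" where
  "graph_A3 = multigraph_of 3 [(0,1), (0,2), (0,2), (1,2), (1,2), (2,2)]"

definition graph_3K3 :: "(nat, nat) multigraph" where
  "graph_3K3 = multigraph_of 3
     [(0,1), (0,1), (0,1), (0,2), (0,2), (0,2), (1,2), (1,2), (1,2)]"

text \<open>\<open>c, x, y, z = 0, 1, 2, 3\<close>\<close>

definition graph_P2 :: "(nat, nat) multigraph" where
  "graph_P2 = multigraph_of 4 [(0,1), (0,1), (0,2), (0,2), (0,3), (0,3)]"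

text \<open>\<open>a, b, c, d = 0, 1, 2, 3\<close>\<close>

definition graph_R4 :: "(nat, nat) multigraph" where
  "graph_R4 = multigraph_of 4 [(0,1), (0,3), (1,3), (0,2), (0,2), (3,3), (3,3)]"

text \<open>\<open>u, v, w = 0, 1, 2\<close>, and \<open>3\<close> is the vertex that subdivides \<open>uv\<close>\<close>

definition graph_D4 :: "(nat, nat) multigraph" where
  "graph_D4 = multigraph_of 4
     [(0,2), (0,2), (0,2), (1,2), (1,2), (1,2), (0,3), (3,1)]"

text \<open>\<open>a, b, c, d, s = 0, 1, 2, 3, 4\<close>\<close>

definition graph_S1 :: "(nat, nat) multigraph" where
  "graph_S1 = multigraph_of 5
     [(0,1), (2,3), (0,4), (4,3), (0,2), (0,2), (1,3), (1,3)]"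

end

theory Submission
  imports Defs
begin

text \<open>A set of edges is bicircular-independent iff each of its subsets \<open>J\<close> covers at least \<open>card J\<close>
  vertices, that is, iff it is a partial transversal of the stars of the vertices. A matroid is a
  lattice path matroid iff it is transversal on intervals whose left and right ends are both weakly
  sorted; this form is visibly inherited by restrictions, and by contractions after merging
  consecutive intervals. Comparing the spans of circuits with an ordering shows that the eight
  matroids have no such presentation.

  Conversely, let \<open>G\<close> be a graph without the eight minors. Summing over components and deleting
  vertices of degree one, we may assume that \<open>G\<close> is connected with minimum degree two. Call a piece
  at \<open>v\<close> the 2-core of a component of \<open>G - v\<close>, provided that it has two independent cycles. A
  minimal dependent set that misses \<open>v\<close> lies inside a piece at \<open>v\<close>, so the star of \<open>v\<close> may be
  enlarged to the set of all edges outside the pieces at \<open>v\<close>. The excluded minors force two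
  incomparable pieces to be edge-disjoint or together to contain all edges; they force two pieces
  to be comparable if both contain, or are both contained in, a third; and they forbid three pairwise
  incomparable pieces. Hence the pieces split into two chains, which are initial and final segments
  of one ordering of the edges. In it the enlarged stars are intervals, and these intervals present
  the matroid.\<close>

text \<open>A circuit of the bicircular matroid is a minimal edge set with more edges than vertices:
  it is connected, has minimum degree two and carries two independent cycles. This is the origin of
  the three conditions on a piece. The obstacle in the converse is to exhibit minors in an arbitrary
  graph. All of them are found in one way: disjoint connected vertex sets are contracted along
  spanning trees, so that only the edges between two sets and the surplus edges inside one set have
  to be counted. Minimum degree two merely says that a set has a surplus edge or sends out two
  edges. The predicate \<open>heavy\<close> keeps this alternative open: in the configurations used,
  trading one of two parallel edges for a loop leaves the matroid unchanged or leads to another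
  excluded one. Some minors also contract a loop, which is no graph contraction: the non-loop edges
  at its vertex become loops at their far ends.\<close>

lemma hall_matching:
  fixes S :: "'a \<Rightarrow> 'b set"
  assumes "finite X" and "\<And>x. x \<in> X \<Longrightarrow> finite (S x)"
    and "\<And>J. J \<subseteq> X \<Longrightarrow> card J \<le> card (\<Union>(S ` J))"
  shows "\<exists>\<phi>. inj_on \<phi> X \<and> (\<forall>x\<in>X. \<phi> x \<in> S x)"
  using assms
proof (induction "card X" arbitrary: X S rule: less_induct)
  case less
  show ?case
  proof (cases "X = {}")
    case False
    then obtain x0 where x0: "x0 \<in> X" by blast
    \<comment> \<open>Halmos and Vaughan: a tight proper subset \<open>J\<close> is matched into its
      own neighbourhood \<open>W\<close> and the rest outside \<open>W\<close>; without tight sets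
      every nonempty proper subset has slack one, so any \<open>s\<close> may be given to
      \<open>x0\<close>.\<close>
    show ?thesis
    proof (cases "\<exists>J. J \<subset> X \<and> J \<noteq> {} \<and> card J = card (\<Union>(S ` J))")
      case True
      then obtain J where J: "J \<subset> X" "J \<noteq> {}" "card J = card (\<Union>(S ` J))" by blast
      define W where "W = \<Union>(S ` J)"
      have finJ: "finite J" using J less.prems(1) finite_subset by blast
      have finW: "finite W" unfolding W_def using finJ J less.prems(2) by blast
      have "card J < card X" using J(1) less.prems(1) by (metis psubset_card_mono)
      moreover have "card K \<le> card (\<Union>(S ` K))" if "K \<subseteq> J" for K
        using that J less.prems(3)[of K] by blast
      ultimately obtain f where f: "inj_on f J" "\<forall>x\<in>J. f x \<in> S x"
        using less.hyps[of J S] finJ J less.prems(2) by blast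
      define S' where "S' x = S x - W" for x
      have "card K \<le> card (\<Union>(S' ` K))" if K: "K \<subseteq> X - J" for K
      proof -
        have finK: "finite K" using K less.prems(1) finite_subset by blast
        have fin1: "finite (\<Union>(S' ` K))" using finK K less.prems(2) by (auto simp: S'_def)
        have "card K + card J = card (K \<union> J)" using K finK finJ by (subst card_Un_disjoint) auto
        also have "\<dots> \<le> card (\<Union>(S ` (K \<union> J)))" using less.prems(3)[of "K \<union> J"] K J by blast
        also have "\<Union>(S ` (K \<union> J)) = \<Union>(S' ` K) \<union> W" by (auto simp: S'_def W_def)
        also have "card (\<Union>(S' ` K) \<union> W) \<le> card (\<Union>(S' ` K)) + card W" by (rule card_Un_le)
        finally show ?thesis using J by (simp add: W_def)
      qed
      moreover have "card (X - J) < card X"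
        using J less.prems(1) by (intro psubset_card_mono) auto
      ultimately obtain g where g: "inj_on g (X - J)" "\<forall>x\<in>X - J. g x \<in> S' x"
        using less.hyps[of "X - J" S'] less.prems(1,2) by (auto simp: S'_def)
      define h where "h x = (if x \<in> J then f x else g x)" for x
      have "inj_on h X"
      proof (rule inj_onI)
        fix x y assume xy: "x \<in> X" "y \<in> X" "h x = h y"
        show "x = y"
        proof (cases "x \<in> J")
          case True
          then have "h x \<in> W" using f by (auto simp: h_def W_def)
          then have "y \<in> J" using xy g by (auto simp: h_def S'_def split: if_splits)
          then show ?thesis using True xy f by (auto simp: h_def inj_on_def)
        next
          case False
          then have "h x \<notin> W" using g xy(1) by (auto simp: h_def S'_def)
          moreover have "h y \<in> W" if "y \<in> J" using that f by (auto simp: h_def W_def)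
          ultimately have "y \<notin> J" using xy by metis
          then show ?thesis using False xy g by (auto simp: h_def inj_on_def)
        qed
      qed
      moreover have "\<forall>x\<in>X. h x \<in> S x" using f g J by (auto simp: h_def S'_def)
      ultimately show ?thesis by blast
    next
      case noJ: False
      have "S x0 \<noteq> {}" using less.prems(3)[of "{x0}"] x0 by auto
      then obtain s where s: "s \<in> S x0" by blast
      define S' where "S' x = S x - {s}" for x
      have "card K \<le> card (\<Union>(S' ` K))" if K: "K \<subseteq> X - {x0}" for K
      proof (cases "K = {}")
        case False
        have fin: "finite (\<Union>(S ` K))"
          using K less.prems(1,2) by (meson Diff_subset finite_UN_I finite_subset subset_iff)
        have "K \<subset> X" using K x0 by blast
        then have "card K < card (\<Union>(S ` K))"
          using noJ False less.prems(3)[of K] by (metis le_neq_implies_less psubset_imp_subset)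
        moreover have "card (\<Union>(S ` K)) - 1 \<le> card (\<Union>(S ` K) - {s})"
          by (simp add: card_Diff_singleton_if)
        moreover have "\<Union>(S ` K) - {s} = \<Union>(S' ` K)" by (auto simp: S'_def)
        ultimately show ?thesis by simp
      qed simp
      moreover have "card (X - {x0}) < card X"
        using x0 less.prems(1) by (meson card_Diff1_less)
      ultimately obtain g where g: "inj_on g (X - {x0})" "\<forall>x\<in>X - {x0}. g x \<in> S' x"
        using less.hyps[of "X - {x0}" S'] less.prems(1,2) by (auto simp: S'_def)
      have "inj_on (g(x0 := s)) X"
        using g x0 by (auto simp: inj_on_def S'_def)
      moreover have "\<forall>x\<in>X. (g(x0 := s)) x \<in> S x" using g s by (auto simp: S'_def)
      ultimately show ?thesis by blast
    qed
  qed simp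
qed

text \<open>The sets are indexed by numbers instead of listed, so that contractions and direct sums
  become re-indexings by arithmetic.\<close>

definition transversal_of :: "nat \<Rightarrow> (nat \<Rightarrow> 'a set) \<Rightarrow> 'a set \<Rightarrow> bool" where
  "transversal_of k A X \<longleftrightarrow> (\<exists>\<phi>. inj_on \<phi> X \<and> (\<forall>x\<in>X. \<phi> x < k \<and> x \<in> A (\<phi> x)))"

lemma transversal_of_subset: "transversal_of k A X \<Longrightarrow> Y \<subseteq> X \<Longrightarrow> transversal_of k A Y"
  unfolding transversal_of_def by (meson inj_on_subset subset_iff)

lemma transversal_of_cong:
  assumes "\<And>i x. i < k \<Longrightarrow> x \<in> X \<Longrightarrow> x \<in> A i \<longleftrightarrow> x \<in> A' i"
  shows "transversal_of k A X \<longleftrightarrow> transversal_of k A' X"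
  unfolding transversal_of_def using assms by meson

lemma transversal_of_hall:
  assumes "finite X" and "\<not> transversal_of k A X"
  shows "\<exists>J\<subseteq>X. card {i. i < k \<and> A i \<inter> J \<noteq> {}} < card J"
proof (rule ccontr)
  assume c: "\<not> ?thesis"
  define S where "S x = {i. i < k \<and> x \<in> A i}" for x
  have "\<Union>(S ` J) = {i. i < k \<and> A i \<inter> J \<noteq> {}}" for J by (auto simp: S_def)
  then have "card J \<le> card (\<Union>(S ` J))" if "J \<subseteq> X" for J using c that by (metis not_le)
  then obtain \<phi> where "inj_on \<phi> X" "\<forall>x\<in>X. \<phi> x \<in> S x"
    using hall_matching[OF assms(1), of S] by (auto simp: S_def)
  then show False using assms(2) unfolding transversal_of_def S_def by auto
qed

lemma transversal_of_card:
  assumes "transversal_of k A X" and "J \<subseteq> X"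
  shows "card J \<le> card {i. i < k \<and> A i \<inter> J \<noteq> {}}"
proof -
  obtain \<phi> where \<phi>: "inj_on \<phi> X" "\<forall>x\<in>X. \<phi> x < k \<and> x \<in> A (\<phi> x)"
    using assms(1) unfolding transversal_of_def by blast
  have "\<phi> ` J \<subseteq> {i. i < k \<and> A i \<inter> J \<noteq> {}}" using \<phi> assms(2) by auto
  then have "card (\<phi> ` J) \<le> card {i. i < k \<and> A i \<inter> J \<noteq> {}}" by (intro card_mono) auto
  moreover have "card (\<phi> ` J) = card J" using \<phi>(1) assms(2) by (meson card_image inj_on_subset)
  ultimately show ?thesis by simp
qed

section \<open>Sorted interval systems\<close>

definition win :: "('a \<Rightarrow> nat) \<Rightarrow> (nat \<Rightarrow> nat) \<Rightarrow> (nat \<Rightarrow> nat) \<Rightarrow> nat \<Rightarrow> 'a set" where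
  "win pos a b i = {x. a i \<le> pos x \<and> pos x < b i}"

definition sorted_windows :: "nat \<Rightarrow> (nat \<Rightarrow> nat) \<Rightarrow> (nat \<Rightarrow> nat) \<Rightarrow> bool" where
  "sorted_windows k a b \<longleftrightarrow> (\<forall>i j. i \<le> j \<longrightarrow> j < k \<longrightarrow> a i \<le> a j \<and> b i \<le> b j)"

text \<open>Windows may be empty, repeated or share an end, since deleting elements can produce all
  of these; \<open>pos\<close> may have ties, since \<open>good_lattice_like\<close> orders edges
  only by the pieces that contain them. \<open>lattice_like_strict\<close> removes this
  slack.\<close>

definition lattice_like :: "'a set \<Rightarrow> ('a set \<Rightarrow> bool) \<Rightarrow> bool" where
  "lattice_like E P \<longleftrightarrow> (\<exists>pos k a b. sorted_windows k a b \<and>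
     (\<forall>X\<subseteq>E. P X \<longleftrightarrow> transversal_of k (win pos a b) X))"

text \<open>When all pairs are comparable componentwise, sorting by the sum \<open>a i + b i\<close>
  sorts left and right ends at once. The index set is arbitrary, so the vertices of a graph can
  serve directly.\<close>

lemma lattice_likeI:
  assumes "finite J"
    and chain: "\<And>i j. i \<in> J \<Longrightarrow> j \<in> J \<Longrightarrow> (a i \<le> a j \<and> b i \<le> b j) \<or> (a j \<le> a i \<and> b j \<le> b i)"
    and P: "\<And>X. X \<subseteq> E \<Longrightarrow> P X \<longleftrightarrow>
        (\<exists>\<phi>. inj_on \<phi> X \<and> (\<forall>x\<in>X. \<phi> x \<in> J \<and> (a (\<phi> x) :: nat) \<le> pos x \<and> pos x < b (\<phi> x)))"
  shows "lattice_like E P"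
proof -
  obtain l0 where l0: "set l0 = J" "distinct l0" using assms(1) finite_distinct_list by blast
  define l where "l = sort_key (\<lambda>i. a i + b i) l0"
  have l: "set l = J" "distinct l" "sorted (map (\<lambda>i. a i + b i) l)"
    using l0 by (simp_all add: l_def)
  have srt: "a (l ! i) \<le> a (l ! j) \<and> b (l ! i) \<le> b (l ! j)" if "i \<le> j" "j < length l" for i j
  proof -
    have "a (l ! i) + b (l ! i) \<le> a (l ! j) + b (l ! j)"
      using l(3) that sorted_nth_mono[of "map (\<lambda>i. a i + b i) l" i j] by simp
    moreover have "l ! i \<in> J" "l ! j \<in> J" using l(1) that nth_mem by fastforce+
    ultimately show ?thesis using chain[of "l ! i" "l ! j"] by linarith
  qed
  have "P X \<longleftrightarrow> transversal_of (length l) (win pos (\<lambda>i. a (l ! i)) (\<lambda>i. b (l ! i))) X"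
    if X: "X \<subseteq> E" for X
  proof
    assume "P X"
    then obtain \<phi> where \<phi>: "inj_on \<phi> X"
      "\<And>x. x \<in> X \<Longrightarrow> \<phi> x \<in> J \<and> a (\<phi> x) \<le> pos x \<and> pos x < b (\<phi> x)"
      using P[OF X] by blast
    have "\<forall>x\<in>X. \<exists>i. i < length l \<and> l ! i = \<phi> x" using \<phi> l(1) by (metis in_set_conv_nth)
    then obtain \<psi> where \<psi>: "\<And>x. x \<in> X \<Longrightarrow> \<psi> x < length l \<and> l ! \<psi> x = \<phi> x" by metis
    have "inj_on \<psi> X" using \<phi>(1) \<psi> by (metis inj_on_def)
    then show "transversal_of (length l) (win pos (\<lambda>i. a (l ! i)) (\<lambda>i. b (l ! i))) X"
      unfolding transversal_of_def win_def using \<psi> \<phi> by (intro exI[of _ \<psi>]) auto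
  next
    assume "transversal_of (length l) (win pos (\<lambda>i. a (l ! i)) (\<lambda>i. b (l ! i))) X"
    then obtain \<psi> where \<psi>: "inj_on \<psi> X"
      "\<And>x. x \<in> X \<Longrightarrow> \<psi> x < length l \<and> a (l ! \<psi> x) \<le> pos x \<and> pos x < b (l ! \<psi> x)"
      unfolding transversal_of_def win_def by auto
    have "inj_on (\<lambda>x. l ! \<psi> x) X"
      using \<psi> l(2) by (auto simp: inj_on_def nth_eq_iff_index_eq)
    then show "P X" using P[OF X] \<psi> l(1) nth_mem by (metis (no_types, lifting))
  qed
  then show ?thesis unfolding lattice_like_def sorted_windows_def using srt
    by (intro exI[of _ pos] exI[of _ "length l"] exI[of _ "\<lambda>i. a (l ! i)"] exI[of _ "\<lambda>i. b (l ! i)"]) auto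
qed

lemma lattice_like_subset: "lattice_like E P \<Longrightarrow> F \<subseteq> E \<Longrightarrow> lattice_like F P"
  unfolding lattice_like_def by (meson subset_trans)

lemma lattice_like_image:
  assumes "lattice_like E P" and "inj_on g F" and "g ` F \<subseteq> E"
    and "\<And>X. X \<subseteq> F \<Longrightarrow> Q X \<longleftrightarrow> P (g ` X)"
  shows "lattice_like F Q"
proof -
  obtain pos k a b where s: "sorted_windows k a b"
    and P: "\<And>X. X \<subseteq> E \<Longrightarrow> P X \<longleftrightarrow> transversal_of k (win pos a b) X"
    using assms(1) unfolding lattice_like_def by blast
  have "Q X \<longleftrightarrow> transversal_of k (win (pos \<circ> g) a b) X" if X: "X \<subseteq> F" for X
  proof -
    have gX: "g ` X \<subseteq> E" "inj_on g X" using assms(2,3) X by (auto intro: inj_on_subset)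
    have "transversal_of k (win pos a b) (g ` X) \<longleftrightarrow> transversal_of k (win (pos \<circ> g) a b) X"
    proof
      assume "transversal_of k (win pos a b) (g ` X)"
      then obtain \<phi> where "inj_on \<phi> (g ` X)"
          "\<forall>x\<in>g ` X. \<phi> x < k \<and> a (\<phi> x) \<le> pos x \<and> pos x < b (\<phi> x)"
        unfolding transversal_of_def win_def by auto
      then show "transversal_of k (win (pos \<circ> g) a b) X"
        unfolding transversal_of_def win_def
        using gX(2) by (intro exI[of _ "\<phi> \<circ> g"]) (auto intro: comp_inj_on)
    next
      assume "transversal_of k (win (pos \<circ> g) a b) X"
      then obtain \<phi> where "inj_on \<phi> X"
          "\<forall>x\<in>X. \<phi> x < k \<and> a (\<phi> x) \<le> pos (g x) \<and> pos (g x) < b (\<phi> x)"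
        unfolding transversal_of_def win_def by auto
      then show "transversal_of k (win pos a b) (g ` X)"
        unfolding transversal_of_def win_def
        using gX(2) by (intro exI[of _ "\<phi> \<circ> inv_into X g"])
          (auto simp: inj_on_def)
    qed
    then show ?thesis using assms(4)[OF X] P[OF gX(1)] by simp
  qed
  then show ?thesis unfolding lattice_like_def using s by blast
qed

text \<open>An element \<open>e\<close> lies in a consecutive run of windows; contracting it merges each window of the
  run with its successor, which shortens the run by one.\<close>

lemma lattice_like_contract1:
  assumes like: "lattice_like E P" and e: "e \<in> E" "P {e}"
  shows "lattice_like (E - {e}) (\<lambda>X. P (insert e X))"
proof -
  obtain pos k a b where s: "sorted_windows k a b"
    and P: "\<And>X. X \<subseteq> E \<Longrightarrow> P X \<longleftrightarrow> transversal_of k (win pos a b) X"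
    using like unfolding lattice_like_def by blast
  note sw = s[unfolded sorted_windows_def, rule_format]
  define p where "p = pos e"
  define I where "I = {i. i < k \<and> a i \<le> p \<and> p < b i}"
  have "transversal_of k (win pos a b) {e}" using P e by simp
  then have "I \<noteq> {}" unfolding transversal_of_def win_def I_def p_def by auto
  have "finite I" by (simp add: I_def)
  define l where "l = Min I"
  define m where "m = Max I"
  have lm: "l \<in> I" "m \<in> I" "l \<le> m" using \<open>I \<noteq> {}\<close> \<open>finite I\<close> by (simp_all add: l_def m_def)
  have I: "i \<in> I \<longleftrightarrow> l \<le> i \<and> i \<le> m" for i
  proof
    show "i \<in> I \<Longrightarrow> l \<le> i \<and> i \<le> m" using \<open>finite I\<close> by (simp add: l_def m_def)
    assume i: "l \<le> i \<and> i \<le> m"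
    then have "i < k" using lm by (auto simp: I_def)
    moreover have "a i \<le> a m" "b l \<le> b i" using sw[of i m] sw[of l i] i lm \<open>i < k\<close>
      by (auto simp: I_def)
    ultimately show "i \<in> I" using lm by (auto simp: I_def)
  qed
  \<comment> \<open>For \<open>l \<le> i\<close> and \<open>i < m\<close> the new window runs from
    the left end of window \<open>i\<close> to the right end of window \<open>Suc i\<close>, and it
    is their union because both contain \<open>p\<close>. Windows before \<open>l\<close> are kept,
    those after \<open>m\<close> move down by one.\<close>
  define b' where "b' i = (if i < l then b i else b (Suc i))" for i
  define a' where "a' i = (if i < m then a i else a (Suc i))" for i
  have mk: "m < k" using lm by (simp add: I_def)
  have "sorted_windows (k - 1) a' b'"
    unfolding sorted_windows_def
  proof (intro allI impI)
    fix i j assume "i \<le> j" "j < k - 1"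
    then show "a' i \<le> a' j \<and> b' i \<le> b' j"
      using sw[of i j] sw[of i "Suc j"] sw[of "Suc i" "Suc j"] by (auto simp: a'_def b'_def)
  qed
  moreover have "P (insert e X) \<longleftrightarrow> transversal_of (k - 1) (win pos a' b') X"
    if X: "X \<subseteq> E - {e}" for X
  proof
    have iX: "insert e X \<subseteq> E" "e \<notin> X" using X e by auto
    {
      assume "P (insert e X)"
      then obtain \<phi> where \<phi>: "inj_on \<phi> (insert e X)"
          "\<And>x. x \<in> insert e X \<Longrightarrow> \<phi> x < k \<and> a (\<phi> x) \<le> pos x \<and> pos x < b (\<phi> x)"
        using P[OF iX(1)] unfolding transversal_of_def win_def by auto
      define c where "c = \<phi> e"
      have c: "l \<le> c" "c \<le> m" "c < k" using \<phi>(2)[of e] I[of c] by (auto simp: c_def I_def p_def)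
      have ne: "\<phi> x \<noteq> c" if "x \<in> X" for x using \<phi>(1) that iX by (auto simp: c_def inj_on_def)
      \<comment> \<open>The window \<open>c\<close> given to \<open>e\<close> is dropped and later
        indices move down by one; on either side of \<open>c\<close> the new window contains the old
        window that the element used.\<close>
      define \<psi> where "\<psi> x = (if \<phi> x < c then \<phi> x else \<phi> x - 1)" for x
      have "inj_on \<psi> X"
      proof (rule inj_onI)
        fix x y assume "x \<in> X" "y \<in> X" "\<psi> x = \<psi> y"
        then have "\<phi> x = \<phi> y" using ne[of x] ne[of y] by (auto simp: \<psi>_def split: if_splits)
        then show "x = y" using \<phi>(1) \<open>x \<in> X\<close> \<open>y \<in> X\<close> by (auto simp: inj_on_def)
      qed
      moreover have "\<psi> x < k - 1 \<and> a' (\<psi> x) \<le> pos x \<and> pos x < b' (\<psi> x)" if x: "x \<in> X" for x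
      proof (cases "\<phi> x < c")
        case True
        then have "b (\<phi> x) \<le> b (Suc (\<phi> x))" using sw[of "\<phi> x" "Suc (\<phi> x)"] c by auto
        then show ?thesis using True \<phi>(2)[of x] x c by (auto simp: \<psi>_def a'_def b'_def)
      next
        case False
        then have gt: "c < \<phi> x" using ne[OF x] by simp
        then obtain q where q: "\<phi> x = Suc q" "c \<le> q" by (cases "\<phi> x") auto
        have "a q \<le> a (Suc q)" using sw[of q "Suc q"] \<phi>(2)[of x] x q by auto
        then show ?thesis using \<phi>(2)[of x] x q c by (auto simp: \<psi>_def a'_def b'_def)
      qed
      ultimately show "transversal_of (k - 1) (win pos a' b') X"
        unfolding transversal_of_def win_def by auto
    }
    assume tr: "transversal_of (k - 1) (win pos a' b') X"
    define N where "N J = {i. i < k \<and> win pos a b i \<inter> J \<noteq> {}}" for J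
    define N' where "N' J = {i. i < k - 1 \<and> win pos a' b' i \<inter> J \<noteq> {}}" for J
    have finN: "finite (N J)" for J by (simp add: N_def)
    show "P (insert e X)"
    proof (rule ccontr)
      assume "\<not> P (insert e X)"
      then have "\<not> transversal_of k (win pos a b) (insert e X)" using P iX by simp
      moreover have "finite (insert e X)"
      proof -
        obtain \<phi> where "inj_on \<phi> X" "\<phi> ` X \<subseteq> {..<k - 1}"
          using tr unfolding transversal_of_def by auto
        then show ?thesis by (simp add: inj_on_finite)
      qed
      ultimately obtain J where J: "J \<subseteq> insert e X" "card (N J) < card J"
        using transversal_of_hall[of "insert e X" k "win pos a b"] by (auto simp: N_def)
      define J0 where "J0 = J - {e}"
      have J0: "J0 \<subseteq> X" "card J0 \<le> card (N' J0)"
        using transversal_of_card[OF tr, of J0] J by (auto simp: J0_def N'_def)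
      \<comment> \<open>A merged window that meets \<open>J0\<close> does so at or below
        \<open>p\<close>, inside the old window \<open>i\<close>, or above \<open>p\<close>, inside
        window \<open>Suc i\<close>. As \<open>a\<close> is sorted, \<open>low\<close> passes to
        smaller indices; hence keeping the low indices and shifting the others is injective.\<close>
      define low where "low i \<longleftrightarrow> (\<exists>x\<in>J0. pos x \<le> p \<and> a i \<le> pos x)" for i
      have cases: "(i < l \<and> i \<in> N J0) \<or> (l \<le> i \<and> i < m \<and> (if low i then i \<in> N J0 else Suc i \<in> N J0))
          \<or> (m \<le> i \<and> Suc i \<in> N J0)" if iN: "i \<in> N' J0" for i
      proof -
        obtain x where x: "x \<in> J0" "a' i \<le> pos x" "pos x < b' i" and i: "i < k - 1"
          using iN unfolding N'_def win_def by blast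
        consider "i < l" | "l \<le> i" "i < m" | "m \<le> i" by linarith
        then show ?thesis
        proof cases
          case 1
          then show ?thesis using x i lm by (auto simp: N_def win_def a'_def b'_def)
        next
          case 2
          then have I2: "i \<in> I" "Suc i \<in> I" using I by auto
          have x2: "a i \<le> pos x" "pos x < b (Suc i)" using x 2 by (auto simp: a'_def b'_def)
          have "i \<in> N J0" if "low i" using that I2 unfolding low_def
            by (force simp: N_def win_def I_def)
          moreover have "Suc i \<in> N J0" if "\<not> low i"
          proof -
            have "p < pos x" using that x x2 by (auto simp: low_def)
            then show ?thesis using I2 x x2 by (force simp: N_def win_def I_def)
          qed
          ultimately show ?thesis using 2 by auto
        next
          case 3
          then show ?thesis using x i lm by (auto simp: N_def win_def a'_def b'_def)
        qed
      qed
      have finN': "finite (N' J0)" by (simp add: N'_def)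
      show False
      proof (cases "e \<in> J")
        case False
        then have [simp]: "J0 = J" by (simp add: J0_def)
        define f where "f i = (if i < l \<or> (i < m \<and> low i) then i else Suc i)" for i
        have "inj_on f (N' J0)"
        proof (rule inj_onI)
          have *: False if "f i = f j" "i < j" for i j
          proof -
            have "j = Suc i" "\<not> i < l" "\<not> (i < m \<and> low i)" "j < m" "low j"
              using that by (auto simp: f_def split: if_splits)
            moreover have "a i \<le> a j" using sw[of i j] that mk \<open>j < m\<close> by auto
            ultimately show False unfolding low_def by (meson Suc_lessD order_trans)
          qed
          fix i j assume "f i = f j"
          then show "i = j" using *[of i j] *[of j i] by (metis linorder_neqE_nat)
        qed
        moreover have "f ` N' J0 \<subseteq> N J0" 
        proof (rule image_subsetI)
          fix i assume "i \<in> N' J0"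
          then show "f i \<in> N J0" using cases[of i] lm(3) by (auto simp: f_def split: if_splits)
        qed
        ultimately have "card (N' J0) \<le> card (N J0)" using finN by (metis card_image card_mono)
        then show False using J J0 by simp
      next
        case True
        define f where "f i = (if i < m then i else Suc i)" for i
        have "inj_on f (N' J0)" by (auto simp: inj_on_def f_def)
        moreover have "f ` N' J0 \<subseteq> N J - {m}"
        proof
          fix y assume "y \<in> f ` N' J0"
          then obtain i where i: "i \<in> N' J0" "y = f i" by blast
          have "N J0 \<subseteq> N J" by (auto simp: N_def J0_def)
          moreover have "I \<subseteq> N J" using True by (auto simp: N_def I_def win_def p_def)
          ultimately show "y \<in> N J - {m}" using cases[OF i(1)] i(2) I[of i] lm(3)
            by (auto simp: f_def split: if_splits)
        qed
        ultimately have "card (N' J0) \<le> card (N J - {m})" using finN by (metis card_image card_mono finite_Diff)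
        moreover have "m \<in> N J" using lm True by (auto simp: N_def I_def win_def p_def)
        ultimately have "card (N' J0) < card (N J)" using finN
          by (metis card_Diff1_less order_le_less_trans)
        moreover have "card J = Suc (card J0)" using True J \<open>finite (insert e X)\<close> unfolding J0_def
          by (metis card.remove finite_subset)
        ultimately show False using J J0 by simp
      qed
    qed
  qed
  ultimately show ?thesis unfolding lattice_like_def by blast
qed

lemma lattice_like_contract:
  assumes "finite C" and "lattice_like E P" and "C \<subseteq> E" and "P C"
    and "\<And>X Y. P X \<Longrightarrow> Y \<subseteq> X \<Longrightarrow> P Y"
  shows "lattice_like (E - C) (\<lambda>X. P (X \<union> C))"
  using assms
proof (induction C)
  case (insert e C)
  have "lattice_like (E - C) (\<lambda>X. P (X \<union> C))" using insert by (meson insert_subset subset_insertI)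
  then have "lattice_like (E - C - {e}) (\<lambda>X. P (insert e X \<union> C))"
    using insert.hyps insert.prems by (intro lattice_like_contract1) auto
  moreover have "E - C - {e} = E - insert e C" by blast
  ultimately show ?case by simp
qed simp

section \<open>Matroid exchange, and minors of sorted interval systems\<close>

lemma matroidD:
  assumes "is_matroid M"
  shows "finite (ground M)" "{} \<in> indeps M"
    "I \<in> indeps M \<Longrightarrow> I \<subseteq> ground M" "I \<in> indeps M \<Longrightarrow> finite I"
    "I \<in> indeps M \<Longrightarrow> J \<subseteq> I \<Longrightarrow> J \<in> indeps M"
    "I \<in> indeps M \<Longrightarrow> J \<in> indeps M \<Longrightarrow> card J < card I \<Longrightarrow> \<exists>x\<in>I - J. insert x J \<in> indeps M"
proof -
  note M = assms[unfolded is_matroid_def]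
  show "finite (ground M)" "{} \<in> indeps M" using M by simp_all
  show sub: "I \<subseteq> ground M" if "I \<in> indeps M" using M that by blast
  show "finite I" if "I \<in> indeps M" using sub[OF that] \<open>finite (ground M)\<close> finite_subset by blast
  show "J \<in> indeps M" if "I \<in> indeps M" "J \<subseteq> I" using M that by simp
  show "\<exists>x\<in>I - J. insert x J \<in> indeps M" if "I \<in> indeps M" "J \<in> indeps M" "card J < card I"
    using M that by simp
qed

lemma matroid_augment:
  assumes "is_matroid M" and "I \<in> indeps M" and "J \<in> indeps M" and "card J \<le> card I"
  shows "\<exists>S. S \<subseteq> I - J \<and> J \<union> S \<in> indeps M \<and> card (J \<union> S) = card I"
  using assms(3,4)
proof (induction "card I - card J" arbitrary: J)
  case 0
  then show ?case by (intro exI[of _ "{}"]) auto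
next
  case (Suc n)
  then have "card J < card I" by simp
  then obtain x where x: "x \<in> I - J" "insert x J \<in> indeps M"
    using matroidD(6)[OF assms(1,2) Suc.prems(1)] by blast
  have "finite J" using matroidD(4)[OF assms(1) Suc.prems(1)] .
  then have cj: "card (insert x J) = Suc (card J)" using x by simp
  have "n = card I - card (insert x J)" using Suc.hyps(2) cj by simp
  then obtain S where "S \<subseteq> I - insert x J" "insert x J \<union> S \<in> indeps M" "card (insert x J \<union> S) = card I"
    using Suc.hyps(1)[of "insert x J"] x(2) \<open>card J < card I\<close> cj by auto
  then show ?case using x(1) by (intro exI[of _ "insert x S"]) auto
qed

text \<open>\<open>contraction\<close> quantifies existentially over bases of \<open>C\<close>; this
  lets a contraction be computed from a single one. All bases of \<open>C\<close> have equal size,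
  and augmenting \<open>B'\<close> from \<open>I \<union> B\<close> cannot use elements of
  \<open>C\<close>, hence it must use all of \<open>I\<close>.\<close>

lemma basis_of_irrelevant:
  assumes M: "is_matroid M" and B: "basis_of M C B" and B': "basis_of M C B'"
    and I: "I \<inter> C = {}" "I \<union> B \<in> indeps M"
  shows "I \<union> B' \<in> indeps M"
proof -
  note fin = matroidD(4)[OF M]
  have BC: "B \<subseteq> C" "B' \<subseteq> C" "B \<in> indeps M" "B' \<in> indeps M"
    using B B' by (auto simp: basis_of_def)
  have max: "card X \<le> card Y" if XY: "basis_of M C X" "basis_of M C Y" for X Y
  proof (rule ccontr)
    assume "\<not> card X \<le> card Y"
    then obtain x where "x \<in> X - Y" "insert x Y \<in> indeps M"
      using matroidD(6)[OF M, of X Y] XY unfolding basis_of_def by (meson not_le)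
    then show False using XY unfolding basis_of_def by blast
  qed
  then have eq: "card B = card B'" using B B' by (simp add: order_antisym)
  have "card B' \<le> card (I \<union> B)" using eq fin[OF I(2)] by (metis card_mono sup_ge2)
  then obtain S where S: "S \<subseteq> I \<union> B - B'" "B' \<union> S \<in> indeps M" "card (B' \<union> S) = card (I \<union> B)"
    using matroid_augment[OF M I(2) BC(4)] by blast
  have SI: "S \<subseteq> I"
  proof
    fix s assume s: "s \<in> S"
    show "s \<in> I"
    proof (rule ccontr)
      assume "s \<notin> I"
      then have "s \<in> C" using s S BC by blast
      have "insert s B' \<in> indeps M" using matroidD(5)[OF M S(2), of "insert s B'"] s by blast
      then have "insert s B' = B'" using B' \<open>s \<in> C\<close> unfolding basis_of_def by blast
      then show False using s S(1) by blast
    qed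
  qed
  have finI: "finite I" "finite B" "finite B'" using fin[OF I(2)] fin[OF BC(4)] by auto
  have "card (I \<union> B) = card I + card B" using finI I(1) BC by (intro card_Un_disjoint) auto
  moreover have "card (B' \<union> S) = card B' + card S"
    using finI SI S(1) finite_subset by (intro card_Un_disjoint) auto
  ultimately have "card S = card I" using S(3) eq by simp
  then have "S = I" using SI finI by (simp add: card_subset_eq)
  then show ?thesis using S(2) by (simp add: Un_commute)
qed

lemma basis_exists:
  assumes "is_matroid M" and "C \<subseteq> ground M"
  shows "\<exists>B. basis_of M C B"
proof -
  let ?F = "{B. B \<in> indeps M \<and> B \<subseteq> C}"
  have "finite C" using assms(2) matroidD(1)[OF assms(1)] finite_subset by blast
  then have "finite ?F" by simp
  moreover have "{} \<in> ?F" using matroidD(2)[OF assms(1)] by simp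
  ultimately obtain B where "B \<in> ?F" "\<forall>X\<in>?F. B \<subseteq> X \<longrightarrow> X = B"
    using finite_has_maximal[of ?F] by (metis (no_types, lifting) empty_iff)
  then show ?thesis unfolding basis_of_def by blast
qed

abbreviation like_matroid :: "'a matroid \<Rightarrow> bool" where
  "like_matroid M \<equiv> lattice_like (ground M) (\<lambda>X. X \<in> indeps M)"

lemma lattice_like_cong:
  assumes "\<And>X. X \<subseteq> E \<Longrightarrow> P X \<longleftrightarrow> Q X"
  shows "lattice_like E P \<longleftrightarrow> lattice_like E Q"
  unfolding lattice_like_def using assms by (metis (no_types, lifting))

text \<open>Contracting \<open>C\<close> amounts to contracting a basis \<open>B\<close> of
  \<open>C\<close> and deleting the elements of \<open>C - B\<close>, so contraction of independent
  sets and restriction suffice.\<close>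

lemma like_matroid_minor:
  assumes M: "is_matroid M" and like: "like_matroid M" and N: "minor_of N M"
  shows "like_matroid N"
proof -
  obtain C D where CD: "C \<subseteq> ground M" "D \<subseteq> ground M" "C \<inter> D = {}"
      and N: "N = deletion (contraction M C) D"
    using N unfolding minor_of_def by blast
  obtain B where B: "basis_of M C B" using basis_exists[OF M CD(1)] by blast
  have BC: "B \<subseteq> C" "B \<in> indeps M" using B by (auto simp: basis_of_def)
  have "lattice_like (ground M - B) (\<lambda>X. X \<union> B \<in> indeps M)"
    using matroidD(4)[OF M BC(2)] like BC CD(1) matroidD(5)[OF M]
    by (intro lattice_like_contract) blast+
  then have "lattice_like (ground N) (\<lambda>X. X \<union> B \<in> indeps M)"
    by (rule lattice_like_subset) (use BC in \<open>auto simp: N deletion_def contraction_def\<close>)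
  moreover have eq: "X \<union> B \<in> indeps M \<longleftrightarrow> X \<in> indeps N" if X: "X \<subseteq> ground N" for X
  proof -
    have "X \<subseteq> ground M - C - D" using X by (simp add: N deletion_def contraction_def)
    then have "X \<in> indeps N \<longleftrightarrow> (\<exists>B'. basis_of M C B' \<and> X \<union> B' \<in> indeps M)"
      unfolding N deletion_def contraction_def by auto
    moreover have "X \<union> B \<in> indeps M" if "basis_of M C B'" "X \<union> B' \<in> indeps M" for B'
      using basis_of_irrelevant[OF M that(1) B _ that(2)] \<open>X \<subseteq> ground M - C - D\<close> by blast
    ultimately show ?thesis using B by blast
  qed
  ultimately show ?thesis
    using lattice_like_cong[OF eq, of "ground N" "\<lambda>X. X"] by simp
qed

lemma like_matroid_iso:
  assumes "matroid_iso M N" and "like_matroid N"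
  shows "like_matroid M"
proof -
  obtain f where f: "bij_betw f (ground M) (ground N)"
      "\<And>X. X \<subseteq> ground M \<Longrightarrow> X \<in> indeps M \<longleftrightarrow> f ` X \<in> indeps N"
    using assms(1) unfolding matroid_iso_def by blast
  show ?thesis
    using lattice_like_image[OF assms(2), of f "ground M"] f by (auto simp: bij_betw_def)
qed

lemma matroid_iso_sym:
  assumes "matroid_iso M N"
  shows "matroid_iso N M"
proof -
  obtain f where f: "bij_betw f (ground M) (ground N)"
      "\<And>X. X \<subseteq> ground M \<Longrightarrow> X \<in> indeps M \<longleftrightarrow> f ` X \<in> indeps N"
    using assms unfolding matroid_iso_def by blast
  let ?g = "inv_into (ground M) f"
  have "X \<in> indeps N \<longleftrightarrow> ?g ` X \<in> indeps M" if X: "X \<subseteq> ground N" for X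
  proof -
    have "f ` ?g ` X = X" using X f(1) by (metis bij_betw_imp_surj_on image_inv_into_cancel)
    moreover have "?g ` X \<subseteq> ground M" using X f(1) by (auto simp: bij_betw_def inv_into_into)
    ultimately show ?thesis using f(2) by metis
  qed
  then show ?thesis unfolding matroid_iso_def using bij_betw_inv_into[OF f(1)] by blast
qed

section \<open>Lattice path presentations versus sorted interval systems\<close>

lemma lattice_path_imp_like:
  assumes "lattice_path_matroid M"
  shows "like_matroid M"
proof -
  obtain es Ns where es: "distinct es" "set es = ground M"
      and iv: "\<And>N. N \<in> set Ns \<Longrightarrow> interval_of es N"
      and inc: "\<And>i j. i < length Ns \<Longrightarrow> j < length Ns \<Longrightarrow> i \<noteq> j \<Longrightarrow> \<not> Ns ! i \<subseteq> Ns ! j"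
      and iso: "matroid_iso M (transversal_matroid (ground M) Ns)"
    using assms unfolding lattice_path_matroid_def by blast
  have "\<forall>i. \<exists>p q. i < length Ns \<longrightarrow> p \<le> q \<and> q < length es \<and> Ns ! i = (!) es ` {p..q}"
    using iv unfolding interval_of_def by (metis nth_mem)
  then obtain a c where ac: "\<And>i. i < length Ns \<Longrightarrow> a i \<le> c i \<and> c i < length es \<and> Ns ! i = (!) es ` {a i..c i}"
    by metis
  have "\<forall>x\<in>ground M. \<exists>p. p < length es \<and> es ! p = x" using es by (metis in_set_conv_nth)
  then obtain pos where pos: "\<And>x. x \<in> ground M \<Longrightarrow> pos x < length es \<and> es ! pos x = x" by metis
  have mem: "x \<in> Ns ! i \<longleftrightarrow> a i \<le> pos x \<and> pos x < Suc (c i)" if "x \<in> ground M" "i < length Ns" for x i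
  proof -
    have "x \<in> Ns ! i \<longleftrightarrow> (\<exists>p. a i \<le> p \<and> p \<le> c i \<and> es ! p = x)"
      using ac[OF that(2)] by (auto simp: image_iff)
    also have "\<dots> \<longleftrightarrow> a i \<le> pos x \<and> pos x \<le> c i"
    proof
      assume "\<exists>p. a i \<le> p \<and> p \<le> c i \<and> es ! p = x"
      then obtain p where p: "a i \<le> p" "p \<le> c i" "es ! p = x" by blast
      then have "p = pos x"
        using pos[OF that(1)] ac[OF that(2)] es(1) by (metis le_less_trans nth_eq_iff_index_eq)
      then show "a i \<le> pos x \<and> pos x \<le> c i" using p by simp
    qed (use pos[OF that(1)] in auto)
    finally show ?thesis by auto
  qed
  have "lattice_like (ground M) (\<lambda>X. X \<in> indeps (transversal_matroid (ground M) Ns))"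
  proof (rule lattice_likeI[of "{..<length Ns}" a "\<lambda>i. Suc (c i)"])
    fix i j assume ij: "i \<in> {..<length Ns}" "j \<in> {..<length Ns}"
    \<comment> \<open>If the left ends and the right ends were ordered oppositely, one interval
      would contain the other.\<close>
    have *: "a i \<le> a j \<Longrightarrow> c j \<le> c i \<Longrightarrow> Ns ! j \<subseteq> Ns ! i" if "i < length Ns" "j < length Ns" for i j
      using ac[of i] ac[of j] that by (auto simp: image_iff)
    show "a i \<le> a j \<and> Suc (c i) \<le> Suc (c j) \<or> a j \<le> a i \<and> Suc (c j) \<le> Suc (c i)"
    proof (cases "i = j")
      case False
      then show ?thesis using *[of i j] *[of j i] inc[of i j] inc[of j i] ij by fastforce
    qed simp
  next
    fix X assume X: "X \<subseteq> ground M"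
    show "X \<in> indeps (transversal_matroid (ground M) Ns) \<longleftrightarrow>
      (\<exists>\<phi>. inj_on \<phi> X \<and> (\<forall>x\<in>X. \<phi> x \<in> {..<length Ns} \<and> a (\<phi> x) \<le> pos x \<and> pos x < Suc (c (\<phi> x))))"
      unfolding transversal_matroid_def partial_transversal_def
      using X mem by (simp add: subset_iff) (metis (no_types, lifting))
  qed simp
  then have "like_matroid (transversal_matroid (ground M) Ns)"
    by (simp add: transversal_matroid_def)
  then show ?thesis using like_matroid_iso[OF iso] by blast
qed

text \<open>An exchange: if \<open>x\<close> was matched to the larger set \<open>A j\<close>, it
  can take \<open>A i\<close> instead, and the element that used \<open>A i\<close> moves to
  \<open>A j\<close>, which contains it.\<close>

lemma transversal_remove_nested:
  assumes ij: "i < k" "j < k" "i \<noteq> j" and A: "A i \<subseteq> A j" "x \<in> A i"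
  shows "transversal_of k (A(j := A j - {x})) X \<longleftrightarrow> transversal_of k A X"
proof
  assume "transversal_of k (A(j := A j - {x})) X"
  then obtain \<phi> where "inj_on \<phi> X" "\<forall>y\<in>X. \<phi> y < k \<and> y \<in> (A(j := A j - {x})) (\<phi> y)"
    unfolding transversal_of_def by blast
  then show "transversal_of k A X" unfolding transversal_of_def
    by (intro exI[of _ \<phi>]) (auto split: if_splits)
next
  assume "transversal_of k A X"
  then obtain \<phi> where \<phi>: "inj_on \<phi> X" "\<forall>y\<in>X. \<phi> y < k \<and> y \<in> A (\<phi> y)"
    unfolding transversal_of_def by blast
  show "transversal_of k (A(j := A j - {x})) X"
  proof (cases "x \<in> X \<and> \<phi> x = j")
    case False
    then show ?thesis unfolding transversal_of_def using \<phi> by (intro exI[of _ \<phi>]) auto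
  next
    case True
    define \<psi> where "\<psi> y = (if y = x then i else if \<phi> y = i then j else \<phi> y)" for y
    have "inj_on \<psi> X"
    proof (rule inj_onI)
      fix y z assume yz: "y \<in> X" "z \<in> X" "\<psi> y = \<psi> z"
      have w: "w = x" if "w \<in> X" "\<phi> w = j" for w using that True inj_onD[OF \<phi>(1), of w x] by simp
      have "\<phi> y = \<phi> z" using yz True ij(3) w[of y] w[of z] unfolding \<psi>_def by (metis (full_types))
      then show "y = z" using inj_onD[OF \<phi>(1)] yz(1,2) by blast
    qed
    moreover have "\<forall>y\<in>X. \<psi> y < k \<and> y \<in> (A(j := A j - {x})) (\<psi> y)"
    proof
      fix y assume y: "y \<in> X"
      then have "\<phi> y = j \<longrightarrow> y = x" using True \<phi>(1) by (auto simp: inj_on_def)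
      then show "\<psi> y < k \<and> y \<in> (A(j := A j - {x})) (\<psi> y)"
        using \<phi>(2) y ij A by (auto simp: \<psi>_def)
    qed
    ultimately show ?thesis unfolding transversal_of_def by blast
  qed
qed

lemma transversal_drop_empty:
  assumes "i < k" and "A i \<inter> X = {}"
  shows "transversal_of (k - 1) (\<lambda>l. A (if l < i then l else Suc l)) X \<longleftrightarrow> transversal_of k A X"
proof
  assume "transversal_of (k - 1) (\<lambda>l. A (if l < i then l else Suc l)) X"
  then obtain \<phi> where \<phi>: "inj_on \<phi> X" "\<forall>y\<in>X. \<phi> y < k - 1 \<and> y \<in> A (if \<phi> y < i then \<phi> y else Suc (\<phi> y))"
    unfolding transversal_of_def by blast
  let ?\<psi> = "\<lambda>y. if \<phi> y < i then \<phi> y else Suc (\<phi> y)"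
  have "inj_on ?\<psi> X" using \<phi>(1) by (auto simp: inj_on_def split: if_splits)
  moreover have "\<forall>y\<in>X. ?\<psi> y < k \<and> y \<in> A (?\<psi> y)" using \<phi>(2) assms(1) by force
  ultimately show "transversal_of k A X" unfolding transversal_of_def by blast
next
  assume "transversal_of k A X"
  then obtain \<phi> where \<phi>: "inj_on \<phi> X" "\<forall>y\<in>X. \<phi> y < k \<and> y \<in> A (\<phi> y)"
    unfolding transversal_of_def by blast
  have ne: "\<phi> y \<noteq> i" if "y \<in> X" for y using \<phi>(2) that assms(2) by auto
  let ?\<psi> = "\<lambda>y. if \<phi> y < i then \<phi> y else \<phi> y - 1"
  have "inj_on ?\<psi> X"
  proof (rule inj_onI)
    fix y z assume "y \<in> X" "z \<in> X" "?\<psi> y = ?\<psi> z"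
    then have "\<phi> y = \<phi> z" using ne[of y] ne[of z] by (auto split: if_splits)
    then show "y = z" using \<phi>(1) \<open>y \<in> X\<close> \<open>z \<in> X\<close> by (auto simp: inj_on_def)
  qed
  moreover have "?\<psi> y < k - 1 \<and> y \<in> A (if ?\<psi> y < i then ?\<psi> y else Suc (?\<psi> y))" if "y \<in> X" for y
    using \<phi>(2) ne[OF that] that assms(1) by auto
  ultimately show "transversal_of (k - 1) (\<lambda>l. A (if l < i then l else Suc l)) X"
    unfolding transversal_of_def by (intro exI[of _ ?\<psi>]) blast
qed

text \<open>Among all sorted interval presentations, one of minimal total length has strictly increasing
  left and right ends: an endpoint shared by two nested intervals can be removed from the larger.\<close>

lemma lattice_like_strict:
  assumes fin: "finite E" and like: "lattice_like E P"
  shows "\<exists>es k a b. distinct es \<and> set es = E \<and> (\<forall>i<k. a i < b i \<and> b i \<le> length es) \<and>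
     (\<forall>i j. i < j \<longrightarrow> j < k \<longrightarrow> a i < a j \<and> b i < b j) \<and>
     (\<forall>X\<subseteq>E. P X \<longleftrightarrow> transversal_of k (\<lambda>i. (!) es ` {a i..<b i}) X)"
proof -
  obtain pos k0 a0 b0 where s0: "sorted_windows k0 a0 b0"
    and P0: "\<And>X. X \<subseteq> E \<Longrightarrow> P X \<longleftrightarrow> transversal_of k0 (win pos a0 b0) X"
    using like unfolding lattice_like_def by blast
  obtain l0 where l0: "set l0 = E" "distinct l0" using fin finite_distinct_list by blast
  define es where "es = sort_key pos l0"
  have es: "set es = E" "distinct es" "sorted (map pos es)" using l0 by (simp_all add: es_def)
  have "\<forall>x\<in>E. \<exists>p. p < length es \<and> es ! p = x" using es by (metis in_set_conv_nth)
  then obtain idx where idx: "\<And>x. x \<in> E \<Longrightarrow> idx x < length es \<and> es ! idx x = x" by metis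
  have idx_nth: "idx (es ! p) = p" if "p < length es" for p
    using idx[of "es ! p"] that es by (metis nth_eq_iff_index_eq nth_mem)
  have inj: "inj_on idx E" using idx by (metis inj_onI)
  have sr: "pos x \<le> pos y" if "x \<in> E" "y \<in> E" "idx x \<le> idx y" for x y
    using sorted_nth_mono[OF es(3), of "idx x" "idx y"] that idx by force
  \<comment> \<open>This replaces the values of \<open>pos\<close>, which may tie, by list indices:
    counting the elements below \<open>t\<close> turns a threshold on \<open>pos\<close> into an
    equivalent threshold on \<open>idx\<close>.\<close>
  define c where "c t = card {y \<in> E. pos y < t}" for t
  have c: "t \<le> pos x \<longleftrightarrow> c t \<le> idx x" if x: "x \<in> E" for x t
  proof
    assume t: "t \<le> pos x"
    have "idx ` {y \<in> E. pos y < t} \<subseteq> {..<idx x}" using sr[OF x] t by force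
    then have "card (idx ` {y \<in> E. pos y < t}) \<le> idx x" by (metis card_lessThan card_mono finite_lessThan)
    then show "c t \<le> idx x" unfolding c_def
      by (subst (asm) card_image) (auto intro: inj_on_subset[OF inj])
  next
    assume t: "c t \<le> idx x"
    show "t \<le> pos x"
    proof (rule ccontr)
      assume n: "\<not> t \<le> pos x"
      have "(!) es ` {..idx x} \<subseteq> {y \<in> E. pos y < t}"
      proof (rule image_subsetI)
        fix p assume p: "p \<in> {..idx x}"
        then have "p < length es" using idx[OF x] by auto
        then have "es ! p \<in> E" "idx (es ! p) = p" using es idx_nth by auto
        then show "es ! p \<in> {y \<in> E. pos y < t}" using sr[of "es ! p" x] x p n by auto
      qed
      then have "card ((!) es ` {..idx x}) \<le> c t" unfolding c_def using fin by (intro card_mono) auto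
      moreover have "card ((!) es ` {..idx x}) = card {..idx x}"
        using idx[OF x] es(2) by (intro card_image) (auto simp: inj_on_def nth_eq_iff_index_eq)
      ultimately show False using t by simp
    qed
  qed
  have cmono: "c s \<le> c t" if "s \<le> t" for s t
    unfolding c_def using fin that by (intro card_mono) auto
  have cle: "c t \<le> length es" for t
  proof -
    have "c t \<le> card E" unfolding c_def using fin by (intro card_mono) auto
    then show ?thesis using es distinct_card by metis
  qed
  define rep where "rep = (\<lambda>(k, a, b). sorted_windows k a b \<and> (\<forall>i<k. b i \<le> length es) \<and>
      (\<forall>X\<subseteq>E. P X \<longleftrightarrow> transversal_of k (win idx a b) X))"
  \<comment> \<open>The \<open>Suc\<close> charges for the window itself, so that discarding an
    empty window also lowers the total.\<close>
  define m where "m = (\<lambda>(k :: nat, a :: nat \<Rightarrow> nat, b). \<Sum>i<k. Suc (b i - a i))"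
  have "rep (k0, \<lambda>i. c (a0 i), \<lambda>i. c (b0 i))"
  proof -
    have "transversal_of k0 (win pos a0 b0) X \<longleftrightarrow> transversal_of k0 (win idx (\<lambda>i. c (a0 i)) (\<lambda>i. c (b0 i))) X"
      if "X \<subseteq> E" for X
    proof (rule transversal_of_cong)
      fix i x assume "x \<in> X"
      then have "x \<in> E" using that by blast
      then show "x \<in> win pos a0 b0 i \<longleftrightarrow> x \<in> win idx (\<lambda>i. c (a0 i)) (\<lambda>i. c (b0 i)) i"
        using c[of x "a0 i"] c[of x "b0 i"] by (auto simp: win_def)
    qed
    then show ?thesis using s0 P0 cmono cle unfolding rep_def sorted_windows_def by auto
  qed
  then obtain r where r: "rep r" "\<And>r'. rep r' \<Longrightarrow> m r \<le> m r'"
    using ex_has_least_nat[of rep _ m] by blast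
  obtain k a b where kab: "r = (k, a, b)" by (cases r)
  have s: "\<And>i j. i \<le> j \<Longrightarrow> j < k \<Longrightarrow> a i \<le> a j \<and> b i \<le> b j"
    and bl: "\<And>i. i < k \<Longrightarrow> b i \<le> length es"
    and P: "\<And>X. X \<subseteq> E \<Longrightarrow> P X \<longleftrightarrow> transversal_of k (win idx a b) X"
    using r(1) unfolding kab rep_def sorted_windows_def by auto
  have min: "(\<Sum>i<k. Suc (b i - a i)) \<le> (\<Sum>i<k'. Suc (b' i - a' i))" if "rep (k', a', b')" for k' a' b'
    using r(2)[OF that] by (simp add: kab m_def)
  have ne: "a i < b i" if i: "i < k" for i
  proof (rule ccontr)
    assume n: "\<not> a i < b i"
    define g where "g l = (if l < i then l else Suc l)" for l
    have "rep (k - 1, \<lambda>l. a (g l), \<lambda>l. b (g l))"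
    proof -
      have "transversal_of (k - 1) (win idx (\<lambda>l. a (g l)) (\<lambda>l. b (g l))) X \<longleftrightarrow> P X" if "X \<subseteq> E" for X
      proof -
        have "win idx a b i \<inter> X = {}" using n by (auto simp: win_def)
        then show ?thesis
          using transversal_drop_empty[of i k "win idx a b" X] i P[OF that]
          by (simp add: g_def[abs_def] win_def[abs_def])
      qed
      moreover have "a (g p) \<le> a (g q) \<and> b (g p) \<le> b (g q)" if "p \<le> q" "q < k - 1" for p q
        using s[of "g p" "g q"] that by (auto simp: g_def)
      moreover have "b (g p) \<le> length es" if "p < k - 1" for p using bl[of "g p"] that by (auto simp: g_def)
      ultimately show ?thesis by (simp add: rep_def sorted_windows_def)
    qed
    then have "(\<Sum>i<k. Suc (b i - a i)) \<le> (\<Sum>l<k - 1. Suc (b (g l) - a (g l)))" by (rule min)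
    also have "\<dots> = (\<Sum>l\<in>g ` {..<k - 1}. Suc (b l - a l))"
      by (subst sum.reindex) (auto simp: inj_on_def g_def split: if_splits)
    also have "\<dots> \<le> (\<Sum>l\<in>{..<k} - {i}. Suc (b l - a l))"
      using i by (intro sum_mono2) (auto simp: g_def)
    finally show False using i by (simp add: sum.remove[of "{..<k}" i])
  qed
  have shrink: "transversal_of k A X \<longleftrightarrow> P X"
    if "X \<subseteq> E" and ij: "i < k" "j < k" "i \<noteq> j" and n: "a j \<le> a i" "b i \<le> b j"
      and t: "a i \<le> t" "t < b i"
      and A: "\<And>l x. x \<in> E \<Longrightarrow> l < k \<Longrightarrow> x \<in> A l \<longleftrightarrow> x \<in> win idx a b l \<and> \<not> (l = j \<and> idx x = t)"
    for X A i j t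
  proof -
    define W where "W = win idx a b"
    have tl: "t < length es" using t bl[OF ij(1)] by simp
    then have et: "idx (es ! t) = t" "es ! t \<in> E" using idx_nth es by auto
    have "transversal_of k A X \<longleftrightarrow> transversal_of k (W(j := W j - {es ! t})) X"
    proof (rule transversal_of_cong)
      fix l x assume l: "l < k" "x \<in> X"
      then have xE: "x \<in> E" using that(1) by blast
      then have "idx x = t \<longleftrightarrow> x = es ! t" using et idx by metis
      then show "x \<in> A l \<longleftrightarrow> x \<in> (W(j := W j - {es ! t})) l" using A[OF xE l(1)] by (auto simp: W_def)
    qed
    also have "\<dots> \<longleftrightarrow> transversal_of k W X"
    proof (rule transversal_remove_nested[OF ij])
      show "W i \<subseteq> W j" using n by (auto simp: W_def win_def)
      show "es ! t \<in> W i" using t et by (auto simp: W_def win_def)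
    qed
    finally show ?thesis using P[OF that(1)] by (simp add: W_def)
  qed
  have less: "(\<Sum>i<k. Suc (b' i - a' i)) < (\<Sum>i<k. Suc (b i - a i))"
    if "j < k" "b' j - a' j < b j - a j" "\<And>l. l \<noteq> j \<Longrightarrow> b' l - a' l = b l - a l" for b' a' j
  proof (rule sum_strict_mono_ex1)
    show "\<forall>l\<in>{..<k}. Suc (b' l - a' l) \<le> Suc (b l - a l)"
      using that(2,3) by (metis Suc_le_mono less_imp_le_nat order_refl)
    show "\<exists>l\<in>{..<k}. Suc (b' l - a' l) < Suc (b l - a l)" using that(1,2) by auto
  qed simp
  have sa: "a i < a (Suc i)" if i: "Suc i < k" for i
  proof (rule ccontr)
    assume "\<not> a i < a (Suc i)"
    then have "a i = a (Suc i)" using s[of i "Suc i"] i by simp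
    define Q where "Q i \<longleftrightarrow> Suc i < k \<and> a i = a (Suc i)" for i
    have "Q i" "\<forall>y. Q y \<longrightarrow> y \<le> k" using i \<open>a i = a (Suc i)\<close> by (auto simp: Q_def)
    \<comment> \<open>Windows \<open>p\<close> and \<open>Suc p\<close> share a left end, so the
      second contains the first and can lose that element. The last such \<open>p\<close> is taken
      because raising \<open>a (Suc p)\<close> by one then does not pass any later left end.\<close>
    define p where "p = (GREATEST i. Q i)"
    have "Q p" unfolding p_def using GreatestI_nat[of Q i k] \<open>Q i\<close> \<open>\<forall>y. Q y \<longrightarrow> y \<le> k\<close> by blast
    then have p: "Suc p < k" "a p = a (Suc p)" by (auto simp: Q_def)
    have gt: "a (Suc p) < a q" if q: "Suc p < q" "q < k" for q
    proof -
      have "\<not> Q (Suc p)"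
        using Greatest_le_nat[of Q "Suc p" k] \<open>\<forall>y. Q y \<longrightarrow> y \<le> k\<close> by (auto simp: p_def)
      then have "a (Suc p) < a (Suc (Suc p))" using s[of "Suc p" "Suc (Suc p)"] q by (auto simp: Q_def)
      then show ?thesis using s[of "Suc (Suc p)" q] q by simp
    qed
    define a' where "a' = a(Suc p := Suc (a (Suc p)))"
    have "rep (k, a', b)"
      unfolding rep_def
    proof (simp, intro conjI allI impI)
      show "sorted_windows k a' b" unfolding sorted_windows_def
      proof (intro allI impI)
        fix i j assume "i \<le> j" "j < k"
        then show "a' i \<le> a' j \<and> b i \<le> b j" using s[of i j] gt[of j] by (auto simp: a'_def)
      qed
      fix X assume "X \<subseteq> E"
      show "P X \<longleftrightarrow> transversal_of k (win idx a' b) X"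
      proof -
        have "x \<in> win idx a' b l \<longleftrightarrow> x \<in> win idx a b l \<and> \<not> (l = Suc p \<and> idx x = a p)" for l x
          using p by (auto simp: win_def a'_def)
        then show ?thesis
          using shrink[OF \<open>X \<subseteq> E\<close>, of p "Suc p" "a p" "win idx a' b"] p s[of p "Suc p"] ne[of p] by auto
      qed
    qed (use bl in auto)
    then have "(\<Sum>i<k. Suc (b i - a i)) \<le> (\<Sum>i<k. Suc (b i - a' i))" by (rule min)
    moreover have "(\<Sum>i<k. Suc (b i - a' i)) < (\<Sum>i<k. Suc (b i - a i))"
      using less[of "Suc p" b a'] p ne[of "Suc p"] by (auto simp: a'_def)
    ultimately show False by simp
  qed
  have sb: "b i < b (Suc i)" if i: "Suc i < k" for i
  proof (rule ccontr)
    assume "\<not> b i < b (Suc i)"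
    then have "b i = b (Suc i)" using s[of i "Suc i"] i by simp
    define Q where "Q i \<longleftrightarrow> Suc i < k \<and> b i = b (Suc i)" for i
    have "Q i" using i \<open>b i = b (Suc i)\<close> by (auto simp: Q_def)
    \<comment> \<open>Mirror image: with a shared right end it is window \<open>p\<close> that
      contains the other one, and the first such index leaves room to lower \<open>b p\<close>
      without passing an earlier right end.\<close>
    define p where "p = (LEAST i. Q i)"
    have "Q p" unfolding p_def using \<open>Q i\<close> by (rule LeastI)
    then have p: "Suc p < k" "b p = b (Suc p)" by (auto simp: Q_def)
    have lt: "b q < b p" if q: "q < p" for q
    proof -
      have "\<not> Q (p - 1)" using q not_less_Least[of "p - 1" Q] by (auto simp: p_def)
      then have "b (p - 1) < b p" using s[of "p - 1" p] q p by (auto simp: Q_def)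
      moreover have "b q \<le> b (p - 1)" using s[of q "p - 1"] q p(1) by simp
      ultimately show ?thesis by simp
    qed
    define b' where "b' = b(p := b p - 1)"
    have "rep (k, a, b')"
      unfolding rep_def
    proof (simp, intro conjI allI impI)
      show "sorted_windows k a b'" unfolding sorted_windows_def
      proof (intro allI impI)
        fix i j assume "i \<le> j" "j < k"
        then show "a i \<le> a j \<and> b' i \<le> b' j" using s[of i j] lt[of i] by (auto simp: b'_def)
      qed
      show "b' i \<le> length es" if "i < k" for i using bl[OF that] by (auto simp: b'_def)
      fix X assume "X \<subseteq> E"
      show "P X \<longleftrightarrow> transversal_of k (win idx a b') X"
      proof -
        have "x \<in> win idx a b' l \<longleftrightarrow> x \<in> win idx a b l \<and> \<not> (l = p \<and> idx x = b p - 1)" for l x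
          by (auto simp: win_def b'_def)
        moreover have "a (Suc p) \<le> b p - 1" "b p - 1 < b (Suc p)" using p ne[of "Suc p"] by auto
        ultimately show ?thesis
          using shrink[OF \<open>X \<subseteq> E\<close>, of "Suc p" p "b p - 1" "win idx a b'"] p s[of p "Suc p"] by auto
      qed
    qed
    then have "(\<Sum>i<k. Suc (b i - a i)) \<le> (\<Sum>i<k. Suc (b' i - a i))" by (rule min)
    moreover have "(\<Sum>i<k. Suc (b' i - a i)) < (\<Sum>i<k. Suc (b i - a i))"
      using less[of p b' a] p ne[of p] by (auto simp: b'_def)
    ultimately show False by simp
  qed
  have strict: "a i < a j \<and> b i < b j" if "i < j" "j < k" for i j
    using that
  proof (induction j)
    case (Suc j)
    then show ?case using sa[of j] sb[of j] by (cases "i = j") (auto intro: less_trans)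
  qed simp
  have "transversal_of k (win idx a b) X \<longleftrightarrow> transversal_of k (\<lambda>i. (!) es ` {a i..<b i}) X" if "X \<subseteq> E" for X
  proof (rule transversal_of_cong)
    fix i x assume "i < k" "x \<in> X"
    then have x: "x \<in> E" using that by blast
    show "x \<in> win idx a b i \<longleftrightarrow> x \<in> (!) es ` {a i..<b i}"
    proof
      assume "x \<in> win idx a b i"
      then show "x \<in> (!) es ` {a i..<b i}"
        using idx[OF x] by (intro image_eqI[of _ _ "idx x"]) (auto simp: win_def)
    next
      assume "x \<in> (!) es ` {a i..<b i}"
      then obtain p where "a i \<le> p" "p < b i" "x = es ! p" by auto
      then show "x \<in> win idx a b i" using idx_nth[of p] bl[OF \<open>i < k\<close>] by (simp add: win_def)
    qed
  qed
  then show ?thesis using es P ne bl strict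
    by (intro exI[of _ es] exI[of _ k] exI[of _ a] exI[of _ b]) auto
qed

lemma like_imp_lattice_path:
  assumes M: "is_matroid M" and like: "like_matroid M"
  shows "lattice_path_matroid M"
proof -
  obtain es k a b where es: "distinct es" "set es = ground M"
    and ab: "\<And>i. i < k \<Longrightarrow> a i < b i \<and> b i \<le> length es"
    and st: "\<And>i j. i < j \<Longrightarrow> j < k \<Longrightarrow> a i < a j \<and> b i < b j"
    and P: "\<And>X. X \<subseteq> ground M \<Longrightarrow> X \<in> indeps M \<longleftrightarrow> transversal_of k (\<lambda>i. (!) es ` {a i..<b i}) X"
    using lattice_like_strict[OF matroidD(1)[OF M] like] by (elim exE conjE) auto
  define Ns where "Ns = map (\<lambda>i. (!) es ` {a i..<b i}) [0..<k]"
  have len: "length Ns = k" and nth: "\<And>i. i < k \<Longrightarrow> Ns ! i = (!) es ` {a i..<b i}"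
    by (simp_all add: Ns_def)
  have "interval_of es (Ns ! i)" if "i < k" for i
    unfolding interval_of_def using ab[OF that] nth[OF that]
    by (intro exI[of _ "a i"] exI[of _ "b i - 1"]) (auto simp: atLeastLessThanSuc_atLeastAtMost[symmetric])
  then have "\<forall>N\<in>set Ns. interval_of es N" using len by (metis in_set_conv_nth)
  moreover have "\<not> Ns ! i \<subseteq> Ns ! j" if ij: "i < k" "j < k" "i \<noteq> j" for i j
  proof -
    have mem: "es ! p \<in> Ns ! l \<longleftrightarrow> a l \<le> p \<and> p < b l" if "l < k" "p < length es" for l p
      using that es(1) ab[OF that(1)] nth[OF that(1)]
      by (auto simp: image_iff nth_eq_iff_index_eq)
    consider "i < j" | "j < i" using ij by linarith
    then show ?thesis
    proof cases
      case 1
      have "es ! a i \<in> Ns ! i" "es ! a i \<notin> Ns ! j"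
        using 1 mem[of i "a i"] mem[of j "a i"] ab[of i] ij st[of i j] by auto
      then show ?thesis by blast
    next
      case 2
      have "b i - 1 < length es" "\<not> b i - 1 < b j" using ab[of i] ij st[of j i] 2 by auto
      then have "es ! (b i - 1) \<in> Ns ! i" "es ! (b i - 1) \<notin> Ns ! j"
        using 2 mem[of i "b i - 1"] mem[of j "b i - 1"] ab[of i] ij st[of j i]
        by (auto dest: leD)
      then show ?thesis by blast
    qed
  qed
  moreover have "X \<in> indeps M \<longleftrightarrow> id ` X \<in> indeps (transversal_matroid (ground M) Ns)"
    if "X \<subseteq> ground M" for X
  proof -
    have "transversal_of k (\<lambda>i. (!) es ` {a i..<b i}) X \<longleftrightarrow> transversal_of k ((!) Ns) X"
      by (rule transversal_of_cong) (simp add: nth)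
    then show ?thesis using P[OF that] that
      unfolding transversal_matroid_def partial_transversal_def transversal_of_def len by simp
  qed
  then have "matroid_iso M (transversal_matroid (ground M) Ns)"
    unfolding matroid_iso_def by (intro exI[of _ id]) (auto simp: transversal_matroid_def)
  ultimately show ?thesis unfolding lattice_path_matroid_def using M es len by blast
qed

section \<open>Circuits and spans in a lattice path ordering\<close>

definition circuit_in :: "'a set \<Rightarrow> ('a set \<Rightarrow> bool) \<Rightarrow> 'a set \<Rightarrow> bool" where
  "circuit_in E P C \<longleftrightarrow> finite C \<and> C \<subseteq> E \<and> \<not> P C \<and> (\<forall>c\<in>C. P (C - {c}))"

definition off_span :: "('a set \<Rightarrow> bool) \<Rightarrow> 'a set \<Rightarrow> 'a \<Rightarrow> bool" where
  "off_span P C y \<longleftrightarrow> y \<notin> C \<and> (\<exists>c\<in>C. P (insert y (C - {c})))"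

text \<open>\<open>off_span P C y\<close> says that \<open>y\<close> is not spanned by the circuit \<open>C\<close>. In a lattice path
  ordering the span of \<open>C\<close> is an interval, and so is the span of everything up to (or from) \<open>C\<close>.\<close>

lemma lattice_like_circuits:
  assumes "lattice_like E P"
  shows "\<exists>pos :: 'a \<Rightarrow> nat. \<forall>C y. circuit_in E P C \<longrightarrow> y \<in> E \<longrightarrow> off_span P C y \<longrightarrow>
    ((\<forall>x\<in>C. pos x < pos y) \<and> (\<forall>I\<subseteq>E. P I \<longrightarrow> \<not> P (insert y I) \<longrightarrow> (\<exists>i\<in>I. \<forall>x\<in>C. pos x < pos i))) \<or>
    ((\<forall>x\<in>C. pos y < pos x) \<and> (\<forall>I\<subseteq>E. P I \<longrightarrow> \<not> P (insert y I) \<longrightarrow> (\<exists>i\<in>I. \<forall>x\<in>C. pos i < pos x)))"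
proof -
  obtain pos k a b where s: "sorted_windows k a b"
    and P: "\<And>X. X \<subseteq> E \<Longrightarrow> P X \<longleftrightarrow> transversal_of k (win pos a b) X"
    using assms unfolding lattice_like_def by blast
  note sw = s[unfolded sorted_windows_def, rule_format]
  define N where "N J = {i. i < k \<and> win pos a b i \<inter> J \<noteq> {}}" for J
  have finN: "finite (N J)" for J by (simp add: N_def)
  have cardN: "card J \<le> card (N J)" if "P J" "J \<subseteq> E" for J
    using transversal_of_card[of k "win pos a b" J J] that P by (simp add: N_def)
  show ?thesis
  proof (intro exI[of _ pos] allI impI)
    fix C y assume C: "circuit_in E P C" and y: "y \<in> E" "off_span P C y"
    have CE: "finite C" "C \<subseteq> E" "\<not> P C" "\<And>c. c \<in> C \<Longrightarrow> P (C - {c})" using C by (auto simp: circuit_in_def)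
    have mono: "P X" if "P Y" "X \<subseteq> Y" "Y \<subseteq> E" for X Y
      using P[of X] P[of Y] that transversal_of_subset[of k _ Y X] by blast
    \<comment> \<open>A Hall violator inside a circuit can only be the whole circuit, since its
      proper subsets are independent. So fewer than \<open>card C\<close> windows meet
      \<open>C\<close>.\<close>
    have NC: "card (N C) < card C"
    proof -
      obtain J where J: "J \<subseteq> C" "card (N J) < card J"
        using transversal_of_hall[OF CE(1), of k "win pos a b"] CE P by (auto simp: N_def)
      have "J = C"
      proof (rule ccontr)
        assume "J \<noteq> C"
        then obtain c where "c \<in> C" "J \<subseteq> C - {c}" using J by blast
        then have "P J" using mono[OF CE(4)[of c]] CE(2) by blast
        then show False using cardN[of J] J CE(2) by auto
      qed
      then show ?thesis using J by simp
    qed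
    obtain c where c: "c \<in> C" "P (insert y (C - {c}))" "y \<notin> C" using y(2) by (auto simp: off_span_def)
    \<comment> \<open>If every window at \<open>y\<close> met \<open>C\<close>, exchanging some
      \<open>c\<close> for \<open>y\<close> would put \<open>card C\<close> independent elements
      into fewer windows. So some window \<open>t\<close> contains \<open>y\<close> and misses
      \<open>C\<close>.\<close>
    have nsub: "\<not> N {y} \<subseteq> N C"
    proof
      assume "N {y} \<subseteq> N C"
      then have "N (insert y (C - {c})) \<subseteq> N C" by (auto simp: N_def)
      then have "card (N (insert y (C - {c}))) \<le> card (N C)" using finN by (simp add: card_mono)
      moreover have "card (insert y (C - {c})) \<le> card (N (insert y (C - {c})))"
        using c CE y by (intro cardN) auto
      moreover have "card (insert y (C - {c})) = card C" using c CE
        by (metis Diff_iff card.insert card_Suc_Diff1 finite_Diff)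
      ultimately show False using NC by simp
    qed
    obtain t where "t \<in> N {y}" "t \<notin> N C" using nsub by blast
    then have t: "t < k" "a t \<le> pos y" "pos y < b t" "\<And>x. x \<in> C \<Longrightarrow> pos x < a t \<or> b t \<le> pos x"
      by (force simp: N_def win_def not_le)+
    \<comment> \<open>A window that meets \<open>C\<close> on both sides of \<open>t\<close> would
      strictly contain window \<open>t\<close>, against sortedness. The two sides of
      \<open>C\<close> would thus use disjoint sets of windows, and as both are independent,
      \<open>C\<close> would have enough of them.\<close>
    have side: "(\<forall>x\<in>C. pos x < a t) \<or> (\<forall>x\<in>C. b t \<le> pos x)"
    proof (rule ccontr)
      assume n: "\<not> ?thesis"
      define CL where "CL = {x \<in> C. pos x < a t}"
      define CR where "CR = {x \<in> C. b t \<le> pos x}"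
      have U: "CL \<union> CR = C" "CL \<inter> CR = {}" using t by (auto simp: CL_def CR_def)
      have sub: "CL \<subset> C" "CR \<subset> C" using n t(4) by (auto simp: CL_def CR_def)
      have PX: "P X" if "X \<subset> C" for X
      proof -
        obtain c where "c \<in> C" "X \<subseteq> C - {c}" using \<open>X \<subset> C\<close> by blast
        then show ?thesis using mono[OF CE(4)[of c]] CE(2) by blast
      qed
      have "N CL \<inter> N CR = {}"
      proof (rule ccontr)
        assume "N CL \<inter> N CR \<noteq> {}"
        then obtain i x x' where i: "i < k" "x \<in> CL" "x' \<in> CR" "a i \<le> pos x" "pos x' < b i"
          by (auto simp: N_def win_def)
        then have "a i < a t" "b t < b i" by (auto simp: CL_def CR_def)
        then show False using sw[of t i] sw[of i t] i t(1) by (metis leD nat_le_linear)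
      qed
      then have "card (N CL \<union> N CR) = card (N CL) + card (N CR)" using finN by (simp add: card_Un_disjoint)
      moreover have "N CL \<union> N CR = N C" using U(1) by (auto simp: N_def)
      moreover have "card CL \<le> card (N CL)" "card CR \<le> card (N CR)"
        using cardN PX sub CE(2) by (meson psubset_imp_subset subset_trans)+
      moreover have "card C = card CL + card CR" using U CE(1)
        by (metis card_Un_disjoint finite_Un)
      ultimately show False using NC by simp
    qed
    \<comment> \<open>Otherwise window \<open>t\<close> is free for \<open>y\<close>. So
      \<open>I\<close> has an element in window \<open>t\<close>, that is, on the side of
      \<open>C\<close> where \<open>y\<close> lies.\<close>
    have ext: "\<exists>i\<in>I. a t \<le> pos i \<and> pos i < b t" if I: "I \<subseteq> E" "P I" "\<not> P (insert y I)" for I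
    proof (rule ccontr)
      assume n: "\<not> ?thesis"
      obtain \<phi> where \<phi>: "inj_on \<phi> I" "\<forall>x\<in>I. \<phi> x < k \<and> x \<in> win pos a b (\<phi> x)"
        using I P[of I] unfolding transversal_of_def by blast
      have "y \<notin> I" using I by (metis insert_absorb)
      have "transversal_of k (win pos a b) (insert y I)"
        unfolding transversal_of_def
      proof (intro exI[of _ "\<phi>(y := t)"] conjI)
        have "t \<notin> \<phi> ` I" using n \<phi>(2) by (auto simp: win_def)
        then show "inj_on (\<phi>(y := t)) (insert y I)"
          using \<phi>(1) \<open>y \<notin> I\<close> by (auto simp: inj_on_def)
        show "\<forall>x\<in>insert y I. (\<phi>(y := t)) x < k \<and> x \<in> win pos a b ((\<phi>(y := t)) x)"
          using \<phi>(2) \<open>y \<notin> I\<close> t by (auto simp: win_def)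
      qed
      then show False using I P[of "insert y I"] y(1) by simp
    qed
    from side show "((\<forall>x\<in>C. pos x < pos y) \<and> (\<forall>I\<subseteq>E. P I \<longrightarrow> \<not> P (insert y I) \<longrightarrow> (\<exists>i\<in>I. \<forall>x\<in>C. pos x < pos i))) \<or>
      ((\<forall>x\<in>C. pos y < pos x) \<and> (\<forall>I\<subseteq>E. P I \<longrightarrow> \<not> P (insert y I) \<longrightarrow> (\<exists>i\<in>I. \<forall>x\<in>C. pos i < pos x)))"
    proof
      assume *: "\<forall>x\<in>C. pos x < a t"
      then show ?thesis using ext t(2,3) by (intro disjI1) (meson less_le_trans)
    next
      assume *: "\<forall>x\<in>C. b t \<le> pos x"
      then show ?thesis using ext t(2,3) by (intro disjI2) (meson less_le_trans)
    qed
  qed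
qed

section \<open>Bicircular independence by counting\<close>

definition hall :: "('e \<Rightarrow> 'v set) \<Rightarrow> 'e set \<Rightarrow> bool" where
  "hall N I \<longleftrightarrow> (\<forall>J\<subseteq>I. card J \<le> card (\<Union>(N ` J)))"

lemma hall_subset: "hall N I \<Longrightarrow> J \<subseteq> I \<Longrightarrow> hall N J"
  unfolding hall_def by (meson subset_trans)

lemma cycle_counts:
  assumes "is_cycle H C"
  shows "finite C" "C \<noteq> {}" "C \<subseteq> edges H" "card (\<Union>(ends H ` C)) = card C" "finite (\<Union>(ends H ` C))"
    "\<And>J. J \<subset> C \<Longrightarrow> J \<noteq> {} \<Longrightarrow> card J < card (\<Union>(ends H ` J))"
proof -
  obtain vs es where c: "es \<noteq> []" "length vs = length es" "distinct vs" "distinct es"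
      "set es \<subseteq> edges H" "C = set es"
      and e: "\<And>i. i < length es \<Longrightarrow> ends H (es ! i) = {vs ! i, vs ! (Suc i mod length es)}"
    using assms unfolding is_cycle_def by blast
  define n where "n = length es"
  define sc where "sc i = Suc i mod n" for i
  have n: "0 < n" "length vs = n" using c by (auto simp: n_def)
  have sc: "sc i < n" for i using n by (simp add: sc_def)
  have VJ: "\<Union>(ends H ` ((!) es ` S)) = (!) vs ` (S \<union> sc ` S)" if "S \<subseteq> {..<n}" for S
  proof -
    have "\<Union>(ends H ` ((!) es ` S)) = (\<Union>i\<in>S. {vs ! i, vs ! sc i})"
      using that e by (auto simp: sc_def n_def subset_iff)
    also have "\<dots> = (!) vs ` (S \<union> sc ` S)" by auto
    finally show ?thesis .
  qed
  have cv: "card ((!) vs ` S) = card S" if "S \<subseteq> {..<n}" for S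
    using that c(3) n by (intro card_image) (auto simp: inj_on_def nth_eq_iff_index_eq subset_iff)
  have ce: "card ((!) es ` S) = card S" if "S \<subseteq> {..<n}" for S
    using that c(4) by (intro card_image) (auto simp: inj_on_def nth_eq_iff_index_eq subset_iff n_def)
  have C: "C = (!) es ` {..<n}" using c(6) by (auto simp: n_def set_conv_nth)
  show "finite C" "C \<noteq> {}" "C \<subseteq> edges H" using c by auto
  have full: "{..<n} \<union> sc ` {..<n} = {..<n}" using sc by auto
  have VC: "\<Union>(ends H ` C) = (!) vs ` {..<n}" unfolding C using VJ[of "{..<n}"] full by simp
  show "card (\<Union>(ends H ` C)) = card C" unfolding VC unfolding C by (simp add: cv ce)
  show "finite (\<Union>(ends H ` C))" unfolding VC by simp
  fix J assume J: "J \<subset> C" "J \<noteq> {}"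
  define S where "S = {i. i < n \<and> es ! i \<in> J}"
  have S: "S \<subseteq> {..<n}" "J = (!) es ` S" using J(1) C by (auto simp: S_def)
  have Sne: "S \<noteq> {}" "S \<noteq> {..<n}" using J S C by auto
  \<comment> \<open>A nonempty set of positions closed under the cyclic successor is the whole
    cycle; so a proper nonempty set of edges covers an extra vertex.\<close>
  have "\<not> sc ` S \<subseteq> S"
  proof
    assume cl: "sc ` S \<subseteq> S"
    obtain i where i: "i \<in> S" using Sne by blast
    have "(i + k) mod n \<in> S" for k
    proof (induction k)
      case 0
      then show ?case using i S(1) by auto
    next
      case (Suc k)
      then have "sc ((i + k) mod n) \<in> S" using cl by blast
      then show ?case by (simp add: sc_def mod_Suc_eq)
    qed
    moreover have "\<exists>k. (i + k) mod n = j" if "j < n" for j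
    proof
      have "i < n" using i S(1) by auto
      then show "(i + (n - i + j)) mod n = j" using that by simp
    qed
    ultimately have "{..<n} \<subseteq> S" by (metis lessThan_iff subsetI)
    then show False using Sne S by blast
  qed
  then have "S \<subset> S \<union> sc ` S" by blast
  moreover have sub: "S \<union> sc ` S \<subseteq> {..<n}" using S(1) sc by auto
  ultimately have "card S < card (S \<union> sc ` S)" by (meson finite_lessThan finite_subset psubset_card_mono)
  then show "card J < card (\<Union>(ends H ` J))"
    unfolding S(2) VJ[OF S(1)] using cv[OF sub] ce[OF S(1)] by simp
qed

text \<open>A vertex on only one edge of \<open>J\<close> is removed with that edge, which preserves
  the inequality. If there is none, the first vertex of a longest path lies on an edge other than
  the first edge of the path; maximality makes that edge a loop or leads it back to the path, which
  closes a cycle.\<close>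

lemma exists_cycle:
  assumes "finite J" and "J \<noteq> {}" and "card (\<Union>(ends H ` J)) \<le> card J" and "J \<subseteq> edges H"
    and "\<And>e. e \<in> J \<Longrightarrow> card (ends H e) = 1 \<or> card (ends H e) = 2"
  shows "\<exists>C\<subseteq>J. is_cycle H C"
  using assms
proof (induction "card J" arbitrary: J rule: less_induct)
  case less
  let ?V = "\<Union>(ends H ` J)"
  have loop: "\<exists>C\<subseteq>J. is_cycle H C" if "e \<in> J" "ends H e = {x}" for e x
  proof -
    have "is_cycle H {e}" unfolding is_cycle_def
      using that less.prems(4) by (intro exI[of _ "[x]"] exI[of _ "[e]"]) auto
    then show ?thesis using that by blast
  qed
  have fe: "finite (ends H e)" if "e \<in> J" for e
    using less.prems(5)[OF that] by (metis card.infinite zero_neq_numeral zero_neq_one)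
  have finV: "finite ?V" using less.prems(1) fe by blast
  have pair: "\<exists>y. ends H e = {x, y}" if ex: "e \<in> J" "x \<in> ends H e" for e x
  proof -
    obtain a b where "ends H e = {a, b}"
      using less.prems(5)[OF ex(1)] by (metis card_1_singletonE card_2_iff insert_absorb2)
    then show ?thesis using ex(2) by auto
  qed
  show ?case
  proof (cases "\<exists>x e. {f \<in> J. x \<in> ends H f} = {e}")
    case True
    then obtain x e where xe: "{f \<in> J. x \<in> ends H f} = {e}" by blast
    then have e: "e \<in> J" "x \<in> ends H e" by auto
    have cJ: "card J = Suc (card (J - {e}))" using less.prems(1) e(1) by (metis card.remove)
    have sub: "\<Union>(ends H ` (J - {e})) \<subseteq> ?V - {x}" using xe by blast
    have "x \<in> ?V" using e by blast
    then have "card (?V - {x}) < card ?V" using finV by (metis card_Diff1_less)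
    then have le: "card (\<Union>(ends H ` (J - {e}))) \<le> card (J - {e})"
      using card_mono[OF _ sub] finV less.prems(3) cJ by simp
    show ?thesis
    proof (cases "J - {e} = {}")
      case True
      then have "J = {e}" using e by blast
      then have "card (ends H e) \<le> 1" using less.prems(3) by simp
      moreover obtain y where "ends H e = {x, y}" using pair[OF e] by blast
      ultimately have "ends H e = {x}" by (metis card_2_iff doubleton_eq_iff insert_absorb2 numeral_le_one_iff semiring_norm(69))
      then show ?thesis using loop[OF e(1)] by blast
    next
      case False
      have "\<exists>C\<subseteq>J - {e}. is_cycle H C"
        using less.hyps[of "J - {e}"] less.prems False le cJ by auto
      then show ?thesis by blast
    qed
  next
    case nleaf: False
    define path where "path vs es \<longleftrightarrow> length vs = Suc (length es) \<and> distinct vs \<and> set vs \<subseteq> ?V \<and>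
      set es \<subseteq> J \<and> (\<forall>i<length es. ends H (es ! i) = {vs ! i, vs ! Suc i})" for vs es
    obtain x0 where x0: "x0 \<in> ?V" using less.prems(2) pair less.prems(5)
      by (metis UN_I card.empty ex_in_conv zero_neq_numeral zero_neq_one)
    have "path [x0] []" using x0 by (simp add: path_def)
    have bound: "length es \<le> card ?V" if "path vs es" for vs es
    proof -
      have "length vs = card (set vs)" using that by (simp add: path_def distinct_card)
      then show ?thesis using that finV card_mono[of ?V "set vs"] by (simp add: path_def)
    qed
    define R where "R n \<longleftrightarrow> (\<exists>vs es. path vs es \<and> length es = n)" for n
    have "R 0" using \<open>path [x0] []\<close> by (auto simp: R_def)
    have Rb: "\<forall>n. R n \<longrightarrow> n \<le> card ?V" using bound by (auto simp: R_def)
    have "R (Greatest R)" using GreatestI_nat[of R 0 "card ?V"] \<open>R 0\<close> Rb by blast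
    then obtain vs es where p: "path vs es" and len: "length es = Greatest R" by (auto simp: R_def)
    have max: "length es' \<le> length es" if "path vs' es'" for vs' es'
      using Greatest_le_nat[of R "length es'" "card ?V"] Rb that len by (auto simp: R_def)
    define v where "v = vs ! 0"
    have lv: "length vs = Suc (length es)" "distinct vs" "set vs \<subseteq> ?V" "set es \<subseteq> J"
      and ev: "\<And>i. i < length es \<Longrightarrow> ends H (es ! i) = {vs ! i, vs ! Suc i}"
      using p by (auto simp: path_def)
    have "v \<in> ?V" using lv unfolding v_def by (metis nth_mem subset_iff zero_less_Suc)
    then obtain f where f: "f \<in> J" "v \<in> ends H f" by blast
    have "{f \<in> J. v \<in> ends H f} \<noteq> {f}" using nleaf by blast
    then obtain f' where f': "f' \<in> J" "v \<in> ends H f'" "f' \<noteq> f" using f by blast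
    obtain e where e: "e \<in> J" "v \<in> ends H e" "es \<noteq> [] \<longrightarrow> e \<noteq> es ! 0"
      using f f' by metis
    obtain u where u: "ends H e = {v, u}" using pair[OF e(1,2)] by blast
    consider "u = v" | "u \<notin> set vs" | j where "u = vs ! j" "0 < j" "j \<le> length es"
    proof (cases "u \<in> set vs")
      case True
      then obtain j where j: "j < length vs" "u = vs ! j" by (metis in_set_conv_nth)
      show ?thesis
      proof (cases "j = 0")
        case True
        then show ?thesis using j that(1) by (simp add: v_def)
      next
        case False
        then show ?thesis using j lv(1) that(3)[of j] by simp
      qed
    qed (use that in blast)
    then show ?thesis
    proof cases
      case 1
      then show ?thesis using loop[OF e(1)] u by auto
    next
      case 2
      have "u \<in> ?V" using u e(1) by auto
      then have "path (u # vs) (e # es)"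
        using 2 lv ev e(1) u unfolding path_def v_def
        by (auto simp: nth_Cons split: nat.splits)
      then show ?thesis using max[of "u # vs" "e # es"] by simp
    next
      case (3 j)
      have inj: "vs ! a = vs ! b \<longleftrightarrow> a = b" if "a \<le> length es" "b \<le> length es" for a b
        using lv(1,2) that by (simp add: nth_eq_iff_index_eq)
      have des: "a = b" if "es ! a = es ! b" "a < length es" "b < length es" for a b
      proof -
        have "{vs ! a, vs ! Suc a} = {vs ! b, vs ! Suc b}" using ev that by metis
        then show ?thesis using inj[of a b] inj[of a "Suc b"] inj[of "Suc a" b] that
          by (auto simp: doubleton_eq_iff)
      qed
      have "e \<noteq> es ! i" if "i < j" for i
      proof
        assume "e = es ! i"
        then have "v \<in> {vs ! i, vs ! Suc i}" using ev[of i] u 3 that by auto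
        then have "i = 0" using inj[of 0 i] inj[of 0 "Suc i"] 3 that by (auto simp: v_def)
        then show False using e(3) \<open>e = es ! i\<close> 3 that by auto
      qed
      then have "e \<notin> set (take j es)" using 3 by (auto simp: in_set_conv_nth)
      moreover have "distinct (take j es)"
        using des by (intro distinct_take) (auto simp: distinct_conv_nth)
      ultimately have "distinct (take j es @ [e])" by simp
      moreover have "set (take j es @ [e]) \<subseteq> J" using lv(4) e(1) set_take_subset[of j es] by auto
      moreover have "ends H ((take j es @ [e]) ! i) =
          {take (Suc j) vs ! i, take (Suc j) vs ! (Suc i mod length (take j es @ [e]))}"
        if i: "i < length (take j es @ [e])" for i
      proof (cases "i = j")
        case True
        then show ?thesis using 3 u by (simp add: nth_append v_def insert_commute)
      next
        case False
        then show ?thesis using 3 i ev[of i] by (simp add: nth_append)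
      qed
      ultimately have "is_cycle H (set (take j es @ [e]))"
        unfolding is_cycle_def using 3 lv less.prems(4)
        by (intro exI[of _ "take (Suc j) vs"] exI[of _ "take j es @ [e]"]) auto
      then show ?thesis using \<open>set (take j es @ [e]) \<subseteq> J\<close> by blast
    qed
  qed
qed

lemma rtrancl_leaves:
  assumes "(u, w) \<in> r\<^sup>*" and "u \<in> S" and "w \<notin> S"
  shows "\<exists>a b. (a, b) \<in> r \<and> a \<in> S \<and> b \<notin> S"
  using assms by (induction rule: rtrancl_induct) blast+

lemma bicircular_indep_iff_hall:
  fixes G :: "('v, 'e) multigraph"
  assumes G: "finite_multigraph G"
  shows "bicircular_indep G I \<longleftrightarrow> I \<subseteq> edges G \<and> hall (ends G) I"
proof (cases "I \<subseteq> edges G")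
  case I: True
  define H where "H = edge_subgraph G I"
  have H: "edges H = I" "ends H = ends G" "verts H = (\<Union>e\<in>I. ends G e)"
    by (simp_all add: H_def edge_subgraph_def)
  have finI: "finite I" using G I finite_subset by (auto simp: finite_multigraph_def)
  have c12: "card (ends G e) = 1 \<or> card (ends G e) = 2" if "e \<in> I" for e
    using G I that by (auto simp: finite_multigraph_def)
  have fe: "finite (ends G e)" "ends G e \<noteq> {}" if "e \<in> I" for e
    using c12[OF that] by (metis card.infinite zero_neq_numeral zero_neq_one, auto)
  have finV: "finite (\<Union>(ends G ` J))" if "J \<subseteq> I" for J
    using that finI fe finite_subset by blast
  have pair: "\<exists>y. ends G e = {x, y}" if ex: "e \<in> I" "x \<in> ends G e" for e x
  proof -
    obtain a b where "ends G e = {a, b}"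
      using c12[OF ex(1)] by (metis card_1_singletonE card_2_iff insert_absorb2)
    then show ?thesis using ex(2) by auto
  qed
  have adjs: "(a, b) \<in> (adjacency H)\<^sup>*" if eab: "e \<in> I" "a \<in> ends G e" "b \<in> ends G e" for e a b
  proof -
    obtain y where y: "ends G e = {a, y}" using pair[OF eab(1,2)] by blast
    then have "b = a \<or> b = y" using eab by blast
    moreover have "(a, y) \<in> adjacency H" using y eab(1) by (auto simp: adjacency_def H)
    ultimately show ?thesis by auto
  qed
  have cycD: "finite C" "C \<noteq> {}" "C \<subseteq> I" "card (\<Union>(ends G ` C)) = card C"
      "\<And>J. J \<subset> C \<Longrightarrow> J \<noteq> {} \<Longrightarrow> card J < card (\<Union>(ends G ` J))" if "is_cycle H C" for C
    using cycle_counts[OF that] by (auto simp: H)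
  have "bicircular_indep G I \<longleftrightarrow> hall (ends G) I"
  proof
    assume hall: "hall (ends G) I"
    have bnd: "card J \<le> card (\<Union>(ends G ` J))" if "J \<subseteq> I" for J
      using hall that by (simp add: hall_def)
    show "bicircular_indep G I"
      unfolding bicircular_indep_def H_def[symmetric]
    proof (intro conjI ballI I Uniq_I)
      fix K C D assume K: "K \<in> components H"
        and "is_cycle H C \<and> (\<forall>e\<in>C. ends G e \<subseteq> K)" "is_cycle H D \<and> (\<forall>e\<in>D. ends G e \<subseteq> K)"
      then have C: "is_cycle H C" "\<And>e. e \<in> C \<Longrightarrow> ends G e \<subseteq> K"
        and D: "is_cycle H D" "\<And>e. e \<in> D \<Longrightarrow> ends G e \<subseteq> K" by auto
      define VC where "VC = \<Union>(ends G ` C)"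
      define VD where "VD = \<Union>(ends G ` D)"
      have finC: "finite VC" "finite VD" unfolding VC_def VD_def using finV cycD(3)[OF C(1)] cycD(3)[OF D(1)] by blast+
      have cV: "card VC = card C" "card VD = card D" using cycD(4)[OF C(1)] cycD(4)[OF D(1)] by (auto simp: VC_def VD_def)
      show "C = D"
      proof (rule ccontr)
        assume "C \<noteq> D"
        show False
        proof (cases "VC \<inter> VD = {}")
          case False
          \<comment> \<open>Two distinct cycles that meet share fewer edges than vertices, so by
            inclusion and exclusion their union has more edges than vertices.\<close>
          have "card (C \<inter> D) < card (VC \<inter> VD)"
          proof (cases "C \<inter> D = {}")
            case True
            then show ?thesis using False finC by (simp add: card_gt_0_iff)
          next
            case ne: False
            have "C \<inter> D \<subset> C \<or> C \<inter> D \<subset> D" using \<open>C \<noteq> D\<close> by blast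
            then have "card (C \<inter> D) < card (\<Union>(ends G ` (C \<inter> D)))"
              using cycD(5)[OF C(1) _ ne] cycD(5)[OF D(1) _ ne] by blast
            also have "\<dots> \<le> card (VC \<inter> VD)" using finC by (intro card_mono) (auto simp: VC_def VD_def)
            finally show ?thesis .
          qed
          moreover have "card C + card D = card (C \<union> D) + card (C \<inter> D)"
            using cycD(1)[OF C(1)] cycD(1)[OF D(1)] by (intro card_Un_Int)
          moreover have "card VC + card VD = card (VC \<union> VD) + card (VC \<inter> VD)"
            using finC by (intro card_Un_Int) auto
          moreover have "card (C \<union> D) \<le> card (VC \<union> VD)"
            using bnd[of "C \<union> D"] cycD(3)[OF C(1)] cycD(3)[OF D(1)] by (auto simp: VC_def VD_def)
          ultimately show False using cV by simp
        next
          case dis: True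
          \<comment> \<open>\<open>S\<close> grows from the first cycle through the component while
            it carries at least as many edges as vertices. A maximal \<open>S\<close> is joined by
            an edge to the second cycle, and this joining edge is one too many for the vertices
            covered.\<close>
          define Q where "Q S \<longleftrightarrow> VC \<subseteq> S \<and> S \<inter> VD = {} \<and> S \<subseteq> verts H \<and>
            (\<exists>F\<subseteq>I. \<Union>(ends G ` F) \<subseteq> S \<and> card S \<le> card F)" for S
          have finvH: "finite (verts H)" using finV[of I] by (simp add: H)
          have "Q VC" using dis cV cycD(3)[OF C(1)] unfolding Q_def VC_def
            by (intro conjI exI[of _ C]) (auto simp: H)
          moreover have "finite {S. Q S}"
            by (rule finite_subset[of _ "Pow (verts H)"]) (auto simp: Q_def finvH)
          ultimately obtain S where S: "Q S" and maxS: "\<And>S'. Q S' \<Longrightarrow> S \<subseteq> S' \<Longrightarrow> S' = S"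
            using finite_has_maximal[of "{S. Q S}"] by blast
          obtain F where F: "F \<subseteq> I" "\<Union>(ends G ` F) \<subseteq> S" "card S \<le> card F" using S by (auto simp: Q_def)
          have finS: "finite S" "finite F" using S finvH F(1) finI finite_subset by (auto simp: Q_def)
          obtain c d where cd: "c \<in> C" "d \<in> D"
            using cycD(2)[OF C(1)] cycD(2)[OF D(1)] by blast
          then have "c \<in> I" "d \<in> I" using cycD(3)[OF C(1)] cycD(3)[OF D(1)] by auto
          then obtain u w where uw: "u \<in> ends G c" "w \<in> ends G d"
            using fe(2)[of c] fe(2)[of d] by blast
          have uwS: "u \<in> S" "w \<notin> S" using S uw cd by (auto simp: Q_def VC_def VD_def)
          obtain x where "K = (adjacency H)\<^sup>* `` {x}" using K unfolding components_def by (auto elim: quotientE)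
          then have "(x, u) \<in> (adjacency H)\<^sup>*" "(x, w) \<in> (adjacency H)\<^sup>*"
            using C(2)[OF cd(1)] D(2)[OF cd(2)] uw by auto
          moreover have "sym (adjacency H)" by (auto simp: sym_def adjacency_def insert_commute)
          ultimately have "(u, w) \<in> (adjacency H)\<^sup>*"
            by (meson rtrancl_trans symD sym_rtrancl)
          then obtain a b where ab: "(a, b) \<in> adjacency H" "a \<in> S" "b \<notin> S"
            using rtrancl_leaves uwS by metis
          then obtain e where e: "e \<in> I" "ends G e = {a, b}" by (auto simp: adjacency_def H)
          have eF: "e \<notin> F" using F(2) e(2) ab by blast
          show False
          proof (cases "b \<in> VD")
            case False
            have "Q (insert b S)" unfolding Q_def
            proof (intro conjI exI[of _ "insert e F"])
              show "insert b S \<subseteq> verts H" using S e by (auto simp: Q_def H)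
              show "card (insert b S) \<le> card (insert e F)" using F(3) eF finS ab(3) by simp
            qed (use S F e ab False in \<open>auto simp: Q_def\<close>)
            then show False using maxS[of "insert b S"] ab(3) by blast
          next
            case True
            have "S \<inter> VD = {}" using S by (simp add: Q_def)
            then have eD: "e \<notin> D" using ab(2) e(2) unfolding VD_def by blast
            have FD: "F \<inter> D = {}"
            proof (rule ccontr)
              assume "F \<inter> D \<noteq> {}"
              then obtain g where g: "g \<in> F" "g \<in> D" by blast
              then obtain z where "z \<in> ends G g" using fe(2) F(1) by blast
              then show False using g F(2) S by (auto simp: Q_def VD_def)
            qed
            have "card (insert e F \<union> D) = Suc (card F) + card D"
              using FD eD eF finS cycD(1)[OF D(1)] by (subst card_Un_disjoint) auto
            moreover have "card (insert e F \<union> D) \<le> card (\<Union>(ends G ` (insert e F \<union> D)))"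
              using bnd[of "insert e F \<union> D"] F(1) e(1) cycD(3)[OF D(1)] by blast
            moreover have "card (\<Union>(ends G ` (insert e F \<union> D))) \<le> card (S \<union> VD)"
              using F(2) e(2) ab True finS finC by (intro card_mono) (auto simp: VD_def)
            moreover have "card (S \<union> VD) \<le> card S + card VD" by (rule card_Un_le)
            ultimately show False using F(3) cV by simp
          qed
        qed
      qed
    qed
  next
    assume bi: "bicircular_indep G I"
    show "hall (ends G) I"
    proof (rule ccontr)
      assume "\<not> hall (ends G) I"
      then obtain J0 where "J0 \<subseteq> I \<and> card (\<Union>(ends G ` J0)) < card J0" by (auto simp: hall_def not_le)
      from ex_has_least_nat[of "\<lambda>J. J \<subseteq> I \<and> card (\<Union>(ends G ` J)) < card J", OF this, of card]
      obtain J where J: "J \<subseteq> I" "card (\<Union>(ends G ` J)) < card J"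
        and minJ: "\<And>J'. J' \<subseteq> I \<Longrightarrow> card (\<Union>(ends G ` J')) < card J' \<Longrightarrow> card J \<le> card J'"
        by auto
      have finJ: "finite J" using J finI finite_subset by blast
      have sub: "card J' \<le> card (\<Union>(ends G ` J'))" if "J' \<subset> J" for J'
      proof -
        have "card J' < card J" "J' \<subseteq> I" using psubset_card_mono[OF finJ that] that J(1) by auto
        then show ?thesis using minJ[of J'] by linarith
      qed
      have cycleJ: "\<exists>C\<subseteq>J'. is_cycle H C"
        if "J' \<subseteq> J" "J' \<noteq> {}" "card (\<Union>(ends G ` J')) \<le> card J'" for J'
      proof (rule exists_cycle)
        show "finite J'" using that(1) finJ finite_subset by blast
        show "J' \<subseteq> edges H" using that(1) J(1) by (simp add: H)
        show "card (ends H e) = 1 \<or> card (ends H e) = 2" if "e \<in> J'" for e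
          using c12[of e] that \<open>J' \<subseteq> J\<close> J(1) by (auto simp: H)
      qed (use that in \<open>simp_all add: H\<close>)
      have "J \<noteq> {}" using J(2) by auto
      \<comment> \<open>A smallest violator contains two distinct cycles: one cycle, and another
        that survives the deletion of an edge \<open>e\<close> of the first, because
        \<open>J - {e}\<close> still has at least as many edges as vertices. Minimality also makes
        \<open>J\<close> connected, so both lie in one component.\<close>
      then obtain C where C: "C \<subseteq> J" "is_cycle H C" using cycleJ[of J] J(2) by auto
      obtain e where e: "e \<in> C" using cycD(2)[OF C(2)] by blast
      then have eJ: "e \<in> J" "e \<in> I" using C J by auto
      have cJ: "card J = Suc (card (J - {e}))" using finJ eJ by (metis card.remove)
      have mono: "card (\<Union>(ends G ` (J - {e}))) \<le> card (\<Union>(ends G ` J))"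
        using finV[OF J(1)] by (intro card_mono) auto
      have "J - {e} \<noteq> {}"
      proof
        assume emp: "J - {e} = {}"
        have "card (J - {e}) = 0" unfolding emp by simp
        then have "card (\<Union>(ends G ` J)) = 0" using J(2) cJ by simp
        then have "\<Union>(ends G ` J) = {}" using finV[OF J(1)] by simp
        then show False using fe(2)[OF eJ(2)] eJ(1) by blast
      qed
      then obtain D where D: "D \<subseteq> J - {e}" "is_cycle H D"
        using cycleJ[of "J - {e}"] J(2) cJ mono by auto
      obtain x where x: "x \<in> ends G e" using fe(2) eJ by blast
      define K where "K = (adjacency H)\<^sup>* `` {x}"
      have K: "K \<in> components H"
        unfolding K_def components_def using x eJ by (intro quotientI) (auto simp: H)
      define J1 where "J1 = {f \<in> J. ends G f \<inter> K \<noteq> {}}"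
      have cl: "ends G f \<subseteq> K" if "f \<in> J1" for f
      proof
        fix b assume b: "b \<in> ends G f"
        obtain a where a: "a \<in> ends G f" "(x, a) \<in> (adjacency H)\<^sup>*" and fI: "f \<in> I"
          using \<open>f \<in> J1\<close> J by (auto simp: J1_def K_def)
        then show "b \<in> K" using adjs[OF fI a(1) b] by (auto simp: K_def)
      qed
      have "J1 = J"
      proof (rule ccontr)
        assume "J1 \<noteq> J"
        moreover have "x \<in> K" by (simp add: K_def)
        then have "e \<in> J1" using eJ x by (auto simp: J1_def)
        ultimately have ps: "J1 \<subset> J" "J - J1 \<subset> J" by (auto simp: J1_def)
        have "\<Union>(ends G ` J1) \<inter> \<Union>(ends G ` (J - J1)) = {}" using cl by (auto simp: J1_def)
        then have "card (\<Union>(ends G ` J1) \<union> \<Union>(ends G ` (J - J1))) =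
            card (\<Union>(ends G ` J1)) + card (\<Union>(ends G ` (J - J1)))"
          using finV J(1) ps by (intro card_Un_disjoint) auto
        moreover have "\<Union>(ends G ` J1) \<union> \<Union>(ends G ` (J - J1)) = \<Union>(ends G ` J)"
          by (auto simp: J1_def)
        moreover have "card J = card J1 + card (J - J1)"
          using ps(1) finJ by (metis card_Diff_subset card_mono finite_subset le_add_diff_inverse psubset_imp_subset)
        ultimately show False using sub[OF ps(1)] sub[OF ps(2)] J(2) by simp
      qed
      then have inK: "\<forall>f\<in>C. ends G f \<subseteq> K" "\<forall>f\<in>D. ends G f \<subseteq> K" using cl C D by auto
      have "\<exists>\<^sub>\<le>\<^sub>1C. is_cycle H C \<and> (\<forall>e\<in>C. ends G e \<subseteq> K)"
        using bi K by (simp add: bicircular_indep_def H_def)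
      then have "C = D" by (rule Uniq_D) (use C D inK in auto)
      then show False using e D by blast
    qed
  qed
  then show ?thesis using I by simp
qed (auto simp: bicircular_indep_def)

section \<open>Minors by contracting an independent set\<close>

text \<open>\<open>emb E P F Q\<close> realises \<open>Q\<close> as a minor of \<open>P\<close>: contract the independent set \<open>C\<close>, then restrict to
  the image of \<open>F\<close>. As \<open>C\<close> is independent, no basis of it has to be chosen.\<close>

definition emb :: "'a set \<Rightarrow> ('a set \<Rightarrow> bool) \<Rightarrow> 'b set \<Rightarrow> ('b set \<Rightarrow> bool) \<Rightarrow> bool" where
  "emb E P F Q \<longleftrightarrow> (\<exists>C g. C \<subseteq> E \<and> P C \<and> inj_on g F \<and> g ` F \<subseteq> E - C \<and> (\<forall>X\<subseteq>F. Q X \<longleftrightarrow> P (g ` X \<union> C)))"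

lemma emb_trans:
  assumes "emb E P F Q" and "emb F Q L R"
  shows "emb E P L R"
proof -
  obtain C g where C: "C \<subseteq> E" "P C" "inj_on g F" "g ` F \<subseteq> E - C" "\<And>X. X \<subseteq> F \<Longrightarrow> Q X \<longleftrightarrow> P (g ` X \<union> C)"
    using assms(1) unfolding emb_def by blast
  obtain D h where D: "D \<subseteq> F" "Q D" "inj_on h L" "h ` L \<subseteq> F - D" "\<And>X. X \<subseteq> L \<Longrightarrow> R X \<longleftrightarrow> Q (h ` X \<union> D)"
    using assms(2) unfolding emb_def by blast
  show ?thesis unfolding emb_def
  proof (intro exI[of _ "g ` D \<union> C"] exI[of _ "g \<circ> h"] conjI allI impI)
    show "g ` D \<union> C \<subseteq> E" using C D by blast
    show "P (g ` D \<union> C)" using C(5)[OF D(1)] D(2) by simp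
    show "inj_on (g \<circ> h) L" using C(3) D(3,4) by (meson Diff_subset comp_inj_on inj_on_subset subset_trans)
    have "g ` (h ` L) \<inter> g ` D = g ` (h ` L \<inter> D)"
      using D(1,4) by (intro inj_on_image_Int[OF C(3), symmetric]) auto
    also have "h ` L \<inter> D = {}" using D(4) by auto
    finally have "g ` (h ` L) \<inter> g ` D = {}" by simp
    then show "(g \<circ> h) ` L \<subseteq> E - (g ` D \<union> C)" 
      using C(4) D(4) unfolding image_comp[symmetric] by blast
    fix X assume X: "X \<subseteq> L"
    then have "h ` X \<union> D \<subseteq> F" using D by blast
    then show "R X \<longleftrightarrow> P ((g \<circ> h) ` X \<union> (g ` D \<union> C))"
      using C(5)[of "h ` X \<union> D"] D(5)[OF X] by (simp add: image_Un image_comp Un_assoc)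
  qed
qed

lemma emb_subset:
  assumes "E' \<subseteq> E" and "emb E' P F Q"
  shows "emb E P F Q"
proof -
  obtain C g where "C \<subseteq> E'" "P C" "inj_on g F" "g ` F \<subseteq> E' - C" "\<forall>X\<subseteq>F. Q X \<longleftrightarrow> P (g ` X \<union> C)"
    using assms(2) unfolding emb_def by blast
  moreover from this assms(1) have "C \<subseteq> E" "g ` F \<subseteq> E - C" by auto
  ultimately show ?thesis unfolding emb_def by blast
qed

lemma emb_bij:
  assumes f: "bij_betw f E' E" "\<And>X. X \<subseteq> E' \<Longrightarrow> P' X \<longleftrightarrow> P (f ` X)" and "P' {}"
  shows "emb E' P' E P"
proof -
  let ?g = "inv_into E' f"
  have g: "bij_betw ?g E E'" using f(1) by (rule bij_betw_inv_into)
  have "P X \<longleftrightarrow> P' (?g ` X \<union> {})" if X: "X \<subseteq> E" for X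
  proof -
    have "f ` ?g ` X = X" using X f(1) by (metis bij_betw_imp_surj_on image_inv_into_cancel)
    moreover have "?g ` X \<subseteq> E'" using g X by (auto simp: bij_betw_def)
    ultimately show ?thesis using f(2)[of "?g ` X"] by simp
  qed
  then show ?thesis unfolding emb_def using g assms(3)
    by (intro exI[of _ "{}"] exI[of _ ?g]) (auto simp: bij_betw_def)
qed

lemma emb_has_minor:
  assumes M: "is_matroid M" and "emb (ground M) (\<lambda>X. X \<in> indeps M) (ground K) (\<lambda>X. X \<in> indeps K)"
  shows "has_minor_isomorphic_to M K"
proof -
  obtain C g where C: "C \<subseteq> ground M" "C \<in> indeps M" "inj_on g (ground K)" "g ` ground K \<subseteq> ground M - C"
      "\<And>X. X \<subseteq> ground K \<Longrightarrow> X \<in> indeps K \<longleftrightarrow> g ` X \<union> C \<in> indeps M"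
    using assms(2) unfolding emb_def by blast
  define D where "D = ground M - C - g ` ground K"
  define N where "N = deletion (contraction M C) D"
  have "minor_of N M" unfolding minor_of_def N_def
    using C(1) by (intro exI[of _ C] exI[of _ D]) (auto simp: D_def)
  have gN: "ground N = g ` ground K"
    using C(4) by (auto simp: N_def D_def deletion_def contraction_def)
  have B: "basis_of M C B \<longleftrightarrow> B = C" for B using C(2) by (auto simp: basis_of_def)
  have ind: "X \<in> indeps N \<longleftrightarrow> X \<union> C \<in> indeps M" if "X \<subseteq> g ` ground K" for X
  proof -
    have "X \<subseteq> ground M - C" "X \<inter> D = {}" using that C(4) by (auto simp: D_def)
    then show ?thesis unfolding N_def deletion_def contraction_def by (simp add: B)
  qed
  have "matroid_iso K N" unfolding matroid_iso_def
  proof (intro exI[of _ g] conjI allI impI)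
    show "bij_betw g (ground K) (ground N)" using C(3) gN by (simp add: bij_betw_def)
    fix X assume X: "X \<subseteq> ground K"
    then show "X \<in> indeps K \<longleftrightarrow> g ` X \<in> indeps N" using C(5)[OF X] ind[of "g ` X"] by blast
  qed
  then show ?thesis unfolding has_minor_isomorphic_to_def
    using \<open>minor_of N M\<close> matroid_iso_sym by blast
qed

section \<open>Connected vertex sets and partition minors\<close>

lemma finite_maximal_set:
  assumes "finite F" "A \<in> F"
  obtains C where "C \<in> F" "\<And>X. X \<in> F \<Longrightarrow> C \<subseteq> X \<Longrightarrow> X = C"
proof -
  have "\<exists>C\<in>F. \<forall>X\<in>F. C \<subseteq> X \<longrightarrow> C = X" using finite_has_maximal[of F] assms by auto
  then show ?thesis using that by blast
qed

text \<open>Vertices occur only as ends of edges, so deleting edges stays inside the locale; the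
  final induction on the edge set relies on this.\<close>

locale mgraph =
  fixes E :: "'e set" and N :: "'e \<Rightarrow> 'v set"
  assumes finE: "finite E"
    and N_card: "\<And>e. e \<in> E \<Longrightarrow> card (N e) = 1 \<or> card (N e) = 2"
begin

definition es :: "'v set \<Rightarrow> nat" where "es S = card {e \<in> E. N e \<subseteq> S}"

definition ec :: "'v set \<Rightarrow> 'v set \<Rightarrow> nat" where
  "ec A B = card {e \<in> E. N e \<inter> A \<noteq> {} \<and> N e \<inter> B \<noteq> {}}"

definition adj :: "'v set \<Rightarrow> 'v set \<Rightarrow> bool" where
  "adj A B \<longleftrightarrow> (\<exists>e\<in>E. N e \<inter> A \<noteq> {} \<and> N e \<inter> B \<noteq> {})"

text \<open>Connectivity of the subgraph induced on \<open>S\<close>, by cuts instead of paths: an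
  edge meeting both \<open>A\<close> and \<open>S - A\<close> has no third end, so it lies inside
  \<open>S\<close>.\<close>

definition conn :: "'v set \<Rightarrow> bool" where
  "conn S \<longleftrightarrow> finite S \<and> S \<noteq> {} \<and> (\<forall>A. A \<subset> S \<longrightarrow> A \<noteq> {} \<longrightarrow> adj A (S - A))"

text \<open>\<open>cyc S r\<close>: a spanning tree of the connected set \<open>S\<close> leaves at least \<open>r\<close> further edges.\<close>

definition cyc :: "'v set \<Rightarrow> nat \<Rightarrow> bool" where "cyc S r \<longleftrightarrow> card S + r \<le> es S + 1"

lemma N_nonempty: "e \<in> E \<Longrightarrow> N e \<noteq> {}"
  using N_card by fastforce

lemma N_finite: "e \<in> E \<Longrightarrow> finite (N e)"
  using N_card by (metis card.infinite zero_neq_numeral zero_neq_one)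

lemma N_pair: "e \<in> E \<Longrightarrow> x \<in> N e \<Longrightarrow> \<exists>y. N e = {x, y}"
  using N_card[of e] by (auto simp: card_1_singleton_iff card_2_iff)

lemma N_cross:
  assumes "e \<in> E" "N e \<inter> A \<noteq> {}" "N e \<inter> B \<noteq> {}" "A \<inter> B = {}"
  shows "\<exists>x y. N e = {x, y} \<and> x \<in> A \<and> y \<in> B"
proof -
  obtain x where x: "x \<in> N e" "x \<in> A" using assms(2) by blast
  obtain y where y: "N e = {x, y}" using N_pair[OF assms(1) x(1)] by blast
  then show ?thesis using x assms(3,4) by (intro exI[of _ x] exI[of _ y]) auto
qed

lemma adj_sym: "adj A B \<longleftrightarrow> adj B A"
  unfolding adj_def by blast

lemma adj_mono: "adj A B \<Longrightarrow> A \<subseteq> A' \<Longrightarrow> B \<subseteq> B' \<Longrightarrow> adj A' B'"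
  unfolding adj_def by blast

lemma adj_Un: "adj A (B \<union> C) \<longleftrightarrow> adj A B \<or> adj A C"
  unfolding adj_def by blast

lemma adj_Un2: "adj (B \<union> C) A \<longleftrightarrow> adj B A \<or> adj C A"
  unfolding adj_def by blast

lemma ec_sym: "ec A B = ec B A"
  unfolding ec_def by (rule arg_cong[of _ _ card]) blast

lemma ec_mono: "A \<subseteq> A' \<Longrightarrow> B \<subseteq> B' \<Longrightarrow> ec A B \<le> ec A' B'"
  unfolding ec_def using finE by (intro card_mono) auto

lemma adj_ec: "adj A B \<longleftrightarrow> 1 \<le> ec A B"
proof -
  have "1 \<le> ec A B \<longleftrightarrow> {e \<in> E. N e \<inter> A \<noteq> {} \<and> N e \<inter> B \<noteq> {}} \<noteq> {}"
    unfolding ec_def using finE by (simp add: Suc_le_eq card_gt_0_iff)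
  then show ?thesis by (auto simp: adj_def)
qed

lemma ec_Un:
  assumes "A \<inter> B = {}" "A \<inter> C = {}" "B \<inter> C = {}"
  shows "ec (A \<union> B) C = ec A C + ec B C"
proof -
  let ?S = "\<lambda>X. {e \<in> E. N e \<inter> X \<noteq> {} \<and> N e \<inter> C \<noteq> {}}"
  have "False" if e: "e \<in> ?S A" "e \<in> ?S B" for e
  proof -
    obtain x y where "N e = {x, y}" "x \<in> A" "y \<in> C" using N_cross[of e A C] e assms(2) by auto
    then show False using e assms by auto
  qed
  then have "?S A \<inter> ?S B = {}" by blast
  moreover have "?S (A \<union> B) = ?S A \<union> ?S B" by blast
  ultimately show ?thesis unfolding ec_def using finE by (simp add: card_Un_disjoint)
qed

lemma es_Un:
  assumes "A \<inter> B = {}"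
  shows "es (A \<union> B) = es A + es B + ec A B"
proof -
  let ?C = "{e \<in> E. N e \<inter> A \<noteq> {} \<and> N e \<inter> B \<noteq> {}}"
  have C: "N e \<subseteq> A \<union> B" if "e \<in> ?C" for e
    using N_cross[of e A B] that assms by auto
  have "{e \<in> E. N e \<subseteq> A \<union> B} = ({e \<in> E. N e \<subseteq> A} \<union> {e \<in> E. N e \<subseteq> B}) \<union> ?C"
    using C by blast
  moreover have "({e \<in> E. N e \<subseteq> A} \<union> {e \<in> E. N e \<subseteq> B}) \<inter> ?C = {}" using assms by blast
  moreover have "{e \<in> E. N e \<subseteq> A} \<inter> {e \<in> E. N e \<subseteq> B} = {}" using assms N_nonempty by blast
  ultimately show ?thesis unfolding es_def ec_def using finE by (simp add: card_Un_disjoint)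
qed

lemma conn_finite: "conn S \<Longrightarrow> finite S" and conn_nonempty: "conn S \<Longrightarrow> S \<noteq> {}"
  by (simp_all add: conn_def)

lemma connD: "conn S \<Longrightarrow> A \<subseteq> S \<Longrightarrow> A \<noteq> {} \<Longrightarrow> A \<noteq> S \<Longrightarrow> adj A (S - A)"
  unfolding conn_def by blast

lemma conn_singleton: "conn {x}"
  unfolding conn_def by auto

lemma conn_N: assumes "e \<in> E" shows "conn (N e)"
  unfolding conn_def adj_def using N_finite[OF assms] N_nonempty[OF assms] assms by blast

lemma conn_Un:
  assumes A: "conn A" and B: "conn B" and "adj A B \<or> A \<inter> B \<noteq> {}"
  shows "conn (A \<union> B)"
  unfolding conn_def
proof (intro conjI allI impI)
  show "finite (A \<union> B)" "A \<union> B \<noteq> {}" using A B by (auto simp: conn_def)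
  fix D assume D: "D \<subset> A \<union> B" "D \<noteq> {}"
  have cut: "adj D (A \<union> B - D)" if "conn X" "X \<subseteq> A \<union> B" "X \<inter> D \<noteq> {}" "\<not> X \<subseteq> D" for X
    using connD[OF that(1), of "X \<inter> D"] adj_mono[of "X \<inter> D" "X - X \<inter> D" D "A \<union> B - D"] that by blast
  show "adj D (A \<union> B - D)"
  proof (cases "(A \<inter> D \<noteq> {} \<and> \<not> A \<subseteq> D) \<or> (B \<inter> D \<noteq> {} \<and> \<not> B \<subseteq> D)")
    case True
    then show ?thesis using cut[OF A] cut[OF B] by blast
  next
    case False
    then consider "A \<subseteq> D" "B \<inter> D = {}" | "B \<subseteq> D" "A \<inter> D = {}" using D by blast
    then show ?thesis
    proof cases
      case 1
      then have "A \<inter> B = {}" by blast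
      then have "adj A B" using assms(3) by blast
      then show ?thesis using adj_mono[of A B D "A \<union> B - D"] 1 by blast
    next
      case 2
      then have "A \<inter> B = {}" by blast
      then have "adj B A" using assms(3) adj_sym by blast
      then show ?thesis using adj_mono[of B A D "A \<union> B - D"] 2 by blast
    qed
  qed
qed

text \<open>A set \<open>D\<close> that avoids \<open>K\<close> has an edge leaving it, because
  \<open>W\<close> is connected, and this edge cannot leave \<open>K \<union> L\<close>. Typically
  \<open>L\<close> collects some of the components of \<open>W - K\<close>.\<close>

lemma conn_rest:
  assumes K: "conn K" and W: "conn W" "K \<union> L \<subseteq> W" and L: "\<not> adj L (W - (K \<union> L))"
  shows "conn (K \<union> L)"
  unfolding conn_def
proof (intro conjI allI impI)
  show "finite (K \<union> L)" using W conn_finite finite_subset by blast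
  show "K \<union> L \<noteq> {}" using K conn_nonempty by blast
  have *: "adj D (K \<union> L - D)" if D: "D \<subseteq> K \<union> L" "D \<noteq> {}" "D \<inter> K = {}" for D
  proof -
    have "K \<noteq> {}" using K by (rule conn_nonempty)
    then have "D \<noteq> W" using D W(2) by blast
    then have "adj D (W - D)" using connD[OF W(1), of D] D W(2) by blast
    moreover have "W - D = (K \<union> L - D) \<union> (W - (K \<union> L))" using D W(2) by blast
    moreover have "D \<subseteq> L" using D by blast
    then have "\<not> adj D (W - (K \<union> L))" using L adj_mono[of D "W - (K \<union> L)" L "W - (K \<union> L)"] by blast
    ultimately show ?thesis by (simp add: adj_Un)
  qed
  fix D assume D: "D \<subset> K \<union> L" "D \<noteq> {}"
  consider "D \<inter> K = {}" | "K \<subseteq> D" | "D \<inter> K \<noteq> {}" "D \<inter> K \<noteq> K" by blast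
  then show "adj D (K \<union> L - D)"
  proof cases
    case 1
    then show ?thesis using * D by blast
  next
    case 2
    have "adj (K \<union> L - D) (K \<union> L - (K \<union> L - D))" using *[of "K \<union> L - D"] D 2 by blast
    moreover have "K \<union> L - (K \<union> L - D) = D" using D by blast
    ultimately show ?thesis using adj_sym by simp
  next
    case 3
    then have "adj (D \<inter> K) (K - D \<inter> K)" using connD[OF K, of "D \<inter> K"] by blast
    then show ?thesis using adj_mono[of "D \<inter> K" "K - D \<inter> K" D "K \<union> L - D"] by blast
  qed
qed

lemma conn_maximal:
  assumes "finite S" "conn C0" "C0 \<subseteq> S"
  shows "\<exists>C. C0 \<subseteq> C \<and> C \<subseteq> S \<and> conn C \<and> \<not> adj C (S - C)"
proof -
  let ?F = "{C. C0 \<subseteq> C \<and> C \<subseteq> S \<and> conn C}"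
  have "finite ?F" by (rule finite_subset[of _ "Pow S"]) (use assms(1) in auto)
  moreover have "C0 \<in> ?F" using assms by blast
  ultimately obtain C where C: "C \<in> ?F" "\<And>X. X \<in> ?F \<Longrightarrow> C \<subseteq> X \<Longrightarrow> X = C"
    by (rule finite_maximal_set) blast
  have "\<not> adj C (S - C)"
  proof
    assume "adj C (S - C)"
    then obtain e x where e: "e \<in> E" "N e \<inter> C \<noteq> {}" "x \<in> N e" "x \<in> S - C" by (auto simp: adj_def)
    then have "adj C {x}" by (auto simp: adj_def)
    then have "conn (C \<union> {x})" using C(1) conn_singleton conn_Un by blast
    then have "C \<union> {x} \<in> ?F" using C(1) e(4) by blast
    then show False using C(2) e(4) by blast
  qed
  then show ?thesis using C(1) by blast
qed

lemma conn_grow: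
  assumes T: "conn T" and S: "S \<subseteq> T" "S \<noteq> {}"
    and step: "\<And>A x. A \<subseteq> T \<Longrightarrow> x \<in> T - A \<Longrightarrow> adj A {x} \<Longrightarrow> P A \<Longrightarrow> P (insert x A)" and P: "P S"
  shows "P T"
proof -
  let ?F = "{A. S \<subseteq> A \<and> A \<subseteq> T \<and> P A}"
  have "finite ?F" by (rule finite_subset[of _ "Pow T"]) (use conn_finite[OF T] in auto)
  moreover have "S \<in> ?F" using S P by blast
  ultimately obtain A where A: "A \<in> ?F" "\<And>X. X \<in> ?F \<Longrightarrow> A \<subseteq> X \<Longrightarrow> X = A"
    by (rule finite_maximal_set) blast
  have "A = T"
  proof (rule ccontr)
    assume "A \<noteq> T"
    then have "adj A (T - A)" using connD[OF T] A S by blast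
    then obtain e x where e: "e \<in> E" "N e \<inter> A \<noteq> {}" "x \<in> N e" "x \<in> T - A" by (auto simp: adj_def)
    then have "adj A {x}" by (auto simp: adj_def)
    then have "insert x A \<in> ?F" using step[of A x] A(1) e(4) by blast
    then show False using A(2) e(4) by blast
  qed
  then show ?thesis using A by blast
qed

text \<open>Each vertex added while growing \<open>S\<close> to the connected set \<open>T\<close>
  brings at least one edge, so the number of surplus edges never drops.\<close>

lemma cyc_mono:
  assumes T: "conn T" and S: "S \<subseteq> T" "S \<noteq> {}" and c: "cyc S r"
  shows "cyc T r"
proof (rule conn_grow[OF T S, where P = "\<lambda>X. cyc X r"])
  show "cyc S r" by (rule c)
  fix A x assume A: "A \<subseteq> T" "x \<in> T - A" "adj A {x}" "cyc A r"
  have "es (A \<union> {x}) = es A + es {x} + ec A {x}" using A(2) by (intro es_Un) auto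
  moreover have "finite A" using conn_finite[OF T] A(1) finite_subset by blast
  ultimately show "cyc (insert x A) r" using A adj_ec[of A "{x}"] unfolding cyc_def by auto
qed

lemma cyc_le: "cyc S r \<Longrightarrow> q \<le> r \<Longrightarrow> cyc S q"
  unfolding cyc_def by simp

lemma conn_cyc0: assumes "conn S" shows "cyc S 0"
proof -
  obtain x where "x \<in> S" using conn_nonempty[OF assms] by blast
  then show ?thesis using cyc_mono[OF assms, of "{x}" 0] by (simp add: cyc_def)
qed

lemma cyc_Un:
  assumes "conn A" "conn B" "A \<inter> B = {}" "cyc A r" "cyc B q" "s + 1 \<le> ec A B"
  shows "cyc (A \<union> B) (r + q + s)"
  using assms es_Un[of A B] conn_finite[of A] conn_finite[of B]
  unfolding cyc_def by (simp add: card_Un_disjoint)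

text \<open>The last clause says in the language of counting that \<open>T\<close> is a forest. The
  tree grows leaf by leaf, and a set of edges containing the new one gains the new vertex.\<close>

lemma spanning_tree:
  assumes "conn S"
  shows "\<exists>T. T \<subseteq> {e \<in> E. N e \<subseteq> S} \<and> card T + 1 = card S \<and> (\<forall>F\<subseteq>T. F \<noteq> {} \<longrightarrow> card F < card (\<Union>(N ` F)))"
    (is "?P S")
proof -
  obtain x0 where x0: "x0 \<in> S" using conn_nonempty[OF assms] by blast
  show ?thesis
  proof (rule conn_grow[OF assms, of "{x0}" ?P])
    fix A x assume A: "A \<subseteq> S" "x \<in> S - A" "adj A {x}" and "?P A"
    then obtain T where T: "T \<subseteq> {e \<in> E. N e \<subseteq> A}" "card T + 1 = card A"
      "\<And>F. F \<subseteq> T \<Longrightarrow> F \<noteq> {} \<Longrightarrow> card F < card (\<Union>(N ` F))" by blast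
    obtain e where e: "e \<in> E" "N e \<inter> A \<noteq> {}" "x \<in> N e" using A(3) by (auto simp: adj_def)
    obtain y where y: "N e = {x, y}" using N_pair[OF e(1,3)] by blast
    have Ne: "N e \<subseteq> insert x A" using y e(2) A(2) by auto
    have finA: "finite A" using conn_finite[OF assms] A(1) finite_subset by blast
    have finT: "finite T" using T(1) by (intro finite_subset[OF _ finE]) auto
    have eT: "e \<notin> T" using T(1) e(3) A(2) by blast
    have "card F < card (\<Union>(N ` F))" if F: "F \<subseteq> insert e T" "F \<noteq> {}" for F
    proof (cases "e \<in> F")
      case False
      then show ?thesis using T(3)[of F] F by blast
    next
      case True
      have "finite F" using F(1) finT finite_subset[of F "insert e T"] by simp
      then have fin: "finite (\<Union>(N ` F))" using F(1) T(1) N_finite e(1) by auto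
      have x: "x \<notin> \<Union>(N ` (F - {e}))" using F(1) T(1) A(2) by blast
      have cF: "card F = Suc (card (F - {e}))"
        using True F(1) finT by (metis card.remove finite_insert finite_subset)
      show ?thesis
      proof (cases "F - {e} = {}")
        case True
        then have "F = {e}" using \<open>e \<in> F\<close> by blast
        moreover obtain y where "y \<in> N e" "y \<in> A" using e(2) by blast
        then have "card {x, y} \<le> card (N e)" "x \<noteq> y" using e A(2) N_finite by (auto intro: card_mono)
        ultimately show ?thesis by simp
      next
        case False
        have "card (F - {e}) < card (\<Union>(N ` (F - {e})))" using T(3)[of "F - {e}"] F(1) False by blast
        moreover have "insert x (\<Union>(N ` (F - {e}))) \<subseteq> \<Union>(N ` F)" using True e(3) by blast
        then have "card (insert x (\<Union>(N ` (F - {e})))) \<le> card (\<Union>(N ` F))" using fin card_mono by blast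
        moreover have "card (insert x (\<Union>(N ` (F - {e})))) = Suc (card (\<Union>(N ` (F - {e}))))"
          using x fin by (intro card_insert_disjoint) (auto intro: finite_subset)
        ultimately show ?thesis using cF by simp
      qed
    qed
    moreover have "insert e T \<subseteq> {e \<in> E. N e \<subseteq> insert x A}" using T(1) e(1) Ne by blast
    moreover have "card (insert e T) + 1 = card (insert x A)" using T(2) eT finT finA A(2) by simp
    ultimately show "?P (insert x A)" by blast
  next
    show "?P {x0}" by (intro exI[of _ "{}"]) auto
  qed (use x0 in auto)
qed

end

section \<open>Contraction of spanning trees of disjoint parts\<close>

definition list_ends :: "(nat \<times> nat) list \<Rightarrow> nat \<Rightarrow> nat set" where
  "list_ends xs p = {fst (xs ! p), snd (xs ! p)}"

context mgraph
begin

text \<open>In each part that it meets, an edge set has fewer tree edges than covered vertices.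
  Hence the tree edges leave room for one further edge per part met, which is the Hall bound of the
  quotient graph. Conversely, adding the whole tree of every part involved makes this bound
  exact.\<close>

lemma parts_core:
  assumes S: "\<And>i. i < k \<Longrightarrow> conn (S i)" "\<And>i j. i < k \<Longrightarrow> j < k \<Longrightarrow> i \<noteq> j \<Longrightarrow> S i \<inter> S j = {}"
    and T: "\<And>i. i < k \<Longrightarrow> T i \<subseteq> {e \<in> E. N e \<subseteq> S i} \<and> card (T i) + 1 = card (S i) \<and>
      (\<forall>F\<subseteq>T i. F \<noteq> {} \<longrightarrow> card F < card (\<Union>(N ` F)))"
    and g: "inj_on g {..<length xs}"
      "\<And>p. p < length xs \<Longrightarrow> g p \<in> E - (\<Union>i<k. T i)"
      "\<And>p. p < length xs \<Longrightarrow> fst (xs ! p) < k \<and> snd (xs ! p) < k \<and>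
        N (g p) \<subseteq> S (fst (xs ! p)) \<union> S (snd (xs ! p)) \<and>
        N (g p) \<inter> S (fst (xs ! p)) \<noteq> {} \<and> N (g p) \<inter> S (snd (xs ! p)) \<noteq> {}"
  shows "emb E (hall N) {..<length xs} (hall (list_ends xs))"
proof -
  define C where "C = (\<Union>i<k. T i)"
  have finS: "finite (S i)" if "i < k" for i using S(1)[OF that] conn_finite by blast
  have TE: "T i \<subseteq> E" if "i < k" for i using T[OF that] by blast
  have finT: "finite (T i)" if "i < k" for i using TE[OF that] finE finite_subset by blast
  have Tdis: "T i \<inter> T j = {}" if "i < k" "j < k" "i \<noteq> j" for i j
  proof -
    have "e \<notin> T j" if "e \<in> T i" for e
    proof -
      have "N e \<subseteq> S i" "e \<in> E" using T[OF \<open>i < k\<close>] that by auto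
      then have "\<not> N e \<subseteq> S j" using S(2)[OF \<open>i < k\<close> \<open>j < k\<close> \<open>i \<noteq> j\<close>] N_nonempty[of e] by blast
      then show ?thesis using T[OF \<open>j < k\<close>] by auto
    qed
    then show ?thesis by blast
  qed
  have CE: "C \<subseteq> E" using TE by (auto simp: C_def)
  have finC: "finite C" using CE finE finite_subset by blast
  have main: "hall (list_ends xs) X \<longleftrightarrow> hall N (g ` X \<union> C)" if X: "X \<subseteq> {..<length xs}" for X
  proof
    assume h: "hall (list_ends xs) X"
    show "hall N (g ` X \<union> C)" unfolding hall_def
    proof (intro allI impI)
      fix J assume J: "J \<subseteq> g ` X \<union> C"
      define V where "V = \<Union>(N ` J)"
      define I0 where "I0 = {i. i < k \<and> V \<inter> S i \<noteq> {}}"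
      define Y where "Y = {p \<in> X. g p \<in> J}"
      have gE: "g ` X \<subseteq> E" using g(2) X by auto
      have JE: "J \<subseteq> E" using J gE CE by blast
      have finJ: "finite J" using JE finE finite_subset by blast
      have finI: "finite I0" by (simp add: I0_def)
      have finX: "finite X" using finite_subset[OF X] by simp
      have finY: "finite Y" using finX by (simp add: Y_def)
      have inV: "V = (\<Union>i\<in>I0. V \<inter> S i)"
      proof -
        have "\<exists>i<k. v \<in> S i" if ve: "v \<in> N e" "e \<in> J" for v e
        proof (cases "e \<in> C")
          case True
          then obtain i where "i < k" "e \<in> T i" by (auto simp: C_def)
          then show ?thesis using T[of i] ve(1) by auto
        next
          case False
          then obtain p where "p \<in> X" "e = g p" using ve J by blast
          then show ?thesis using g(3)[of p] X ve(1) by blast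
        qed
        then have "\<exists>i<k. v \<in> S i" if "v \<in> V" for v using that unfolding V_def by blast
        then show ?thesis unfolding I0_def by blast
      qed
      have finV: "finite V" using finJ JE N_finite by (auto simp: V_def)
      have cardV: "card V = (\<Sum>i\<in>I0. card (V \<inter> S i))"
        by (subst inV, rule card_UN_disjoint) (use finI finV S(2) in \<open>auto simp: I0_def\<close>)
      have "J \<inter> C = (\<Union>i\<in>I0. J \<inter> T i)"
      proof -
        have "i \<in> I0" if "e \<in> J" "e \<in> T i" "i < k" for e i
        proof -
          have "e \<in> E" "N e \<subseteq> S i" using T[OF that(3)] that(2) by auto
          then show ?thesis using N_nonempty[of e] that by (auto simp: I0_def V_def)
        qed
        then show ?thesis by (auto simp: C_def I0_def)
      qed
      then have "card (J \<inter> C) = (\<Sum>i\<in>I0. card (J \<inter> T i))"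
      proof -
        have "card (\<Union>i\<in>I0. J \<inter> T i) = (\<Sum>i\<in>I0. card (J \<inter> T i))"
        proof (rule card_UN_disjoint)
          show "\<forall>i\<in>I0. \<forall>j\<in>I0. i \<noteq> j \<longrightarrow> J \<inter> T i \<inter> (J \<inter> T j) = {}"
            using Tdis by (auto simp: I0_def)
        qed (use finI finJ in auto)
        then show ?thesis by (simp only: \<open>J \<inter> C = (\<Union>i\<in>I0. J \<inter> T i)\<close>)
      qed
      also have "\<dots> \<le> (\<Sum>i\<in>I0. card (V \<inter> S i) - 1)"
      proof (rule sum_mono)
        fix i assume i: "i \<in> I0"
        then have ik: "i < k" "V \<inter> S i \<noteq> {}" by (auto simp: I0_def)
        show "card (J \<inter> T i) \<le> card (V \<inter> S i) - 1"
        proof (cases "J \<inter> T i = {}")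
          case False
          then have "card (J \<inter> T i) < card (\<Union>(N ` (J \<inter> T i)))" using T[OF ik(1)] by blast
          also have "\<dots> \<le> card (V \<inter> S i)"
            using finV T[OF ik(1)] by (intro card_mono) (auto simp: V_def)
          finally show ?thesis by simp
        qed (metis card.empty le0)
      qed
      also have "\<dots> + card I0 = card V"
      proof -
        have ge1: "1 \<le> card (V \<inter> S i)" if "i \<in> I0" for i
          using that finV by (simp add: I0_def Suc_le_eq card_gt_0_iff)
        have "(\<Sum>i\<in>I0. (card (V \<inter> S i) - 1) + 1) = (\<Sum>i\<in>I0. card (V \<inter> S i))"
          by (intro sum.cong refl le_add_diff_inverse2 ge1)
        then show ?thesis using cardV by (simp only: sum.distrib) simp
      qed
      finally have 1: "card (J \<inter> C) + card I0 \<le> card V" by simp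
      have "J - C \<subseteq> g ` Y" using J by (auto simp: Y_def)
      then have "card (J - C) \<le> card Y" using finY by (metis card_image_le card_mono finite_imageI order_trans)
      also have "card Y \<le> card (\<Union>(list_ends xs ` Y))" using h by (simp add: hall_def Y_def)
      also have "\<dots> \<le> card I0"
      proof (rule card_mono[OF finI], rule UN_least)
        fix p assume p: "p \<in> Y"
        then have "p < length xs" "N (g p) \<subseteq> V" using X by (auto simp: Y_def V_def)
        then show "list_ends xs p \<subseteq> I0" using g(3)[of p] by (auto simp: list_ends_def I0_def)
      qed
      finally have "card (J - C) \<le> card I0" .
      moreover have "card J = card (J \<inter> C) + card (J - C)"
        using finJ by (metis Int_Diff_Un Int_Diff_disjoint card_Un_disjoint finite_Diff finite_Int)
      ultimately show "card J \<le> card (\<Union>(N ` J))" using 1 by (simp add: V_def)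
    qed
  next
    assume h: "hall N (g ` X \<union> C)"
    show "hall (list_ends xs) X" unfolding hall_def
    proof (intro allI impI)
      fix Y assume Y: "Y \<subseteq> X"
      define I0 where "I0 = \<Union>(list_ends xs ` Y)"
      have I0k: "i < k" if iI: "i \<in> I0" for i
      proof -
        obtain p where "p \<in> Y" "i = fst (xs ! p) \<or> i = snd (xs ! p)"
          using iI by (auto simp: I0_def list_ends_def)
        then show ?thesis using g(3)[of p] Y X by auto
      qed
      then have "I0 \<subseteq> {..<k}" by auto
      then have finI: "finite I0" by (rule finite_subset) simp
      define J where "J = g ` Y \<union> (\<Union>i\<in>I0. T i)"
      have finY: "finite Y" using finite_subset[OF subset_trans[OF Y X]] by simp
      have "J \<subseteq> g ` X \<union> C" using Y I0k by (auto simp: J_def C_def)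
      then have "card J \<le> card (\<Union>(N ` J))" using h by (simp add: hall_def)
      also have "\<dots> \<le> card (\<Union>i\<in>I0. S i)"
      proof (rule card_mono)
        show "finite (\<Union>i\<in>I0. S i)" using finI I0k finS by auto
        show "\<Union>(N ` J) \<subseteq> (\<Union>i\<in>I0. S i)"
        proof (rule UN_least)
          fix e assume "e \<in> J"
          then consider p where "p \<in> Y" "e = g p" | i where "i \<in> I0" "e \<in> T i" by (auto simp: J_def)
          then show "N e \<subseteq> (\<Union>i\<in>I0. S i)"
          proof cases
            case 1
            then have "fst (xs ! p) \<in> I0" "snd (xs ! p) \<in> I0" by (auto simp: I0_def list_ends_def)
            moreover have "p < length xs" using 1 X Y by auto
            ultimately have "N (g p) \<subseteq> S (fst (xs ! p)) \<union> S (snd (xs ! p))"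
              "fst (xs ! p) \<in> I0" "snd (xs ! p) \<in> I0" using g(3)[of p] by simp_all
            then show ?thesis unfolding 1(2) by blast
          next
            case 2
            then have "N e \<subseteq> S i" using T[OF I0k[OF 2(1)]] by auto
            then show ?thesis using 2(1) by blast
          qed
        qed
      qed
      also have "\<dots> = (\<Sum>i\<in>I0. card (S i))"
        using finI by (intro card_UN_disjoint ballI impI) (use I0k finS S(2) in blast)+
      also have "\<dots> = (\<Sum>i\<in>I0. card (T i)) + card I0"
      proof -
        have "(\<Sum>i\<in>I0. card (S i)) = (\<Sum>i\<in>I0. card (T i) + 1)" using T I0k by (intro sum.cong) auto
        then show ?thesis by (simp only: sum.distrib) simp
      qed
      also have "(\<Sum>i\<in>I0. card (T i)) = card (\<Union>i\<in>I0. T i)"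
        using finI by (intro card_UN_disjoint[symmetric] ballI impI) (use I0k finT Tdis in blast)+
      finally have 1: "card J \<le> card (\<Union>i\<in>I0. T i) + card I0" .
      have "g ` Y \<inter> (\<Union>i\<in>I0. T i) = {}" 
      proof -
        have "g p \<notin> T i" if "p \<in> Y" "i \<in> I0" for p i
          using g(2)[of p] I0k[OF that(2)] X Y that(1) by auto
        then show ?thesis by blast
      qed
      then have "card J = card (g ` Y) + card (\<Union>i\<in>I0. T i)"
        unfolding J_def using finY finI I0k finT by (intro card_Un_disjoint) auto
      moreover have "card (g ` Y) = card Y" using g(1) X Y by (meson card_image inj_on_subset subset_trans)
      ultimately show "card Y \<le> card (\<Union>(list_ends xs ` Y))" using 1 by (simp add: I0_def)
    qed
  qed
  have "hall (list_ends xs) {}" by (simp add: hall_def)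
  then have "hall N C" using main[of "{}"] by simp
  moreover have "g ` {..<length xs} \<subseteq> E - C" using g(2) by (auto simp: C_def)
  ultimately show ?thesis unfolding emb_def using main CE g(1) by blast
qed

text \<open>Contract a spanning tree of each part \<open>Ss ! i\<close>; the surplus edges inside it become loops.\<close>

lemma parts_minor:
  assumes conn: "\<forall>S\<in>set Ss. conn S" and dis: "sorted_wrt (\<lambda>S S'. S \<inter> S' = {}) Ss"
    and xs: "\<forall>(i, j)\<in>set xs. j < length Ss \<and>
      ((i < j \<and> count_list xs (i, j) \<le> ec (Ss ! i) (Ss ! j)) \<or> (i = j \<and> cyc (Ss ! i) (count_list xs (i, i))))"
  shows "emb E (hall N) {..<length xs} (hall (list_ends xs))"
proof -
  define k where "k = length Ss"
  define S where "S i = Ss ! i" for i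
  have S: "conn (S i)" if "i < k" for i using conn that by (simp add: S_def k_def)
  have Sd: "S i \<inter> S j = {}" if "i < k" "j < k" "i \<noteq> j" for i j
    using sorted_wrt_nth_less[OF dis, of i j] sorted_wrt_nth_less[OF dis, of j i] that
    by (cases "i < j") (auto simp: S_def k_def)
  obtain T where T: "\<And>i. i < k \<Longrightarrow> T i \<subseteq> {e \<in> E. N e \<subseteq> S i} \<and> card (T i) + 1 = card (S i) \<and>
      (\<forall>F\<subseteq>T i. F \<noteq> {} \<longrightarrow> card F < card (\<Union>(N ` F)))"
    using spanning_tree[OF S] by metis
  \<comment> \<open>Candidates for a list entry: the edges between two parts, or the non-tree edges
    inside one part. Equal entries need distinct candidates, hence the comparison with
    \<open>count_list\<close>.\<close>
  define Av where "Av = (\<lambda>(i, j). if i = j then {e \<in> E. N e \<subseteq> S i} - T i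
      else {e \<in> E. N e \<inter> S i \<noteq> {} \<and> N e \<inter> S j \<noteq> {}})"
  define pos where "pos c = {p. p < length xs \<and> xs ! p = c}" for c
  have x: "j < k" "i \<le> j" "i < j \<Longrightarrow> count_list xs (i, j) \<le> ec (S i) (S j)"
      "i = j \<Longrightarrow> cyc (S i) (count_list xs (i, i))" if "(i, j) \<in> set xs" for i j
    using xs that by (auto simp: S_def k_def)
  have cnt: "card (pos c) = count_list xs c" for c
    unfolding pos_def by (simp add: count_list_eq_length_filter length_filter_conv_card eq_commute)
  have finAv: "finite (Av c)" for c using finE by (cases c) (auto simp: Av_def)
  have "\<exists>h. inj_on h (pos c) \<and> h ` pos c \<subseteq> Av c" if c: "c \<in> set xs" for c
  proof -
    obtain i j where ij: "c = (i, j)" by (cases c)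
    have "finite (pos c)" by (simp add: pos_def)
    have "count_list xs c \<le> card (Av c)"
    proof (cases "i = j")
      case False
      then have "i < j" using x(2)[of i j] c ij by simp
      then show ?thesis using x(3)[of i j] c ij by (simp add: Av_def ec_def)
    next
      case True
      have ik: "i < k" using x[of i j] c ij True by simp
      have "card (S i) + count_list xs c \<le> es (S i) + 1" using x(4)[of i j] c ij True by (simp add: cyc_def)
      moreover have "card ({e \<in> E. N e \<subseteq> S i} - T i) = es (S i) - card (T i)"
        using T[OF ik] finE finite_subset unfolding es_def
        by (intro card_Diff_subset) (auto intro: finite_subset[OF _ finE])
      moreover have "card (T i) + 1 = card (S i)" using T[OF ik] by blast
      ultimately have "count_list xs c \<le> card ({e \<in> E. N e \<subseteq> S i} - T i)" using ij True by simp
      then show ?thesis using ij True by (simp add: Av_def)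
    qed
    then have "card (pos c) \<le> card (Av c)" using cnt by simp
    then show ?thesis using card_le_inj[OF \<open>finite (pos c)\<close> finAv] by blast
  qed
  then obtain h where h: "\<And>c. c \<in> set xs \<Longrightarrow> inj_on (h c) (pos c) \<and> h c ` pos c \<subseteq> Av c" by metis
  define g where "g p = h (xs ! p) p" for p
  have gAv: "g p \<in> Av (xs ! p)" if "p < length xs" for p
    using h[of "xs ! p"] that by (auto simp: g_def pos_def)
  have gN: "fst (xs ! p) < k \<and> snd (xs ! p) < k \<and> g p \<in> E \<and>
        N (g p) \<subseteq> S (fst (xs ! p)) \<union> S (snd (xs ! p)) \<and>
        N (g p) \<inter> S (fst (xs ! p)) \<noteq> {} \<and> N (g p) \<inter> S (snd (xs ! p)) \<noteq> {}" if p: "p < length xs" for p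
  proof -
    obtain i j where ij: "xs ! p = (i, j)" by (cases "xs ! p")
    then have mem: "(i, j) \<in> set xs" using p by (metis nth_mem)
    note xi = x[OF mem]
    show ?thesis
    proof (cases "i = j")
      case True
      then show ?thesis using gAv[OF p] ij xi N_nonempty[of "g p"] by (auto simp: Av_def)
    next
      case False
      then have "g p \<in> E" "N (g p) \<inter> S i \<noteq> {}" "N (g p) \<inter> S j \<noteq> {}"
        using gAv[OF p] ij by (auto simp: Av_def)
      moreover from this obtain a b where "N (g p) = {a, b}" "a \<in> S i" "b \<in> S j"
        using N_cross[of "g p" "S i" "S j"] Sd[of i j] xi(1,2) False by auto
      ultimately show ?thesis using ij xi False by auto
    qed
  qed
  have gT: "g p \<notin> T l" if p: "p < length xs" and l: "l < k" for p l
  proof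
    assume gT: "g p \<in> T l"
    then have Nl: "N (g p) \<subseteq> S l" using T[OF l] by blast
    have "fst (xs ! p) = l" "snd (xs ! p) = l"
      using gN[OF p] Nl Sd[of "fst (xs ! p)" l] Sd[of "snd (xs ! p)" l] l by blast+
    then have "xs ! p = (l, l)" by (metis prod.collapse)
    then show False using gAv[OF p] gT by (simp add: Av_def)
  qed
  have "inj_on g {..<length xs}"
  proof (rule inj_onI)
    fix p q assume p: "p \<in> {..<length xs}" and q: "q \<in> {..<length xs}" and eq: "g p = g q"
    obtain i j where ij: "xs ! p = (i, j)" by (cases "xs ! p")
    obtain i' j' where ij': "xs ! q = (i', j')" by (cases "xs ! q")
    have le: "i \<le> j" "i' \<le> j'" using x(2) p q ij ij' by (metis lessThan_iff nth_mem)+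
    have in1: "i < k" "j < k" "N (g p) \<subseteq> S i \<union> S j" "N (g p) \<inter> S i \<noteq> {}" "N (g p) \<inter> S j \<noteq> {}"
      using gN[of p] p ij by auto
    have in2: "i' < k" "j' < k" "N (g p) \<subseteq> S i' \<union> S j'" "N (g p) \<inter> S i' \<noteq> {}" "N (g p) \<inter> S j' \<noteq> {}"
      using gN[of q] q ij' eq by auto
    \<comment> \<open>An edge determines the pair of parts that it meets, and \<open>le\<close>
      fixes the order of the pair, so equal edges come from equal entries.\<close>
    have "l = i \<or> l = j" if "l < k" "N (g p) \<inter> S l \<noteq> {}" for l
      using Sd[of l i] Sd[of l j] in1 that by blast
    then have "i' = i \<or> i' = j" "j' = i \<or> j' = j" using in2 by blast+
    moreover have "l = i' \<or> l = j'" if "l < k" "N (g p) \<inter> S l \<noteq> {}" for l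
      using Sd[of l i'] Sd[of l j'] in2 that by blast
    then have "i = i' \<or> i = j'" "j = i' \<or> j = j'" using in1 by blast+
    ultimately have "i = i'" "j = j'" using le by auto
    then have c: "xs ! q = xs ! p" using ij ij' by simp
    then have "p \<in> pos (xs ! p)" "q \<in> pos (xs ! p)" using p q by (auto simp: pos_def)
    then show "p = q" using h[of "xs ! p"] eq c p by (auto simp: g_def inj_on_def)
  qed
  then show ?thesis
    using gN gT by (intro parts_core[where k = k and S = S and T = T and g = g] S Sd T) auto
qed

end

text \<open>\<open>matches [] es\<close> is an executable form of the Hall condition: distinct endpoints can be chosen for
  the edges of \<open>es\<close>.\<close>

fun matches :: "nat list \<Rightarrow> (nat \<times> nat) list \<Rightarrow> bool" where
  "matches U [] \<longleftrightarrow> True"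
| "matches U ((a, b) # es) \<longleftrightarrow>
     (a \<notin> set U \<and> matches (a # U) es) \<or> (b \<notin> set U \<and> matches (b # U) es)"

lemma matches_iff:
  "matches U es \<longleftrightarrow> (\<exists>ws. length ws = length es \<and> distinct ws \<and> set ws \<inter> set U = {} \<and>
     (\<forall>i<length es. ws ! i \<in> {fst (es ! i), snd (es ! i)}))"
proof (induction U es rule: matches.induct)
  case (2 U a b es)
  have "(\<exists>ws. length ws = length ((a, b) # es) \<and> distinct ws \<and> set ws \<inter> set U = {} \<and>
     (\<forall>i<length ((a, b) # es). ws ! i \<in> {fst (((a, b) # es) ! i), snd (((a, b) # es) ! i)})) \<longleftrightarrow>
     (\<exists>w ws. length ws = length es \<and> w \<notin> set ws \<and> distinct ws \<and> w \<notin> set U \<and> set ws \<inter> set U = {} \<and>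
       w \<in> {a, b} \<and> (\<forall>i<length es. ws ! i \<in> {fst (es ! i), snd (es ! i)}))" (is "?L \<longleftrightarrow> ?R")
  proof
    assume ?L
    then obtain l where l: "length l = Suc (length es)" "distinct l" "set l \<inter> set U = {}"
      "\<forall>i<Suc (length es). l ! i \<in> {fst (((a, b) # es) ! i), snd (((a, b) # es) ! i)}" by auto
    obtain w ws where ws: "l = w # ws" using l(1) by (cases l) auto
    have "w \<in> {a, b}" using l(4) ws by (auto dest: spec[of _ 0])
    moreover have "\<forall>i<length es. ws ! i \<in> {fst (es ! i), snd (es ! i)}"
      using l(4) ws by (auto dest: spec[of _ "Suc _"])
    ultimately show ?R using l ws by (intro exI[of _ w] exI[of _ ws]) auto
  next
    assume ?R
    then obtain w ws where "length ws = length es \<and> w \<notin> set ws \<and> distinct ws \<and> w \<notin> set U \<and> set ws \<inter> set U = {} \<and>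
       w \<in> {a, b} \<and> (\<forall>i<length es. ws ! i \<in> {fst (es ! i), snd (es ! i)})" by blast
    then show ?L by (intro exI[of _ "w # ws"]) (auto simp: nth_Cons split: nat.splits)
  qed
  moreover have "?R \<longleftrightarrow> matches U ((a, b) # es)" unfolding matches.simps "2.IH" by auto
  ultimately show ?case by blast
qed simp

lemma hall_list_ends:
  assumes "distinct l" "set l \<subseteq> {..<length xs}"
  shows "hall (list_ends xs) (set l) \<longleftrightarrow> matches [] (map ((!) xs) l)"
proof
  assume h: "hall (list_ends xs) (set l)"
  have "\<exists>\<phi>. inj_on \<phi> (set l) \<and> (\<forall>x\<in>set l. \<phi> x \<in> list_ends xs x)"
    by (rule hall_matching) (use h in \<open>auto simp: hall_def list_ends_def\<close>)
  then obtain \<phi> where "inj_on \<phi> (set l)" "\<forall>x\<in>set l. \<phi> x \<in> list_ends xs x" by blast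
  then show "matches [] (map ((!) xs) l)" unfolding matches_iff
    using assms(1) by (intro exI[of _ "map \<phi> l"]) (auto simp: distinct_map list_ends_def)
next
  assume "matches [] (map ((!) xs) l)"
  then obtain ws where ws: "length ws = length l" "distinct ws"
      "\<And>i. i < length l \<Longrightarrow> ws ! i \<in> list_ends xs (l ! i)"
    unfolding matches_iff by (auto simp: list_ends_def)
  show "hall (list_ends xs) (set l)" unfolding hall_def
  proof (intro allI impI)
    fix J assume J: "J \<subseteq> set l"
    define I where "I = {i. i < length l \<and> l ! i \<in> J}"
    have "J = (!) l ` I"
    proof
      show "J \<subseteq> (!) l ` I"
      proof
        fix x assume "x \<in> J"
        then obtain i where "i < length l" "l ! i = x" using J by (metis in_set_conv_nth subsetD)
        then show "x \<in> (!) l ` I" using \<open>x \<in> J\<close> by (auto simp: I_def)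
      qed
    qed (auto simp: I_def)
    then have "card J \<le> card I" using card_image_le[of I "(!) l"] by (simp add: I_def)
    also have "card I = card ((!) ws ` I)" using ws(1,2)
      by (intro card_image[symmetric]) (auto simp: inj_on_def I_def nth_eq_iff_index_eq)
    also have "\<dots> \<le> card (\<Union>(list_ends xs ` J))"
    proof (rule card_mono)
      show "finite (\<Union>(list_ends xs ` J))" using J finite_subset by (auto simp: list_ends_def)
      show "(!) ws ` I \<subseteq> \<Union>(list_ends xs ` J)" using ws(3) by (auto simp: I_def)
    qed
    finally show "card J \<le> card (\<Union>(list_ends xs ` J))" .
  qed
qed

text \<open>Contracting the edges \<open>cs\<close> of the graph \<open>xs\<close> and keeping only the edges \<open>gs\<close> yields \<open>ys\<close>.\<close>

definition certificate :: "(nat \<times> nat) list \<Rightarrow> (nat \<times> nat) list \<Rightarrow> nat list \<Rightarrow> nat list \<Rightarrow> bool" where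
  "certificate xs ys gs cs \<longleftrightarrow> length gs = length ys \<and> distinct (gs @ cs) \<and>
     (\<forall>p\<in>set (gs @ cs). p < length xs) \<and>
     (\<forall>s\<in>set (subseqs [0..<length ys]).
        matches [] (map ((!) ys) s) = matches [] (map ((!) xs) (map ((!) gs) s @ cs)))"

lemma certificate_emb:
  assumes "certificate xs ys gs cs"
  shows "emb {..<length xs} (hall (list_ends xs)) {..<length ys} (hall (list_ends ys))"
proof -
  have c: "length gs = length ys" "distinct gs" "distinct cs" "set gs \<inter> set cs = {}"
    "set gs \<subseteq> {..<length xs}" "set cs \<subseteq> {..<length xs}"
    and m: "\<And>s. s \<in> set (subseqs [0..<length ys]) \<Longrightarrow>
        matches [] (map ((!) ys) s) = matches [] (map ((!) xs) (map ((!) gs) s @ cs))"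
    using assms by (auto simp: certificate_def)
  have main: "hall (list_ends ys) X \<longleftrightarrow> hall (list_ends xs) ((!) gs ` X \<union> set cs)"
    if X: "X \<subseteq> {..<length ys}" for X
  proof -
    have "X \<in> set ` set (subseqs [0..<length ys])" using X by (auto simp: subseqs_powset)
    then obtain s where s: "s \<in> set (subseqs [0..<length ys])" "X = set s" by blast
    have ds: "distinct s" using s(1) subseqs_distinctD by fastforce
    have inj: "inj_on ((!) gs) (set s)"
      using X s(2) c(1,2) by (auto simp: inj_on_def nth_eq_iff_index_eq subset_iff)
    have sub: "(!) gs ` set s \<subseteq> set gs" using X s(2) c(1) by (auto simp: subset_iff)
    have "distinct (map ((!) gs) s @ cs)" using ds inj c(3,4) sub by (auto simp: distinct_map)
    moreover have "set (map ((!) gs) s @ cs) \<subseteq> {..<length xs}" using sub c by auto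
    ultimately have "hall (list_ends xs) (set (map ((!) gs) s @ cs)) \<longleftrightarrow>
        matches [] (map ((!) xs) (map ((!) gs) s @ cs))" by (rule hall_list_ends)
    moreover have "hall (list_ends ys) (set s) \<longleftrightarrow> matches [] (map ((!) ys) s)"
      using ds X s(2) by (intro hall_list_ends) auto
    ultimately show ?thesis using m[OF s(1)] s(2) by simp
  qed
  have "hall (list_ends ys) {}" by (simp add: hall_def)
  then have "hall (list_ends xs) (set cs)" using main[of "{}"] by simp
  moreover have "inj_on ((!) gs) {..<length ys}" using c by (auto simp: inj_on_def nth_eq_iff_index_eq)
  moreover have "(!) gs ` {..<length ys} \<subseteq> {..<length xs} - set cs"
    using c(1,4,5) by (auto simp: subset_iff) (metis disjoint_iff nth_mem)
  ultimately show ?thesis unfolding emb_def using main c(6)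
    by (intro exI[of _ "set cs"] exI[of _ "(!) gs"]) blast
qed

section \<open>Recognising the excluded minors\<close>

definition ex_P2 :: "(nat \<times> nat) list" where "ex_P2 = [(0,1), (0,1), (0,2), (0,2), (0,3), (0,3)]"
definition ex_W :: "(nat \<times> nat) list" where "ex_W = [(0,1), (1,2), (0,2), (0,0), (1,1), (2,2)]"
definition ex_A3 :: "(nat \<times> nat) list" where "ex_A3 = [(0,1), (0,2), (0,2), (1,2), (1,2), (2,2)]"
definition ex_R3 :: "(nat \<times> nat) list" where "ex_R3 = [(0,1), (0,2), (1,2), (0,0), (0,0), (1,1), (1,1)]"
definition ex_R4 :: "(nat \<times> nat) list" where "ex_R4 = [(0,1), (0,3), (1,3), (0,2), (0,2), (3,3), (3,3)]"
definition ex_D4 :: "(nat \<times> nat) list" where "ex_D4 = [(0,2), (0,2), (0,2), (1,2), (1,2), (1,2), (0,3), (3,1)]"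
definition ex_3K3 :: "(nat \<times> nat) list" where "ex_3K3 = [(0,1), (0,1), (0,1), (0,2), (0,2), (0,2), (1,2), (1,2), (1,2)]"
definition ex_S1 :: "(nat \<times> nat) list" where "ex_S1 = [(0,1), (2,3), (0,4), (4,3), (0,2), (0,2), (1,3), (1,3)]"

definition excluded :: "(nat \<times> nat) list set" where
  "excluded = {ex_P2, ex_W, ex_A3, ex_R3, ex_R4, ex_D4, ex_3K3, ex_S1}"

lemma cert_A3: "certificate ex_A3 ex_A3 [0..<6] []"
  by code_simp

text \<open>One of the two parallel edges between 0 and 2 has become a loop at 0, with the same
  matroid. Trading at vertex 1 as well would give \<open>ex_W\<close>, so \<open>bad_A3\<close> can
  treat every mixture.\<close>

lemma cert_A3': "certificate [(0,1), (0,2), (0,0), (1,2), (1,2), (2,2)] ex_A3 [0..<6] []"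
  by code_simp

lemma cert_W: "certificate ex_W ex_W [0..<6] []"
  by code_simp

text \<open>Trading a parallel edge for a loop at a leaf, one leaf after another, never changes the
  matroid.\<close>

lemma cert_P2:
  "certificate [(0,1), (0,1), (0,2), (0,2), (0,3), (0,3)] ex_P2 [0..<6] []"
  "certificate [(0,1), (1,1), (0,2), (0,2), (0,3), (0,3)] ex_P2 [0..<6] []"
  "certificate [(0,1), (1,1), (0,2), (2,2), (0,3), (0,3)] ex_P2 [0..<6] []"
  "certificate [(0,1), (1,1), (0,2), (2,2), (0,3), (3,3)] ex_P2 [0..<6] []"
  by code_simp+

text \<open>The last edge, a loop at 0, is contracted: the edges from 0 to 2, 3 and 4 turn into
  loops, and a star at 1 with a loop at every leaf remains.\<close>

lemma cert_P2_K23: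
  "certificate [(0,2), (0,3), (0,4), (1,2), (1,3), (1,4), (0,0)] ex_P2 [0,3,1,4,2,5] [6]"
  by code_simp

text \<open>The loop at 1 is contracted, which turns the edges from 1 to 2 and 3 into loops; vertex
  0 becomes the centre of a star with leaves 2, 3 and 4.\<close>

lemma cert_P2_C4:
  "certificate [(0,2), (0,3), (1,2), (1,3), (1,1), (0,4), (0,4)] ex_P2 [0,2,1,3,5,6] [4]"
  "certificate [(0,2), (0,3), (1,2), (1,3), (1,1), (0,4), (4,4)] ex_P2 [0,2,1,3,5,6] [4]"
  by code_simp+

lemma cert_R3: "certificate ex_R3 ex_R3 [0..<7] []"
  by code_simp

text \<open>All seven edges are kept in each case, so these are four graphs with isomorphic
  bicircular matroids; the third is a four-cycle with loops, the fourth the complete graph on four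
  vertices minus an edge, with loops.\<close>

lemma cert_R4:
  "certificate ex_R4 ex_R4 [0..<7] []"
  "certificate [(0,1), (0,3), (1,3), (0,2), (2,2), (3,3), (3,3)] ex_R4 [0..<7] []"
  "certificate [(0,1), (1,2), (2,3), (0,3), (3,3), (3,3), (1,1)] ex_R4 [0,6,3,1,2,4,5] []"
  "certificate [(0,1), (0,2), (0,3), (1,3), (2,3), (3,3), (3,3)] ex_R4 [0,2,3,1,4,5,6] []"
  by code_simp+

lemma cert_D4:
  "certificate [(0,2), (0,2), (0,2), (1,2), (1,2), (1,2), (0,3), (1,3)] ex_D4 [0..<8] []"
  "certificate [(0,0), (0,2), (0,2), (1,2), (1,2), (1,2), (0,3), (1,3)] ex_D4 [0..<8] []"
  by code_simp+

lemma cert_S1: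
  "certificate [(0,1), (2,3), (0,4), (3,4), (0,2), (0,2), (1,3), (1,3)] ex_S1 [0..<8] []"
  by code_simp

context mgraph
begin

definition bad :: bool where
  "bad \<longleftrightarrow> (\<exists>ys\<in>excluded. emb E (hall N) {..<length ys} (hall (list_ends ys)))"

text \<open>The two ways in which minimum degree two can be met at \<open>A\<close>; after
  contraction they are a loop at \<open>A\<close> and a second edge to \<open>Z\<close>. Most of the
  configurations below accept either.\<close>

definition heavy :: "'v set \<Rightarrow> 'v set \<Rightarrow> bool" where
  "heavy A Z \<longleftrightarrow> cyc A 1 \<or> 2 \<le> ec A Z"

lemma badI:
  assumes "\<forall>S\<in>set Ss. conn S" and "sorted_wrt (\<lambda>S S'. S \<inter> S' = {}) Ss"
    and "certificate xs ys gs cs" and "ys \<in> excluded"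
    and "\<forall>(i, j)\<in>set xs. j < length Ss \<and>
      ((i < j \<and> count_list xs (i, j) \<le> ec (Ss ! i) (Ss ! j)) \<or> (i = j \<and> cyc (Ss ! i) (count_list xs (i, i))))"
  shows bad
  unfolding bad_def using emb_trans[OF parts_minor[OF assms(1,2,5)] certificate_emb[OF assms(3)]] assms(4)
  by blast

lemmas few = numeral_2_eq_2 numeral_3_eq_3

text \<open>\<open>R\<close> is the apex that carries the loop. The cases record how
  \<open>P\<close> and \<open>Q\<close> obtain their extra edges; two further loops give
  \<open>ex_W\<close> instead of \<open>ex_A3\<close>.\<close>

lemma bad_A3:
  assumes c: "conn P" "conn Q" "conn R" and d: "P \<inter> Q = {}" "P \<inter> R = {}" "Q \<inter> R = {}"
    and a: "adj P Q" "adj P R" "adj Q R" and r: "cyc R 1" "heavy P R" "heavy Q R"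
  shows bad
proof -
  note a' = a[unfolded adj_ec]
  have mixed: bad if "conn P" "conn Q" "P \<inter> Q = {}" "P \<inter> R = {}" "Q \<inter> R = {}"
    "1 \<le> ec P Q" "1 \<le> ec P R" "1 \<le> ec Q R" "cyc P 1" "2 \<le> ec Q R" for P Q
    by (rule badI[OF _ _ cert_A3', of "[P, Q, R]"]) (use that c r in \<open>simp_all add: few excluded_def\<close>)
  consider "2 \<le> ec P R" "2 \<le> ec Q R" | "cyc P 1" "2 \<le> ec Q R" | "cyc Q 1" "2 \<le> ec P R" | "cyc P 1" "cyc Q 1"
    using r by (auto simp: heavy_def)
  then show ?thesis
  proof cases
    case 1
    then show ?thesis
      by (intro badI[OF _ _ cert_A3, of "[P, Q, R]"]) (use c d a' r in \<open>simp_all add: few excluded_def ex_A3_def\<close>)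
  next
    case 2
    then show ?thesis using mixed[of P Q] c d a' by simp
  next
    case 3
    then show ?thesis using mixed[of Q P] c d a' by (simp add: ec_sym Int_commute)
  next
    case 4
    then show ?thesis
      by (intro badI[OF _ _ cert_W, of "[P, Q, R]"]) (use c d a' r in \<open>simp_all add: few excluded_def ex_W_def\<close>)
  qed
qed

lemma bad_P2:
  assumes c: "conn Z" "conn A" "conn B" "conn C"
    and d: "Z \<inter> A = {}" "Z \<inter> B = {}" "Z \<inter> C = {}" "A \<inter> B = {}" "A \<inter> C = {}" "B \<inter> C = {}"
    and a: "adj A Z" "adj B Z" "adj C Z" and h: "heavy A Z" "heavy B Z" "heavy C Z"
  shows bad
proof -
  have one: bad if "conn A" "conn B" "conn C" "Z \<inter> A = {}" "Z \<inter> B = {}" "Z \<inter> C = {}" "A \<inter> B = {}" "A \<inter> C = {}" "B \<inter> C = {}"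
    "1 \<le> ec Z A" "cyc A 1" "2 \<le> ec Z B" "2 \<le> ec Z C" for A B C
    by (rule badI[OF _ _ cert_P2(2), of "[Z, A, B, C]"]) (use that c(1) in \<open>simp_all add: few excluded_def\<close>)
  have two: bad if "conn A" "conn B" "conn C" "Z \<inter> A = {}" "Z \<inter> B = {}" "Z \<inter> C = {}" "A \<inter> B = {}" "A \<inter> C = {}" "B \<inter> C = {}"
    "1 \<le> ec Z A" "cyc A 1" "1 \<le> ec Z B" "cyc B 1" "2 \<le> ec Z C" for A B C
    by (rule badI[OF _ _ cert_P2(3), of "[Z, A, B, C]"]) (use that c(1) in \<open>simp_all add: few excluded_def\<close>)
  have a': "1 \<le> ec Z A" "1 \<le> ec Z B" "1 \<le> ec Z C" using a by (simp_all add: adj_ec ec_sym[of Z])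
  have h': "cyc A 1 \<or> 2 \<le> ec Z A" "cyc B 1 \<or> 2 \<le> ec Z B" "cyc C 1 \<or> 2 \<le> ec Z C"
    using h by (simp_all add: heavy_def ec_sym[of Z])
  have dd: "B \<inter> A = {}" "C \<inter> A = {}" "C \<inter> B = {}" using d by blast+
  have 0: bad if "2 \<le> ec Z A" "2 \<le> ec Z B" "2 \<le> ec Z C"
    by (rule badI[OF _ _ cert_P2(1), of "[Z, A, B, C]"]) (use that c d in \<open>simp_all add: few excluded_def\<close>)
  have 3: bad if "cyc A 1" "cyc B 1" "cyc C 1"
    by (rule badI[OF _ _ cert_P2(4), of "[Z, A, B, C]"]) (use that c d a' in \<open>simp_all add: few excluded_def\<close>)
  show ?thesis
    using h' 0 3 one[of A B C] one[of B A C] one[of C A B] two[of A B C] two[of A C B] two[of B C A] c d dd a'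
    by blast
qed

lemma bad_P2_K23:
  assumes c: "conn Z" "conn Z'" "conn A" "conn B" "conn C"
    and d: "Z \<inter> Z' = {}" "Z \<inter> A = {}" "Z \<inter> B = {}" "Z \<inter> C = {}" "Z' \<inter> A = {}" "Z' \<inter> B = {}" "Z' \<inter> C = {}"
      "A \<inter> B = {}" "A \<inter> C = {}" "B \<inter> C = {}"
    and a: "adj Z A" "adj Z B" "adj Z C" "adj Z' A" "adj Z' B" "adj Z' C" and r: "cyc Z 1"
  shows bad
  by (rule badI[OF _ _ cert_P2_K23, of "[Z, Z', A, B, C]"])
    (use c d a[unfolded adj_ec] r in \<open>simp_all add: few excluded_def\<close>)

lemma bad_P2_C4:
  assumes c: "conn Z" "conn D" "conn A" "conn B" "conn C"
    and d: "Z \<inter> D = {}" "Z \<inter> A = {}" "Z \<inter> B = {}" "Z \<inter> C = {}" "D \<inter> A = {}" "D \<inter> B = {}" "D \<inter> C = {}"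
      "A \<inter> B = {}" "A \<inter> C = {}" "B \<inter> C = {}"
    and a: "adj Z A" "adj Z B" "adj D A" "adj D B" "adj Z C" and r: "cyc D 1" "heavy C Z"
  shows bad
proof (cases "cyc C 1")
  case True
  show ?thesis
    by (rule badI[OF _ _ cert_P2_C4(2), of "[Z, D, A, B, C]"])
      (use c d a[unfolded adj_ec] r True in \<open>simp_all add: few excluded_def\<close>)
next
  case False
  then have "2 \<le> ec Z C" using r(2) by (simp add: heavy_def ec_sym[of Z])
  then show ?thesis
    by (intro badI[OF _ _ cert_P2_C4(1), of "[Z, D, A, B, C]"])
      (use c d a[unfolded adj_ec] r in \<open>simp_all add: few excluded_def\<close>)
qed

lemma bad_R3:
  assumes c: "conn A" "conn B" "conn C" and d: "A \<inter> B = {}" "A \<inter> C = {}" "B \<inter> C = {}"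
    and a: "adj A B" "adj A C" "adj B C" and r: "cyc A 2" "cyc B 2"
  shows bad
  by (rule badI[OF _ _ cert_R3, of "[A, B, C]"])
    (use c d a[unfolded adj_ec] r in \<open>simp_all add: few excluded_def ex_R3_def\<close>)

lemma bad_R4:
  assumes c: "conn Z" "conn A" "conn B" "conn C"
    and d: "Z \<inter> A = {}" "Z \<inter> B = {}" "Z \<inter> C = {}" "A \<inter> B = {}" "A \<inter> C = {}" "B \<inter> C = {}"
    and a: "adj Z A" "adj Z C" "adj A C" "adj Z B" and r: "cyc C 2" "heavy B Z"
  shows bad
proof (cases "cyc B 1")
  case True
  show ?thesis
    by (rule badI[OF _ _ cert_R4(2), of "[Z, A, B, C]"])
      (use c d a[unfolded adj_ec] r True in \<open>simp_all add: few excluded_def\<close>)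
next
  case False
  then have "2 \<le> ec Z B" using r(2) by (simp add: heavy_def ec_sym[of Z])
  then show ?thesis
    by (intro badI[OF _ _ cert_R4(1), of "[Z, A, B, C]"])
      (use c d a[unfolded adj_ec] r in \<open>simp_all add: few excluded_def ex_R4_def\<close>)
qed

lemma bad_R4_C4:
  assumes c: "conn A" "conn Z" "conn B" "conn C"
    and d: "A \<inter> Z = {}" "A \<inter> B = {}" "A \<inter> C = {}" "Z \<inter> B = {}" "Z \<inter> C = {}" "B \<inter> C = {}"
    and a: "adj A Z" "adj Z B" "adj B C" "adj A C" and r: "cyc C 2" "cyc Z 1"
  shows bad
  by (rule badI[OF _ _ cert_R4(3), of "[A, Z, B, C]"])
    (use c d a[unfolded adj_ec] r in \<open>simp_all add: few excluded_def\<close>)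

lemma bad_R4_diamond:
  assumes c: "conn Z" "conn A" "conn B" "conn C"
    and d: "Z \<inter> A = {}" "Z \<inter> B = {}" "Z \<inter> C = {}" "A \<inter> B = {}" "A \<inter> C = {}" "B \<inter> C = {}"
    and a: "adj Z A" "adj Z B" "adj Z C" "adj A C" "adj B C" and r: "cyc C 2"
  shows bad
  by (rule badI[OF _ _ cert_R4(4), of "[Z, A, B, C]"])
    (use c d a[unfolded adj_ec] r in \<open>simp_all add: few excluded_def\<close>)

lemma bad_D4:
  assumes c: "conn A" "conn B" "conn Z" "conn S"
    and d: "A \<inter> B = {}" "A \<inter> Z = {}" "A \<inter> S = {}" "B \<inter> Z = {}" "B \<inter> S = {}" "Z \<inter> S = {}"
    and a: "adj A S" "adj B S" and e: "2 \<le> ec A Z" "2 \<le> ec B Z"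
    and r: "cyc A 1 \<or> 3 \<le> ec A Z" "cyc B 1 \<or> 3 \<le> ec B Z"
  shows bad
proof -
  have one: bad if "conn A" "conn B" "A \<inter> B = {}" "A \<inter> Z = {}" "A \<inter> S = {}" "B \<inter> Z = {}" "B \<inter> S = {}"
    "1 \<le> ec A S" "1 \<le> ec B S" "2 \<le> ec A Z" "3 \<le> ec B Z" "cyc A 1" for A B
    by (rule badI[OF _ _ cert_D4(2), of "[A, B, Z, S]"]) (use that c d in \<open>simp_all add: few excluded_def\<close>)
  consider "3 \<le> ec A Z" "3 \<le> ec B Z" | "cyc A 1" "3 \<le> ec B Z" | "cyc B 1" "3 \<le> ec A Z" | "cyc A 1" "cyc B 1"
    using r by blast
  then show ?thesis
  proof cases
    case 1
    then show ?thesis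
      by (intro badI[OF _ _ cert_D4(1), of "[A, B, Z, S]"])
        (use c d a[unfolded adj_ec] in \<open>simp_all add: few excluded_def\<close>)
  next
    case 2
    then show ?thesis using one[of A B] c d a[unfolded adj_ec] e by simp
  next
    case 3
    then show ?thesis using one[of B A] c d a[unfolded adj_ec] e by (simp add: Int_commute)
  next
    \<comment> \<open>With surplus edges on both sides no third parallel edge need exist; merging
      \<open>S\<close> into \<open>A\<close> gives a triangle \<open>Z\<close>, \<open>B\<close>,
      \<open>A \<union> S\<close> whose apex is the last set.\<close>
    case 4
    have U: "conn (A \<union> S)" using c a by (intro conn_Un) auto
    have "adj Z A" "adj B Z" using e by (simp_all add: adj_ec ec_sym[of Z])
    then have "adj Z (A \<union> S)" "adj B Z" by (simp_all add: adj_Un)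
    moreover have "heavy Z (A \<union> S)" using e(1) ec_mono[of A "A \<union> S" Z Z] by (simp add: heavy_def ec_sym[of Z])
    moreover have "cyc (A \<union> S) 1" using cyc_mono[OF U, of A 1] 4 c by (simp add: conn_nonempty)
    moreover have "adj B (A \<union> S)" using a by (simp add: adj_Un)
    ultimately show ?thesis using bad_A3[of Z B "A \<union> S"] U c d 4
      by (simp add: heavy_def adj_sym[of Z B] Int_Un_distrib Int_commute)
  qed
qed

lemma bad_S1:
  assumes c: "conn Z" "conn Z'" "conn A" "conn B" "conn C"
    and d: "Z \<inter> Z' = {}" "Z \<inter> A = {}" "Z \<inter> B = {}" "Z \<inter> C = {}" "Z' \<inter> A = {}" "Z' \<inter> B = {}" "Z' \<inter> C = {}"
      "A \<inter> B = {}" "A \<inter> C = {}" "B \<inter> C = {}"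
    and a: "adj Z B" "adj Z C" "adj Z' A" "adj Z' C" and e: "2 \<le> ec Z A" "2 \<le> ec Z' B"
  shows bad
proof -
  have e': "2 \<le> ec B Z'" "1 \<le> ec A Z'" using e(2) a(3) by (simp_all add: ec_sym[of _ Z'] adj_ec)
  show ?thesis
    by (rule badI[OF _ _ cert_S1, of "[Z, B, A, Z', C]"])
      (use c d a[unfolded adj_ec] e e' in \<open>simp_all add: few excluded_def Int_commute\<close>)
qed

lemma bad_3K3:
  assumes c: "conn A" "conn B" "conn C" and d: "A \<inter> B = {}" "A \<inter> C = {}" "B \<inter> C = {}"
    and e: "3 \<le> ec A B" "3 \<le> ec A C" "3 \<le> ec B C"
  shows bad
proof -
  have "emb E (hall N) {..<length ex_3K3} (hall (list_ends ex_3K3))"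
    by (rule parts_minor[of "[A, B, C]"]) (use c d e in \<open>simp_all add: few ex_3K3_def\<close>)
  then show ?thesis by (auto simp: bad_def excluded_def)
qed

end

section \<open>Pieces of vertex-deleted subgraphs\<close>

context mgraph
begin

lemma adj_reduce: "adj A S \<Longrightarrow> S \<subseteq> B \<union> C \<Longrightarrow> \<not> adj A C \<Longrightarrow> adj A B"
  unfolding adj_def by blast

lemma ec_reduce: "S \<subseteq> B \<union> C \<Longrightarrow> \<not> adj A C \<Longrightarrow> ec A S \<le> ec A B"
  unfolding ec_def adj_def using finE by (intro card_mono) auto

lemma heavy_reduce: "heavy A S \<Longrightarrow> S \<subseteq> B \<union> C \<Longrightarrow> \<not> adj A C \<Longrightarrow> heavy A B"
  unfolding heavy_def using ec_reduce[of S B C A] by linarith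

lemma heavy_mono:
  assumes "heavy A Z" "A \<subseteq> A'" "Z \<subseteq> Z'" "conn A'" "A \<noteq> {}"
  shows "heavy A' Z'"
  using assms cyc_mono[of A' A 1] ec_mono[of A A' Z Z'] unfolding heavy_def by auto

lemma ec_two:
  assumes "adj A B" "adj A C" "B \<inter> C = {}" "A \<inter> B = {}" "A \<inter> C = {}" "B \<subseteq> W" "C \<subseteq> W"
  shows "2 \<le> ec A W"
proof -
  have "ec (B \<union> C) A = ec B A + ec C A" using assms by (intro ec_Un) auto
  then have "2 \<le> ec A (B \<union> C)" using assms(1,2) by (simp add: adj_ec ec_sym[of A])
  then show ?thesis using ec_mono[of A A "B \<union> C" W] assms by simp
qed

lemma cyc_heavy:
  assumes "heavy A Z" "conn A" "conn Z" "adj A Z" "A \<inter> Z = {}"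
  shows "cyc (A \<union> Z) 1"
proof -
  have c: "conn (A \<union> Z)" using assms by (intro conn_Un) auto
  show ?thesis
  proof (cases "cyc A 1")
    case True
    then show ?thesis using cyc_mono[OF c, of A] conn_nonempty[OF assms(2)] by blast
  next
    case False
    then have "2 \<le> ec A Z" using assms(1) by (simp add: heavy_def)
    then show ?thesis
      using cyc_Un[OF assms(2,3,5) conn_cyc0 conn_cyc0, of 1] assms(2,3) by simp
  qed
qed

definition V :: "'v set" where "V = \<Union>(N ` E)"

text \<open>Incident edges are counted, not edge ends: a loop counts once, because it occurs once in
  the star of its vertex. A vertex whose only edge is a loop therefore has degree one.\<close>

definition deg2 :: "'v set \<Rightarrow> bool" where
  "deg2 S \<longleftrightarrow> (\<forall>x\<in>S. 2 \<le> card {e \<in> E. x \<in> N e \<and> N e \<subseteq> S})"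

definition comp :: "'v set \<Rightarrow> 'v set \<Rightarrow> bool" where
  "comp J D \<longleftrightarrow> D \<subseteq> J \<and> conn D \<and> \<not> adj D (J - D)"

text \<open>Equivalently, \<open>X\<close> is the 2-core of a component of the graph minus \<open>v\<close>, provided that it has two
  independent cycles.\<close>

definition piece :: "'v set \<Rightarrow> 'v \<Rightarrow> bool" where
  "piece X v \<longleftrightarrow> X \<subseteq> V \<and> v \<in> V \<and> v \<notin> X \<and> conn X \<and> deg2 X \<and> cyc X 2 \<and>
     (\<forall>S. X \<subseteq> S \<longrightarrow> S \<subseteq> V - {v} \<longrightarrow> conn S \<longrightarrow> deg2 S \<longrightarrow> S = X)"

lemma finV: "finite V"
  unfolding V_def using finE N_finite by blast

lemma N_V: "e \<in> E \<Longrightarrow> N e \<subseteq> V"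
  unfolding V_def by blast

text \<open>Count the incidences at \<open>A\<close>: there are at least \<open>2 * card A\<close>,
  an edge inside \<open>A\<close> accounts for at most two and an edge leaving \<open>A\<close> for
  one. If \<open>A\<close> has fewer edges inside than vertices, at least two edges must
  leave.\<close>

lemma heavy_deg2:
  assumes d: "deg2 S" and A: "A \<subseteq> S" "finite S"
  shows "heavy A (S - A)"
proof (cases "cyc A 1")
  case False
  define F where "F = {e \<in> E. N e \<subseteq> S}"
  have finA: "finite A" "finite F" using A finE finite_subset by (auto simp: F_def)
  have "2 * card A = (\<Sum>x\<in>A. 2)" by simp
  also have "\<dots> \<le> (\<Sum>x\<in>A. card {e \<in> F. x \<in> N e})"
  proof (rule sum_mono)
    fix x assume "x \<in> A"
    then have "2 \<le> card {e \<in> E. x \<in> N e \<and> N e \<subseteq> S}" using d A(1) by (auto simp: deg2_def)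
    moreover have "{e \<in> E. x \<in> N e \<and> N e \<subseteq> S} = {e \<in> F. x \<in> N e}" by (auto simp: F_def)
    ultimately show "2 \<le> card {e \<in> F. x \<in> N e}" by simp
  qed
  also have "\<dots> = (\<Sum>x\<in>A. \<Sum>e\<in>F. if x \<in> N e then 1 else 0)"
    using finA by (simp add: sum.If_cases Int_def)
  also have "\<dots> = (\<Sum>e\<in>F. \<Sum>x\<in>A. if x \<in> N e then 1 else 0)" by (rule sum.swap)
  also have "\<dots> = (\<Sum>e\<in>F. card (N e \<inter> A))"
    using finA by (simp add: sum.If_cases Int_def conj_commute)
  also have "\<dots> \<le> (\<Sum>e\<in>F. (if N e \<subseteq> A then 2 else 0) + (if N e \<inter> A \<noteq> {} \<and> N e \<inter> (S - A) \<noteq> {} then 1 else 0))"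
  proof (rule sum_mono)
    fix e assume e: "e \<in> F"
    then have eE: "e \<in> E" "N e \<subseteq> S" by (auto simp: F_def)
    show "card (N e \<inter> A) \<le> (if N e \<subseteq> A then 2 else 0) + (if N e \<inter> A \<noteq> {} \<and> N e \<inter> (S - A) \<noteq> {} then 1 else 0)"
    proof (cases "N e \<subseteq> A \<or> N e \<inter> A = {}")
      case True
      have "card (N e \<inter> A) \<le> card (N e)" using N_finite[OF eE(1)] by (intro card_mono) auto
      then show ?thesis using True N_card[OF eE(1)] N_nonempty[OF eE(1)] by auto
    next
      case False
      then have "N e \<inter> A \<subset> N e" by blast
      then have "card (N e \<inter> A) < card (N e)" using N_finite[OF eE(1)] psubset_card_mono by blast
      then show ?thesis using False eE N_card[OF eE(1)] by auto
    qed
  qed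
  also have "\<dots> = 2 * card {e \<in> F. N e \<subseteq> A} + card {e \<in> F. N e \<inter> A \<noteq> {} \<and> N e \<inter> (S - A) \<noteq> {}}"
    using finA(2) by (simp add: sum.distrib sum.If_cases Int_def)
  also have "\<dots> \<le> 2 * es A + ec A (S - A)"
    unfolding es_def ec_def F_def using finE by (intro add_mono mult_le_mono card_mono) auto
  finally have "2 * card A \<le> 2 * es A + ec A (S - A)" .
  then show ?thesis using False by (simp add: heavy_def cyc_def)
qed (simp add: heavy_def)

lemma deg2_mono:
  assumes "x \<in> S" "deg2 S" "\<And>e. e \<in> E \<Longrightarrow> x \<in> N e \<Longrightarrow> N e \<subseteq> S \<Longrightarrow> N e \<subseteq> T"
  shows "2 \<le> card {e \<in> E. x \<in> N e \<and> N e \<subseteq> T}"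
proof -
  have "card {e \<in> E. x \<in> N e \<and> N e \<subseteq> S} \<le> card {e \<in> E. x \<in> N e \<and> N e \<subseteq> T}"
    using finE assms(3) by (intro card_mono) auto
  then show ?thesis using assms(1,2) unfolding deg2_def by fastforce
qed

lemma deg2_Un: "deg2 A \<Longrightarrow> deg2 B \<Longrightarrow> deg2 (A \<union> B)"
  using deg2_mono[of _ A "A \<union> B"] deg2_mono[of _ B "A \<union> B"] unfolding deg2_def[of "A \<union> B"] by blast

lemma comp_exists:
  assumes "finite J" "x \<in> J"
  shows "\<exists>D. comp J D \<and> x \<in> D"
  using conn_maximal[OF assms(1) conn_singleton[of x]] assms(2) unfolding comp_def by blast

lemma comp_absorb:
  assumes "conn C" "\<not> adj C (S - C)" "conn D" "D \<subseteq> S" "C \<inter> D \<noteq> {} \<or> adj C D"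
  shows "D \<subseteq> C"
proof (rule ccontr)
  assume n: "\<not> D \<subseteq> C"
  have "conn (C \<union> D)" using assms conn_Un by blast
  then have "adj C ((C \<union> D) - C)" using n conn_nonempty[OF assms(1)] by (intro connD) auto
  then show False using assms(2,4) adj_mono[of C "(C \<union> D) - C" C "S - C"] by blast
qed

lemma comp_disjoint: "comp J D \<Longrightarrow> comp J D' \<Longrightarrow> D \<noteq> D' \<Longrightarrow> D \<inter> D' = {}"
  using comp_absorb[of D J D'] comp_absorb[of D' J D] unfolding comp_def by blast

lemma piece_extends:
  assumes "X \<subseteq> V" "v \<in> V" "v \<notin> X" "conn X" "deg2 X" "cyc X 2"
  shows "\<exists>X'. piece X' v \<and> X \<subseteq> X'"
proof -
  let ?F = "{S. X \<subseteq> S \<and> S \<subseteq> V - {v} \<and> conn S \<and> deg2 S}"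
  have "finite ?F" by (rule finite_subset[of _ "Pow V"]) (use finV in auto)
  moreover have "X \<in> ?F" using assms by blast
  ultimately obtain S where S: "S \<in> ?F" "\<And>T. T \<in> ?F \<Longrightarrow> S \<subseteq> T \<Longrightarrow> T = S"
    by (rule finite_maximal_set) blast
  have S': "X \<subseteq> S" "S \<subseteq> V - {v}" "conn S" "deg2 S" using S(1) by auto
  have "cyc S 2" using cyc_mono[OF S'(3,1) conn_nonempty[OF assms(4)] assms(6)] .
  moreover have "T = S" if "S \<subseteq> T" "T \<subseteq> V - {v}" "conn T" "deg2 T" for T
    using S(2)[of T] S'(1) that by simp
  ultimately show ?thesis using S' assms(2) unfolding piece_def by (intro exI[of _ S]) auto
qed

lemma pieceD:
  assumes "piece X v"
  shows "X \<subseteq> V" "v \<in> V" "v \<notin> X" "conn X" "deg2 X" "cyc X 2"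
    "\<And>S. X \<subseteq> S \<Longrightarrow> S \<subseteq> V - {v} \<Longrightarrow> conn S \<Longrightarrow> deg2 S \<Longrightarrow> S = X"
  using assms unfolding piece_def by simp_all

text \<open>The union of two intersecting pieces is connected with minimum degree two. It avoids
  \<open>v'\<close>, so maximality of \<open>X'\<close> absorbs \<open>X\<close>.\<close>

lemma piece_subset:
  assumes X: "piece X v" and X': "piece X' v'" and "X \<inter> X' \<noteq> {}" "v' \<notin> X"
  shows "X \<subseteq> X'"
proof -
  have "X' \<union> X = X'"
  proof (rule pieceD(7)[OF X'])
    show "conn (X' \<union> X)" using conn_Un[OF pieceD(4)[OF X'] pieceD(4)[OF X]] assms(3) by blast
    show "deg2 (X' \<union> X)" using deg2_Un pieceD(5) X X' by blast
  qed (use assms(4) pieceD(1,3)[OF X'] pieceD(1)[OF X] in auto)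
  then show ?thesis by blast
qed

text \<open>A component of \<open>S - X\<close> that misses \<open>v\<close> could be added to the piece \<open>X\<close>.\<close>

lemma piece_rest:
  assumes X: "piece X v" and S: "conn S" "deg2 S" "S \<subseteq> V" "v \<in> S" "S \<inter> X \<noteq> {}"
  shows "conn (S - X)"
proof -
  have "finite (S - X)" using conn_finite[OF S(1)] by simp
  then obtain C where C: "comp (S - X) C" "v \<in> C" using comp_exists[of "S - X" v] S(4) pieceD(3)[OF X] by blast
  \<comment> \<open>All components of \<open>S - X\<close> except the one of \<open>v\<close>,
    absorbed at once. Their vertices keep all their edges of \<open>S\<close>, since no edge joins
    them to \<open>C\<close>.\<close>
  define T where "T = S - X - C"
  have nadj: "\<not> adj T C" using C by (simp add: comp_def T_def adj_sym)
  have CS: "C \<subseteq> S - X" "conn C" using C by (auto simp: comp_def)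
  have SX: "conn (S \<union> X)" using conn_Un[OF S(1) pieceD(4)[OF X]] S(5) by blast
  have "X \<union> T = X"
  proof (rule pieceD(7)[OF X])
    have "\<not> adj T (S \<union> X - (X \<union> T))"
      using nadj adj_mono[of T "S \<union> X - (X \<union> T)" T C] by (auto simp: T_def)
    then show "conn (X \<union> T)" by (intro conn_rest[OF pieceD(4)[OF X] SX]) (auto simp: T_def)
    have "2 \<le> card {e \<in> E. x \<in> N e \<and> N e \<subseteq> X \<union> T}" if x: "x \<in> X \<union> T" for x
    proof (cases "x \<in> X")
      case True
      then show ?thesis using deg2_mono[of x X "X \<union> T"] pieceD(5)[OF X] by blast
    next
      case False
      then have xT: "x \<in> T" using x by blast
      have "N e \<subseteq> X \<union> T" if e: "e \<in> E" "x \<in> N e" "N e \<subseteq> S" for e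
      proof -
        have "N e \<inter> C = {}" using nadj e xT unfolding adj_def by blast
        then show ?thesis using e(3) by (auto simp: T_def)
      qed
      then show ?thesis using deg2_mono[of x S "X \<union> T"] S(2) xT by (auto simp: T_def)
    qed
    then show "deg2 (X \<union> T)" by (simp add: deg2_def)
    show "X \<union> T \<subseteq> V - {v}" using C(2) pieceD(1,3)[OF X] S(3) by (auto simp: T_def)
  qed simp
  then have "C = S - X" using CS(1) by (auto simp: T_def)
  then show ?thesis using CS(2) by simp
qed

text \<open>No edge joins \<open>R\<close> to \<open>Z\<close>, so \<open>R\<close> can be attached
  to \<open>B\<close>. This leaves the triangle \<open>A\<close>, \<open>B \<union> R\<close>,
  \<open>Z\<close> with apex \<open>Z\<close>; minimum degree two in \<open>X\<close> makes
  \<open>B \<union> R\<close> heavy towards \<open>Z\<close>, because \<open>Z\<close> is all of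
  \<open>X\<close> outside \<open>B0 \<union> R\<close>.\<close>

lemma crossing_half:
  assumes cA: "conn A" and cB: "conn B" "conn B0" and cZ: "conn Z" "cyc Z 1"
    and X: "conn X" "deg2 X" "X = B0 \<union> R \<union> Z" and sub: "B0 \<subseteq> B"
    and d: "A \<inter> B = {}" "A \<inter> X = {}" "B \<inter> (R \<union> Z) = {}" "R \<inter> Z = {}"
    and a: "adj A B" "adj A Z" "adj B Z" "\<not> adj R Z" and h: "heavy A Z"
  shows bad
proof -
  have XR: "X - (B0 \<union> R) = Z" using X(3) d sub by blast
  have c0: "conn (B0 \<union> R)" using XR a(4) X(3) by (intro conn_rest[OF cB(2) X(1)]) auto
  have c1: "conn (B \<union> R)"
  proof -
    have "conn (B \<union> (B0 \<union> R))" using conn_Un[OF cB(1) c0] sub conn_nonempty[OF cB(2)] by blast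
    moreover have "B \<union> (B0 \<union> R) = B \<union> R" using sub by blast
    ultimately show ?thesis by simp
  qed
  have "heavy (B0 \<union> R) Z"
    using heavy_deg2[OF X(2), of "B0 \<union> R"] XR X(3) conn_finite[OF X(1)] by auto
  then have h2: "heavy (B \<union> R) Z"
    using heavy_mono[of "B0 \<union> R" Z "B \<union> R" Z] c1 sub conn_nonempty[OF cB(2)] by blast
  show ?thesis
    by (rule bad_A3[OF cA c1 cZ(1) _ _ _ _ a(2) _ cZ(2) h h2])
      (use d X(3) a adj_mono in \<open>auto simp: adj_Un adj_Un2\<close>)
qed

text \<open>Every branch ends in a triangle for \<open>bad_A3\<close>. If the component
  \<open>Z\<close> of the overlap that contains \<open>f\<close> has a cycle, the apex is
  \<open>Z\<close>, or \<open>A \<union> R\<close> when neither outer side is heavy towards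
  \<open>Z\<close>. If \<open>Z\<close> is a tree, it is cut into two subtrees, one of which joins
  the apex.\<close>

lemma crossing_bad:
  assumes X1: "conn X1" "deg2 X1" "cyc X1 2" and X2: "conn X2" "deg2 X2" "cyc X2 2"
    and A0: "conn (X1 - X2)" "X1 - X2 \<subseteq> A" "conn A" "A \<inter> X2 = {}"
    and B0: "conn (X2 - X1)" "X2 - X1 \<subseteq> B" "conn B" "B \<inter> X1 = {}"
    and AB: "A \<inter> B = {}" "adj A B" and f: "f \<in> E" "N f \<subseteq> X1 \<inter> X2"
  shows bad
proof -
  define I where "I = X1 \<inter> X2"
  define A0 where "A0 = X1 - X2"
  define B0 where "B0 = X2 - X1"
  note cA0 = A0(1)[folded A0_def] and cB0 = B0(1)[folded B0_def]
  note sA0 = A0(2)[folded A0_def] and sB0 = B0(2)[folded B0_def]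
  have nA0: "A0 \<noteq> {}" and nB0: "B0 \<noteq> {}" using conn_nonempty cA0 cB0 by auto
  have finI: "finite I" using conn_finite X1(1) by (auto simp: I_def)
  obtain Z where Z: "N f \<subseteq> Z" "Z \<subseteq> I" "conn Z" "\<not> adj Z (I - Z)"
    using conn_maximal[OF finI conn_N[OF f(1)]] f(2) by (auto simp: I_def)
  define R where "R = I - Z"
  have ZR: "\<not> adj Z R" "\<not> adj R Z" using Z(4) by (simp_all add: R_def adj_sym)
  have x1: "X1 = A0 \<union> R \<union> Z" "X2 = B0 \<union> R \<union> Z" using Z(2) by (auto simp: A0_def B0_def R_def I_def)
  have RZ: "R \<inter> Z = {}" by (auto simp: R_def)
  have dis: "A \<inter> (R \<union> Z) = {}" "B \<inter> (R \<union> Z) = {}" "A0 \<inter> (R \<union> Z) = {}" "B0 \<inter> (R \<union> Z) = {}"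
    using A0(4) B0(4) sA0 sB0 x1 by auto
  have nZ: "Z \<noteq> {}" using conn_nonempty[OF Z(3)] .
  have "adj Z (X1 - Z)" using connD[OF X1(1), of Z] nZ x1 nA0 dis by blast
  then have ZA0: "adj Z A0" using adj_reduce[of Z "X1 - Z" A0 R] x1 ZR(1) by blast
  have "adj Z (X2 - Z)" using connD[OF X2(1), of Z] nZ x1 nB0 dis by blast
  then have ZB0: "adj Z B0" using adj_reduce[of Z "X2 - Z" B0 R] x1 ZR(1) by blast
  have ZA: "adj Z A" "adj A Z" using ZA0 sA0 adj_mono[of Z A0 Z A] by (simp_all add: adj_sym)
  have ZB: "adj Z B" "adj B Z" using ZB0 sB0 adj_mono[of Z B0 Z B] by (simp_all add: adj_sym)
  have cAR: "conn (A0 \<union> R)"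
    using ZR(2) x1 dis RZ by (intro conn_rest[OF cA0 X1(1)]) (auto simp: adj_def)
  have cAR': "conn (A \<union> R)"
  proof -
    have "conn (A \<union> (A0 \<union> R))" using conn_Un[OF A0(3) cAR] sA0 nA0 by blast
    moreover have "A \<union> (A0 \<union> R) = A \<union> R" using sA0 by blast
    ultimately show ?thesis by simp
  qed
  show ?thesis
  proof (cases "cyc Z 1")
    case cz: True
    consider "heavy A Z" | "heavy B Z" | "\<not> heavy A Z" "\<not> heavy B Z" by blast
    then show ?thesis
    proof cases
      case 1
      show ?thesis
        by (rule crossing_half[OF A0(3) B0(3) cB0 Z(3) cz X2(1,2) x1(2) sB0])
          (use 1 AB ZA ZB ZR dis RZ A0(4) in auto)
    next
      case 2
      show ?thesis
        by (rule crossing_half[OF B0(3) A0(3) cA0 Z(3) cz X1(1,2) x1(1) sA0])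
          (use 2 AB ZA ZB ZR dis RZ B0(4) adj_sym[of A B] in auto)
    next
      \<comment> \<open>Fewer than two edges run from \<open>Z\<close> to \<open>A0\<close>, so
        \<open>A0 \<union> R\<close> must have a surplus edge of its own. If \<open>R\<close> were
        empty, this would make \<open>A\<close> heavy; so \<open>R\<close> is nonempty and gives
        \<open>B\<close> a second edge to the apex \<open>A \<union> R\<close>.\<close>
      case 3
      have "heavy (A0 \<union> R) (X1 - (A0 \<union> R))" using heavy_deg2[OF X1(2)] x1 conn_finite[OF X1(1)] by auto
      moreover have "X1 - (A0 \<union> R) = Z" using x1 dis RZ by blast
      moreover have "ec Z (A0 \<union> R) \<le> ec Z A0" using ec_reduce[of "A0 \<union> R" A0 R Z] ZR(1) by simp
      moreover have "ec Z A0 \<le> ec Z A" using ec_mono[of Z Z A0 A] sA0 by simp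
      ultimately have cy: "cyc (A0 \<union> R) 1" using 3(1) by (auto simp: heavy_def ec_sym[of _ Z])
      have "R \<noteq> {}"
      proof
        assume "R = {}"
        then have "cyc A 1" using cy cyc_mono[OF A0(3) sA0 nA0] by simp
        then show False using 3(1) by (simp add: heavy_def)
      qed
      then have "adj R (X2 - R)" using connD[OF X2(1), of R] x1 nZ RZ by blast
      then have "adj R B0" using adj_reduce[of R "X2 - R" B0 Z] x1 ZR(2) by blast
      then have BR: "adj B R" using sB0 adj_mono[of R B0 R B] adj_sym by blast
      have cw: "cyc (A \<union> R) 1" using cyc_mono[OF cAR' _ _ cy] sA0 nA0 by blast
      have "2 \<le> ec B (A \<union> R)"
        using ec_two[of B A R "A \<union> R"] AB BR adj_sym[of A B] dis by (auto simp: Int_commute)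
      then show ?thesis
        by (intro bad_A3[OF B0(3) Z(3) cAR'])
          (use cw cz dis RZ AB ZA ZB adj_sym[of A B] in \<open>auto simp: heavy_def adj_Un\<close>)
    qed
  next
    case ncz: False
    have cz0: "cyc Z 0" using conn_cyc0[OF Z(3)] .
    have esZ: "es Z + 1 = card Z" using ncz cz0 by (auto simp: cyc_def)
    have "es Z \<noteq> 0"
    proof
      assume "es Z = 0"
      then have "{e \<in> E. N e \<subseteq> Z} = {}" using finE by (simp add: es_def)
      then show False using f(1) Z(1) by blast
    qed
    then have "2 \<le> card Z" using esZ by simp
    then obtain s y where sy: "s \<in> Z" "y \<in> Z" "s \<noteq> y"
      by (metis card_2_iff' card_le_Suc0_iff_eq conn_finite[OF Z(3)] not_less_eq_eq numeral_2_eq_2)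
    have "finite (Z - {s})" using conn_finite[OF Z(3)] by simp
    then obtain Zy where Zy: "comp (Z - {s}) Zy" "y \<in> Zy" using comp_exists[of "Z - {s}" y] sy by blast
    define Zx where "Zx = Z - Zy"
    have Zy': "conn Zy" "Zy \<subseteq> Z - {s}" "\<not> adj Zy (Z - {s} - Zy)" using Zy by (auto simp: comp_def)
    have Zx_eq: "Zx = {s} \<union> (Z - {s} - Zy)" using Zy'(2) sy by (auto simp: Zx_def)
    have "Z - ({s} \<union> (Z - {s} - Zy)) = Zy" using Zy'(2) by blast
    then have cZx: "conn Zx" unfolding Zx_eq
      using Zy'(3) sy by (intro conn_rest[OF conn_singleton Z(3)]) (auto simp: adj_sym)
    have ZZ: "Zx \<union> Zy = Z" "Zx \<inter> Zy = {}" using Zy'(2) by (auto simp: Zx_def)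
    have split: "es Z = es Zx + es Zy + ec Zx Zy" "card Z = card Zx + card Zy"
      using es_Un[OF ZZ(2)] card_Un_disjoint[of Zx Zy] ZZ conn_finite cZx Zy'(1) by auto
    have "Zx \<noteq> Z" "Zx \<noteq> {}" using ZZ conn_nonempty[OF Zy'(1)] conn_nonempty[OF cZx] by auto
    then have "adj Zx (Z - Zx)" using connD[OF Z(3)] ZZ by blast
    moreover have "Z - Zx = Zy" using ZZ by blast
    ultimately have axy: "adj Zx Zy" by simp
    then have e1: "1 \<le> ec Zx Zy" by (simp add: adj_ec)
    have "cyc Zx 0" "cyc Zy 0" using conn_cyc0 cZx Zy'(1) by auto
    then have e: "ec Zx Zy = 1" "\<not> cyc Zx 1" "\<not> cyc Zy 1"
      using split esZ e1 by (auto simp: cyc_def)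
    \<comment> \<open>A subtree has no surplus edge, so at least two edges leave it inside
      \<open>X\<close>; only one runs to the other subtree and none to \<open>R\<close>, hence one
      runs to the outer part \<open>C\<close>.\<close>
    have adjW: "adj W C" if W: "(W = Zx \<and> W' = Zy) \<or> (W = Zy \<and> W' = Zx)"
      and XC: "deg2 X" "finite X" "X = C \<union> R \<union> Z" "C \<inter> (R \<union> Z) = {}" for W W' X C
    proof -
      have n: "\<not> cyc W 1" "ec W W' = 1" "W \<union> W' = Z" "W \<inter> W' = {}" using W e ZZ by (auto simp: ec_sym)
      have "heavy W (X - W)" using heavy_deg2[OF XC(1)] XC(2,3) n(3) by blast
      then have two: "2 \<le> ec W (X - W)" using n(1) by (simp add: heavy_def)
      have nR: "\<not> adj W R" using ZR(1) n(3) adj_mono[of W R Z R] by blast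
      have "ec W (X - W) \<le> ec W (C \<union> W')" using nR XC(3) n(3) by (intro ec_reduce[of _ _ R]) auto
      also have "\<dots> = ec (C \<union> W') W" by (rule ec_sym)
      also have "\<dots> = ec C W + ec W' W" using XC(4) n(3,4) by (intro ec_Un) auto
      also have "ec W' W = 1" using n(2) by (simp add: ec_sym)
      finally have "1 \<le> ec C W" using two by simp
      then show ?thesis by (simp add: adj_ec ec_sym[of W])
    qed
    have finX: "finite X1" "finite X2" using conn_finite X1(1) X2(1) by auto
    have aA: "adj Zx A0" "adj Zy A0" using adjW[of Zx Zy X1 A0] adjW[of Zy Zx X1 A0] X1(2) finX x1(1) dis by auto
    have aB: "adj Zx B0" "adj Zy B0" using adjW[of Zx Zy X2 B0] adjW[of Zy Zx X2 B0] X2(2) finX x1(2) dis by auto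
    define U where "U = A0 \<union> R"
    have UZ: "U \<inter> Z = {}" using dis RZ by (auto simp: U_def)
    have "X1 = U \<union> Z" using x1 by (auto simp: U_def)
    then have "es X1 = es U + es Z + ec U Z" "card X1 = card U + card Z"
      using es_Un[OF UZ] card_Un_disjoint[of U Z] UZ conn_finite[OF cAR] conn_finite[OF Z(3)] by (auto simp: U_def)
    moreover have "ec Z U = ec Zx U + ec Zy U" unfolding ZZ(1)[symmetric]
      using UZ ZZ by (intro ec_Un) auto
    \<comment> \<open>\<open>X1\<close> has surplus two and \<open>Z\<close> has none. If
      \<open>U\<close> has none either, at least three edges join \<open>U\<close> to
      \<open>Z\<close>, and two of them go to the same subtree.\<close>
    ultimately have cases: "cyc U 1 \<or> 2 \<le> ec U Zx \<or> 2 \<le> ec U Zy"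
      using X1(3) esZ unfolding cyc_def by (auto simp: ec_sym[of U])
    have fin: bad if W: "(W = Zx \<and> W' = Zy) \<or> (W = Zy \<and> W' = Zx)" and h: "heavy U W" for W W'
    proof -
      have w: "conn W" "conn W'" "W \<union> W' = Z" "W \<inter> W' = {}" "adj W A0" "adj W' A0" "adj W B0" "adj W' B0" "adj W W'"
        using W cZx Zy'(1) ZZ aA aB axy by (auto simp: adj_sym)
      have wU: "adj U W" "adj W' U" "U \<inter> W = {}" "U \<inter> W' = {}"
        using w(3,5,6) UZ by (auto simp: U_def adj_Un adj_Un2 adj_sym)
      have c1: "conn (U \<union> W)" "cyc (U \<union> W) 1"
        using conn_Un[of U W] cyc_heavy[OF h] cAR w(1) wU by (simp_all add: U_def)
      have UA: "U \<inter> A = A0" using sA0 dis by (auto simp: U_def)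
      have c2: "conn (A \<union> (U \<union> W))" using conn_Un[OF A0(3) c1(1)] UA nA0 by blast
      have c3: "cyc (A \<union> (U \<union> W)) 1" using cyc_mono[OF c2 _ _ c1(2)] conn_nonempty[OF c1(1)] by blast
      have d: "W' \<inter> B = {}" "W' \<inter> (A \<union> (U \<union> W)) = {}" "B \<inter> (A \<union> (U \<union> W)) = {}" "B \<inter> W = {}"
        using dis w(3,4) wU(4) AB(1) sA0 by (auto simp: U_def)
      have "2 \<le> ec W' (A \<union> (U \<union> W))"
        using w(9) wU d by (intro ec_two[of W' W U]) (auto simp: adj_sym w(4))
      moreover have BW: "adj B W" using w(7) sB0 adj_mono[of W B0 W B] adj_sym by blast
      have "2 \<le> ec B (A \<union> (U \<union> W))"
        using AB(2) BW d dis w(3) AB(1) by (intro ec_two[of B A W]) (auto simp: adj_sym)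
      moreover have "adj W' B" using w(8) sB0 adj_mono[of W' B0 W' B] by blast
      ultimately show ?thesis
        by (intro bad_A3[OF w(2) B0(3) c2])
          (use d c3 wU BW in \<open>auto simp: heavy_def adj_Un\<close>)
    qed
    show ?thesis using cases fin[of Zx Zy] fin[of Zy Zx] by (auto simp: heavy_def)
  qed
qed

end

section \<open>Two pieces in a graph without the excluded minors\<close>

locale good_graph = mgraph +
  assumes conn_V: "conn V" and deg2_V: "deg2 V" and not_bad: "\<not> bad"
begin

lemma conn_co_piece: "piece X v \<Longrightarrow> conn (V - X)"
  using piece_rest[of X v V] conn_V deg2_V pieceD[of X v] conn_nonempty[of X] by blast

lemma crossing_ends:
  assumes "piece X1 v1" "piece X2 v2" "\<not> X1 \<subseteq> X2" "\<not> X2 \<subseteq> X1" "X1 \<inter> X2 \<noteq> {}"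
  shows "v2 \<in> X1" "v1 \<in> X2" "conn (X1 - X2)" "conn (X2 - X1)"
proof -
  show v: "v2 \<in> X1" using piece_subset[of X1 v1 X2 v2] assms by blast
  show w: "v1 \<in> X2" using piece_subset[of X2 v2 X1 v1] assms by blast
  show "conn (X1 - X2)" using piece_rest[OF assms(2), of X1] v assms(5) pieceD[OF assms(1)] by blast
  show "conn (X2 - X1)" using piece_rest[OF assms(1), of X2] w assms(5) pieceD[OF assms(2)] by blast
qed

text \<open>All edges of the two pieces at a shared vertex run to the outer parts, at least two to
  each. Two shared vertices would give the triangle of \<open>bad_A3\<close>; so there is only one,
  and a vertex outside both pieces would complete \<open>bad_D4\<close>.\<close>

lemma crossing_no_edge:
  assumes p: "piece X1 v1" "piece X2 v2" "\<not> X1 \<subseteq> X2" "\<not> X2 \<subseteq> X1" "X1 \<inter> X2 \<noteq> {}"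
    and no: "\<And>e. e \<in> E \<Longrightarrow> \<not> N e \<subseteq> X1 \<inter> X2"
  shows "V = X1 \<union> X2" "\<exists>z. X1 \<inter> X2 = {z}"
    "\<And>z. z \<in> X1 \<inter> X2 \<Longrightarrow> 2 \<le> ec {z} (X2 - X1)"
proof -
  note X1 = pieceD[OF p(1)] and X2 = pieceD[OF p(2)]
  define A where "A = X1 - X2"
  define B where "B = X2 - X1"
  define I where "I = X1 \<inter> X2"
  have cA: "conn A" and cB: "conn B" using crossing_ends[OF p] by (simp_all add: A_def B_def)
  have AB: "A \<inter> B = {}" "A \<inter> I = {}" "B \<inter> I = {}" by (auto simp: A_def B_def I_def)
  have deg: "2 \<le> ec {z} C" if z: "z \<in> I" and X: "deg2 X" "X = C \<union> I" for z C X
  proof -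
    have "2 \<le> card {e \<in> E. z \<in> N e \<and> N e \<subseteq> X}" using z X by (auto simp: deg2_def)
    also have "\<dots> \<le> ec {z} C" unfolding ec_def
    proof (rule card_mono)
      have "N e \<inter> C \<noteq> {}" if "e \<in> E" "N e \<subseteq> X" for e
        using no[OF that(1)] that(2) X(2) by (auto simp: I_def)
      then show "{e \<in> E. z \<in> N e \<and> N e \<subseteq> X} \<subseteq> {e \<in> E. N e \<inter> {z} \<noteq> {} \<and> N e \<inter> C \<noteq> {}}" by blast
    qed (use finE in simp)
    finally show ?thesis .
  qed
  have x: "X1 = A \<union> I" "X2 = B \<union> I" by (auto simp: A_def B_def I_def)
  have zA: "2 \<le> ec {z} A" and zB: "2 \<le> ec {z} B" if "z \<in> I" for z
    using deg[OF that X1(5) x(1)] deg[OF that X2(5) x(2)] by auto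
  show "2 \<le> ec {z} (X2 - X1)" if "z \<in> X1 \<inter> X2" for z using zB that by (simp add: I_def B_def)
  have single: "z1 = z2" if z: "z1 \<in> I" "z2 \<in> I" for z1 z2
  proof (rule ccontr)
    assume ne: "z1 \<noteq> z2"
    have d: "A \<inter> {z1} = {}" "A \<inter> {z2} = {}" "B \<inter> {z1} = {}" "B \<inter> {z2} = {}" using z AB by auto
    have aA: "adj {z1} A" using zA[OF z(1)] by (simp add: adj_ec)
    then have aA': "adj A {z1}" using adj_sym by blast
    have h: "heavy A {z1}" using zA[OF z(1)] by (simp add: heavy_def ec_sym)
    have w: "conn (A \<union> {z1})" "cyc (A \<union> {z1}) 1"
      using conn_Un[OF cA conn_singleton] cyc_heavy[OF h cA conn_singleton] aA' d by auto
    have "2 \<le> ec {z2} (A \<union> {z1})" by (rule order_trans[OF zA[OF z(2)] ec_mono]) auto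
    then have "heavy {z2} (A \<union> {z1})" unfolding heavy_def by (rule disjI2)
    moreover have "heavy B (A \<union> {z1})"
      using zB[OF z(1)] ec_mono[of B B "{z1}" "A \<union> {z1}"] by (auto simp: heavy_def ec_sym[of B])
    moreover have "adj {z2} A" "adj {z2} B" "adj {z1} B"
      using zA[OF z(2)] zB[OF z(2)] zB[OF z(1)] by (simp_all add: adj_ec)
    then have "adj {z2} B" "adj {z2} (A \<union> {z1})" "adj B (A \<union> {z1})"
      using adj_sym[of B "{z1}"] unfolding adj_Un by simp_all
    ultimately have bad
      by (intro bad_A3[OF conn_singleton[of z2] cB w(1) _ _ _ _ _ _ w(2)]) (use d ne AB in auto)
    then show False using not_bad by simp
  qed
  then show ex: "\<exists>z. X1 \<inter> X2 = {z}" using p(5) unfolding I_def[symmetric] by blast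
  then obtain z where I: "I = {z}" by (auto simp: I_def)
  show "V = X1 \<union> X2"
  proof (rule ccontr)
    assume n: "V \<noteq> X1 \<union> X2"
    define O' where "O' = V - (X1 \<union> X2)"
    obtain o' where o': "o' \<in> O'" using n X1(1) X2(1) by (auto simp: O'_def)
    obtain S where S: "comp O' S" "o' \<in> S" using comp_exists[OF _ o'] finV by (auto simp: O'_def)
    have S': "S \<subseteq> O'" "conn S" "\<not> adj S (O' - S)" using S by (auto simp: comp_def)
    have dS: "A \<inter> S = {}" "B \<inter> S = {}" "I \<inter> S = {}" using S'(1) by (auto simp: O'_def A_def B_def I_def)
    have sA: "adj S C" if "conn Y" "Y = C \<union> O'" "C \<inter> S = {}" "C \<noteq> {}" for C Y
    proof -
      have "adj S (Y - S)" using connD[OF that(1), of S] that S' conn_nonempty[OF S'(2)] by blast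
      then show ?thesis using adj_reduce[of S "Y - S" C "O' - S"] S'(3) that(2) by blast
    qed
    have "V - X2 = A \<union> O'" "V - X1 = B \<union> O'" using X1(1) X2(1) by (auto simp: A_def B_def O'_def)
    then have a: "adj S A" "adj S B"
      using sA[OF conn_co_piece[OF p(2)]] sA[OF conn_co_piece[OF p(1)]] dS conn_nonempty cA cB by auto
    \<comment> \<open>Source of the three parallel edges in D_4: a piece has surplus two, so if
      \<open>C\<close> has no surplus edge, three edges must join it to the single shared
      vertex.\<close>
    have count: "cyc C 1 \<or> 3 \<le> ec C I" if "cyc X 2" "X = C \<union> I" "C \<inter> I = {}" "conn C" for C X
    proof -
      have "es I = 0" using no finE by (auto simp: es_def I_def)
      then have "es X = es C + ec C I" using es_Un[OF that(3)] that(2) by simp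
      moreover have "card X = card C + 1"
        using that(2,3,4) I conn_finite[of C] by simp
      ultimately show ?thesis using that(1) conn_cyc0[OF that(4)] unfolding cyc_def by linarith
    qed
    have "adj A S" "adj B S" using a adj_sym by auto
    then have bad
      using bad_D4[of A B I S] count[OF X1(6) x(1) AB(2) cA] count[OF X2(6) x(2) AB(3) cB]
        zA[of z] zB[of z] AB dS S'(2) cA cB I conn_singleton[of z] by (auto simp: ec_sym[of "{z}"])
    then show False using not_bad by simp
  qed
qed

text \<open>With a shared edge, \<open>crossing_bad\<close> rules out every edge between the
  complements, and then no vertex can lie outside both pieces. In the last alternative every edge
  lies inside one of the two pieces.\<close>

lemma pair_cases:
  assumes p: "piece X1 v1" "piece X2 v2" "\<not> X1 \<subseteq> X2" "\<not> X2 \<subseteq> X1"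
  shows "X1 \<inter> X2 = {} \<or>
    (V = X1 \<union> X2 \<and> (\<exists>z. X1 \<inter> X2 = {z}) \<and> (\<forall>e\<in>E. \<not> N e \<subseteq> X1 \<inter> X2)) \<or>
    (V = X1 \<union> X2 \<and> \<not> adj (V - X1) (V - X2))"
proof (cases "X1 \<inter> X2 = {}")
  case False
  note X1 = pieceD[OF p(1)] and X2 = pieceD[OF p(2)]
  note ends = crossing_ends[OF p False]
  show ?thesis
  proof (cases "\<exists>f\<in>E. N f \<subseteq> X1 \<inter> X2")
    case True
    then obtain f where f: "f \<in> E" "N f \<subseteq> X1 \<inter> X2" by auto
    have touch: False if t: "adj (V - X1) (V - X2)"
    proof -
      have B: "conn (V - X1)" "X2 - X1 \<subseteq> V - X1" "(V - X1) \<inter> X1 = {}"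
        using conn_co_piece[OF p(1)] X2(1) by auto
      have "adj (X1 - X2) (V - X1)"
      proof (cases "V = X1 \<union> X2")
        case True
        then have "V - X1 = X2 - X1" "V - X2 = X1 - X2" by auto
        then show ?thesis using t adj_sym by simp
      next
        case False
        then have "X1 - X2 \<noteq> V - X2" using X1(1) X2(1) by blast
        then have "adj (X1 - X2) (V - X2 - (X1 - X2))"
          using X1(1) conn_nonempty[OF ends(3)] by (intro connD[OF conn_co_piece[OF p(2)]]) auto
        then show ?thesis
          using adj_mono[of "X1 - X2" "V - X2 - (X1 - X2)" "X1 - X2" "V - X1"] by blast
      qed
      then have bad
        by (intro crossing_bad[OF X1(4,5,6) X2(4,5,6) ends(3) _ ends(3) _ ends(4) B(2,1,3) _ _ f]) auto
      then show False using not_bad by simp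
    qed
    have "V = X1 \<union> X2"
    proof (rule ccontr)
      assume "V \<noteq> X1 \<union> X2"
      then obtain x where x: "x \<in> V" "x \<notin> X1" "x \<notin> X2" using X1(1) X2(1) by blast
      then obtain e where "e \<in> E" "x \<in> N e" by (auto simp: V_def)
      then have "adj (V - X1) (V - X2)" using x unfolding adj_def by blast
      then show False using touch by simp
    qed
    then show ?thesis using touch by blast
  next
    case no: False
    then show ?thesis using crossing_no_edge[OF p False] by blast
  qed
qed simp

section \<open>Linking disjoint connected sets, and nested triples of pieces\<close>

definition link :: "'b set \<Rightarrow> 'b set \<Rightarrow> 'b set \<Rightarrow> 'b set \<Rightarrow> bool" where
  "link J A B D \<longleftrightarrow> (D = {} \<and> adj A B) \<or> (comp J D \<and> adj D A \<and> adj D B)"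

text \<open>An empty \<open>D\<close> stands for direct adjacency, so that
  \<open>A \<union> D\<close> touches \<open>B\<close> in either case. The component of
  \<open>A\<close> in the graph without \<open>B\<close> and \<open>C\<close> must reach
  \<open>B\<close>; if not from \<open>A\<close> itself, then from a vertex of \<open>J\<close>,
  whose component in \<open>J\<close> is the link.\<close>

lemma link_exists:
  assumes c: "conn A" "B \<noteq> {}" "conn (V - C)" and s: "A \<subseteq> V - C" "B \<subseteq> V - C"
    and d: "A \<inter> B = {}" and J: "J = V - (A \<union> B \<union> C)"
  shows "\<exists>D. link J A B D"
proof (cases "adj A B")
  case False
  have fin: "finite (V - C - B)" "finite J" using finV J by auto
  obtain W where W: "A \<subseteq> W" "W \<subseteq> V - C - B" "conn W" "\<not> adj W (V - C - B - W)"
    using conn_maximal[OF fin(1) c(1)] s d by blast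
  have "adj W (V - C - W)" using connD[OF c(3), of W] W conn_nonempty[OF W(3)] s(2) c(2) by blast
  then have "adj W B" using W(4) adj_reduce[of W "V - C - W" B "V - C - B - W"] by blast
  then obtain e x where e: "e \<in> E" "N e \<inter> B \<noteq> {}" "x \<in> N e" "x \<in> W" by (auto simp: adj_def)
  have "x \<notin> A" using False e unfolding adj_def by blast
  then have xJ: "x \<in> J" using e(4) W(2) J by blast
  then obtain D where D: "comp J D" "x \<in> D" using comp_exists[OF fin(2)] by blast
  have D': "D \<subseteq> J" "conn D" "\<not> adj D (J - D)" using D by (auto simp: comp_def)
  have DB: "adj D B" using e D(2) unfolding adj_def by blast
  have DW: "D \<subseteq> W" using comp_absorb[OF W(3,4) D'(2)] D'(1) J e(4) D(2) by blast
  have "D \<noteq> W" using W(1) D'(1) J conn_nonempty[OF c(1)] by blast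
  then have "adj D (W - D)" using connD[OF W(3) DW] D(2) by blast
  moreover have "W - D \<subseteq> A \<union> (J - D)" using W(2) J by blast
  ultimately have "adj D A" using adj_reduce D'(3) by blast
  then show ?thesis using D(1) DB unfolding link_def by blast
qed (auto simp: link_def)

lemma link_conn:
  assumes "link J A B D" "conn A"
  shows "conn (A \<union> D)"
  using assms conn_Un[of A D] adj_sym[of A D] by (auto simp: link_def comp_def)

text \<open>Complements are connected, so each pair is linked without using the third set. Either
  one component touches all three sets, or the three links are disjoint, and giving one link to each
  set makes the sets touch pairwise.\<close>

lemma triad:
  assumes c: "conn A" "conn B" "conn C" "conn (V - A)" "conn (V - B)" "conn (V - C)"
    and s: "A \<subseteq> V" "B \<subseteq> V" "C \<subseteq> V" and d: "A \<inter> B = {}" "A \<inter> C = {}" "B \<inter> C = {}"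
    and J: "J = V - (A \<union> B \<union> C)"
  shows "(\<exists>Z. comp J Z \<and> adj Z A \<and> adj Z B \<and> adj Z C) \<or>
    (\<exists>A' B' C'. A \<subseteq> A' \<and> B \<subseteq> B' \<and> C \<subseteq> C' \<and> conn A' \<and> conn B' \<and> conn C' \<and>
      A' \<inter> B' = {} \<and> A' \<inter> C' = {} \<and> B' \<inter> C' = {} \<and> adj A' B' \<and> adj A' C' \<and> adj B' C')"
proof (cases "\<exists>Z. comp J Z \<and> adj Z A \<and> adj Z B \<and> adj Z C")
  case no: False
  have n: "A \<noteq> {}" "B \<noteq> {}" "C \<noteq> {}" using c conn_nonempty by auto
  obtain D1 where D1: "link J A B D1" using link_exists[OF c(1) n(2) c(6) _ _ d(1) J] s d by blast
  obtain D2 where D2: "link J B C D2"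
  proof -
    have "B \<subseteq> V - A" "C \<subseteq> V - A" "J = V - (B \<union> C \<union> A)" using s d J by auto
    then show ?thesis using link_exists[OF c(2) n(3) c(4) _ _ d(3), of J] that by blast
  qed
  obtain D3 where D3: "link J C A D3"
  proof -
    have "C \<subseteq> V - B" "A \<subseteq> V - B" "C \<inter> A = {}" "J = V - (C \<union> A \<union> B)" using s d J by auto
    then show ?thesis using link_exists[OF c(3) n(1) c(5), of J] that by blast
  qed
  have sub: "D1 \<subseteq> J" "D2 \<subseteq> J" "D3 \<subseteq> J" using D1 D2 D3 by (auto simp: link_def comp_def)
  have dis: "D1 \<inter> D2 = {}" "D1 \<inter> D3 = {}" "D2 \<inter> D3 = {}"
    using D1 D2 D3 no comp_disjoint[of J] unfolding link_def by blast+
  have "adj (A \<union> D1) (B \<union> D2)" using D1 by (auto simp: link_def adj_Un adj_Un2 adj_sym)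
  moreover have "adj (A \<union> D1) (C \<union> D3)" using D3 by (auto simp: link_def adj_Un adj_Un2 adj_sym)
  moreover have "adj (B \<union> D2) (C \<union> D3)" using D2 by (auto simp: link_def adj_Un adj_Un2 adj_sym)
  moreover have "(A \<union> D1) \<inter> (B \<union> D2) = {}" "(A \<union> D1) \<inter> (C \<union> D3) = {}" "(B \<union> D2) \<inter> (C \<union> D3) = {}"
    using dis sub d J by auto
  ultimately show ?thesis
    using link_conn[OF D1 c(1)] link_conn[OF D2 c(2)] link_conn[OF D3 c(3)]
    by (intro disjI2 exI[of _ "A \<union> D1"] exI[of _ "B \<union> D2"] exI[of _ "C \<union> D3"] conjI Un_upper1)
qed simp

text \<open>\<open>triad\<close> is applied to \<open>X1\<close>, \<open>X2\<close> and the
  complement \<open>C\<close> of \<open>X3\<close>. A triangle gives \<open>bad_R3\<close>. A common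
  component \<open>Z\<close> gives \<open>bad_P2\<close> if \<open>C\<close> is heavy towards
  \<open>Z\<close>; otherwise \<open>C\<close> has another way to \<open>X1\<close> or
  \<open>X2\<close>, and this piece, extended by a component if necessary, closes a triangle for
  \<open>bad_R4\<close>.\<close>

lemma no_common_superpiece:
  assumes p: "piece X1 v1" "piece X2 v2" "piece X3 v3" "\<not> X1 \<subseteq> X2" "\<not> X2 \<subseteq> X1"
    and s: "X1 \<subseteq> X3" "X2 \<subseteq> X3"
  shows False
proof -
  note X1 = pieceD[OF p(1)] and X2 = pieceD[OF p(2)] and X3 = pieceD[OF p(3)]
  have "V \<noteq> X1 \<union> X2" using s X3(2,3) by blast
  then have d: "X1 \<inter> X2 = {}" using pair_cases[OF p(1,2,4,5)] by blast
  define C where "C = V - X3"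
  define J where "J = V - (X1 \<union> X2 \<union> C)"
  have C: "conn C" "conn (V - C)" "X1 \<inter> C = {}" "X2 \<inter> C = {}" "C \<subseteq> V"
    using conn_co_piece[OF p(3)] X3(1,4) s by (auto simp: C_def double_diff)
  have h1: "heavy X1 Y" "heavy X2 Y" for Y using X1(6) X2(6) cyc_le by (auto simp: heavy_def)
  consider Z where "comp J Z" "adj Z X1" "adj Z X2" "adj Z C"
    | A' B' C' where "X1 \<subseteq> A'" "X2 \<subseteq> B'" "conn A'" "conn B'" "conn C'" "A' \<inter> B' = {}" "A' \<inter> C' = {}" "B' \<inter> C' = {}"
      "adj A' B'" "adj A' C'" "adj B' C'"
    using triad[OF X1(4) X2(4) C(1) conn_co_piece[OF p(1)] conn_co_piece[OF p(2)] C(2) X1(1) X2(1) C(5) d C(3,4) J_def]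
    by blast
  then show False
  proof cases
    case 1
    have Z: "Z \<subseteq> J" "conn Z" "\<not> adj Z (J - Z)" using 1 by (auto simp: comp_def)
    have dZ: "Z \<inter> X1 = {}" "Z \<inter> X2 = {}" "Z \<inter> C = {}" using Z(1) by (auto simp: J_def)
    have r4: False if "adj C Y" "(Y0 = X1 \<and> Y1 = X2) \<or> (Y0 = X2 \<and> Y1 = X1)" "Y0 \<subseteq> Y" "conn Y"
      "Y \<inter> Z = {}" "Y \<inter> Y1 = {}" "Y \<inter> C = {}" for Y Y0 Y1
    proof -
      have Y0: "cyc Y0 2" "conn Y0" "adj Z Y0" and Y1: "heavy Y1 Z" "conn Y1" "adj Z Y1" "Z \<inter> Y1 = {}" "C \<inter> Y1 = {}"
        using that(2) X1 X2 1 h1 dZ C by auto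
      have "cyc Y 2" using cyc_mono[OF that(4,3) conn_nonempty[OF Y0(2)] Y0(1)] .
      moreover have "adj Z Y" using Y0(3) that(3) adj_mono by blast
      moreover have "adj Z C" using 1 by simp
      ultimately have bad using bad_R4[OF Z(2) C(1) Y1(2) that(4)] Y1 that dZ by (simp add: Int_commute)
      then show False using not_bad by simp
    qed
    show False
    proof (cases "heavy C Z")
      case True
      then have bad using bad_P2[OF Z(2) X1(4) X2(4) C(1)] dZ d C 1 h1 adj_sym by metis
      then show False using not_bad by simp
    next
      case False
      have "heavy C (V - C)" using heavy_deg2[OF deg2_V C(5) finV] .
      then have "\<not> ec C (V - C) \<le> ec C Z" using False by (auto simp: heavy_def)
      then have "adj C (X1 \<union> X2 \<union> (J - Z))" using ec_reduce[of "V - C" Z "X1 \<union> X2 \<union> (J - Z)" C] by (auto simp: J_def)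
      then consider "adj C X1" | "adj C X2" | "adj C (J - Z)" by (auto simp: adj_Un)
      then show False
      proof cases
        assume "adj C X1"
        then show False using r4[of X1 X1 X2] X1(4) dZ d C by (auto simp: Int_commute)
      next
        assume "adj C X2"
        then show False using r4[of X2 X2 X1] X2(4) dZ d C by (auto simp: Int_commute)
      next
        assume "adj C (J - Z)"
        then obtain e x where e: "e \<in> E" "N e \<inter> C \<noteq> {}" "x \<in> N e" "x \<in> J - Z" by (auto simp: adj_def)
        obtain D where D: "comp J D" "x \<in> D" using comp_exists[of J x] e(4) finV by (auto simp: J_def)
        have D': "D \<subseteq> J" "conn D" "\<not> adj D (J - D)" using D by (auto simp: comp_def)
        have DZ: "D \<inter> Z = {}" using comp_disjoint[OF D(1) 1(1)] D(2) e(4) by blast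
        have CD: "adj C D" using e D(2) unfolding adj_def by blast
        have dD: "D \<inter> X1 = {}" "D \<inter> X2 = {}" "D \<inter> C = {}" using D'(1) by (auto simp: J_def)
        have "D \<noteq> V - C" using dD s X1(1) conn_nonempty[OF X1(4)] C(3) by blast
        then have "adj D (V - C - D)" using connD[OF C(2), of D] D'(1) D(2) by (auto simp: J_def)
        then have "adj D (X1 \<union> X2)" using D'(3) adj_reduce[of D "V - C - D" "X1 \<union> X2" "J - D"] by (auto simp: J_def)
        then consider "adj D X1" | "adj D X2" by (auto simp: adj_Un)
        then show False
        proof cases
          assume a: "adj D X1"
          then have "conn (X1 \<union> D)" using conn_Un[OF X1(4) D'(2)] adj_sym by blast
          then show False
            by (intro r4[of "X1 \<union> D" X1 X2]) (use CD DZ dZ d dD C in \<open>auto simp: adj_Un\<close>)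
        next
          assume a: "adj D X2"
          then have "conn (X2 \<union> D)" using conn_Un[OF X2(4) D'(2)] adj_sym by blast
          then show False
            by (intro r4[of "X2 \<union> D" X2 X1]) (use CD DZ dZ d dD C in \<open>auto simp: adj_Un\<close>)
        qed
      qed
    qed
  next
    case 2
    have "cyc A' 2" "cyc B' 2"
      using cyc_mono[OF 2(3,1) conn_nonempty[OF X1(4)] X1(6)] cyc_mono[OF 2(4,2) conn_nonempty[OF X2(4)] X2(6)] by auto
    then have bad using bad_R3[of A' B' C'] 2 by blast
    then show False using not_bad by simp
  qed
qed

text \<open>The complements \<open>A\<close> and \<open>B\<close> do not touch, so a link between
  them runs through the overlap \<open>I\<close>, and \<open>touch3\<close> ties it to
  \<open>X3\<close>. This yields a centre \<open>Z\<close> touching \<open>A\<close>,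
  \<open>B\<close> and \<open>X3\<close>; which minor appears depends on whether \<open>A\<close>
  and \<open>B\<close> are heavy towards \<open>Z\<close>.\<close>

lemma no_common_subpiece:
  assumes p: "piece X1 v1" "piece X2 v2" "piece X3 v3" "\<not> X1 \<subseteq> X2" "\<not> X2 \<subseteq> X1"
    and s: "X3 \<subseteq> X1" "X3 \<subseteq> X2"
  shows False
proof -
  note X1 = pieceD[OF p(1)] and X2 = pieceD[OF p(2)] and X3 = pieceD[OF p(3)]
  have "es X3 \<noteq> 0" using X3(6) conn_nonempty[OF X3(4)] conn_finite[OF X3(4)]
    by (auto simp: cyc_def)
  then have "\<exists>e\<in>E. N e \<subseteq> X3" unfolding es_def by (metis (no_types, lifting) card.empty empty_Collect_eq)
  then have V: "V = X1 \<union> X2" "\<not> adj (V - X1) (V - X2)"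
    using pair_cases[OF p(1,2,4,5)] s conn_nonempty[OF X3(4)] by blast+
  define A where "A = V - X2"
  define B where "B = V - X1"
  define I where "I = X1 \<inter> X2"
  define J where "J = V - (A \<union> B \<union> X3)"
  have nAB: "\<not> adj A B" "\<not> adj B A" using V(2) by (auto simp: A_def B_def adj_sym)
  have cA: "conn A" and cB: "conn B" using conn_co_piece p by (auto simp: A_def B_def)
  have x: "X1 = A \<union> I" "X2 = B \<union> I" "V - A = B \<union> I" "V - B = A \<union> I" "I = J \<union> X3"
    using V(1) s X1(1) X2(1) by (auto simp: A_def B_def I_def J_def)
  have d: "A \<inter> B = {}" "A \<inter> I = {}" "B \<inter> I = {}" "J \<inter> X3 = {}" "A \<inter> J = {}" "B \<inter> J = {}" "A \<inter> X3 = {}" "B \<inter> X3 = {}"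
    using V(1) s by (auto simp: A_def B_def I_def J_def)
  have finI: "finite I" using conn_finite[OF X1(4)] by (simp add: I_def)
  have sV: "A \<subseteq> V" "B \<subseteq> V" by (auto simp: A_def B_def)
  have cX: "conn (A \<union> I)" "conn (B \<union> I)" "deg2 (A \<union> I)" "deg2 (B \<union> I)" using X1 X2 x by auto
  have around: "\<exists>C. X3 \<subseteq> C \<and> C \<subseteq> I - Z \<and> conn C \<and> \<not> adj C (I - Z - C) \<and> cyc C 2" if "Z \<subseteq> J" for Z
  proof -
    have fin: "finite (I - Z)" using finI by simp
    have "X3 \<subseteq> I - Z" using that x(5) d(4) by blast
    then obtain C where C: "X3 \<subseteq> C" "C \<subseteq> I - Z" "conn C" "\<not> adj C (I - Z - C)"
      using conn_maximal[OF fin X3(4)] by blast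
    then show ?thesis using cyc_mono[OF C(3,1) conn_nonempty[OF X3(4)] X3(6)] by blast
  qed
  \<comment> \<open>If \<open>Z\<close> missed \<open>X3\<close>, the component \<open>C\<close> of
    \<open>X3\<close> in \<open>I - Z\<close> would touch \<open>A\<close> and \<open>B\<close> as
    well, and \<open>A\<close>, \<open>Z\<close>, \<open>B\<close>, \<open>C\<close> would form a
    four-cycle with surplus two at \<open>C\<close>. There \<open>Z\<close> is heavy towards
    \<open>A\<close> and \<open>B\<close>, which gives a minor with or without a surplus edge in
    \<open>Z\<close>.\<close>
  have touch3: "adj Z X3" if Z: "comp J Z" "adj Z A" "adj Z B" for Z
  proof (rule ccontr)
    assume n3: "\<not> adj Z X3"
    have Z': "Z \<subseteq> J" "conn Z" "\<not> adj Z (J - Z)" using Z by (auto simp: comp_def)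
    have dZ: "A \<inter> Z = {}" "B \<inter> Z = {}" "X3 \<inter> Z = {}" using Z'(1) d by auto
    have nrest: "\<not> adj Z (I - Z)" using n3 Z'(3) adj_reduce[of Z "I - Z" X3 "J - Z"] x(5) by blast
    obtain C where C: "X3 \<subseteq> C" "C \<subseteq> I - Z" "conn C" "\<not> adj C (I - Z - C)" "cyc C 2" using around[OF Z'(1)] by blast
    have dC: "A \<inter> C = {}" "B \<inter> C = {}" "Z \<inter> C = {}" using C(2) d by auto
    have nCZ: "\<not> adj C Z" using nrest C(2) adj_mono[of Z C Z "I - Z"] adj_sym by blast
    have hZ: "heavy Z Y" and aC: "adj C Y" if Y: "conn (Y \<union> I)" "deg2 (Y \<union> I)" "Y \<inter> I = {}" "conn Y" for Y
    proof -
      have ZI: "Z \<subseteq> I" using Z'(1) x(5) by blast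
      have "heavy Z (Y \<union> I - Z)" using heavy_deg2[OF Y(2), of Z] conn_finite[OF Y(1)] ZI by blast
      then show "heavy Z Y" by (rule heavy_reduce[of _ _ _ "I - Z"]) (use nrest in auto)
      have "C \<noteq> Y \<union> I" using C(2) conn_nonempty[OF Z'(2)] ZI by blast
      then have "adj C (Y \<union> I - C)" using connD[OF Y(1), of C] C(2) conn_nonempty[OF C(3)] by blast
      moreover have "\<not> adj C (Z \<union> (I - Z - C))" using C(4) nCZ by (simp add: adj_Un)
      ultimately show "adj C Y" using adj_reduce[of C "Y \<union> I - C" Y "Z \<union> (I - Z - C)"] by blast
    qed
    have h: "heavy Z A" "heavy Z B" "adj C A" "adj C B" using hZ aC cX d cA cB by auto
    have bad
    proof (cases "cyc Z 1")
      case True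
      then show ?thesis
        using bad_R4_C4[OF cA Z'(2) cB C(3)] dZ dC d Z h C(5) adj_sym by (metis Int_commute)
    next
      case False
      then have e: "2 \<le> ec Z A" "2 \<le> ec Z B" using h by (auto simp: heavy_def)
      have w: "conn (Z \<union> A)" "cyc (Z \<union> A) 1"
        using conn_Un[OF Z'(2) cA] cyc_heavy[OF h(1) Z'(2) cA] Z dZ by auto
      have "heavy B (Z \<union> A)" using e(2) ec_mono[of B B Z "Z \<union> A"] by (simp add: heavy_def ec_sym[of B])
      moreover have "heavy C (Z \<union> A)" using C(5) cyc_le by (auto simp: heavy_def)
      ultimately show ?thesis
        by (intro bad_A3[OF cB C(3) w(1) _ _ _ _ _ _ w(2)])
          (use dZ dC d Z h adj_sym in \<open>auto simp: adj_Un\<close>)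
    qed
    then show False using not_bad by simp
  qed
  have "\<exists>D. link J A B D"
    using link_exists[OF cA conn_nonempty[OF cB] conn_co_piece[OF p(3)] _ _ d(1) J_def] sV d by blast
  then obtain Z where Z: "comp J Z" "adj Z A" "adj Z B" using nAB by (auto simp: link_def)
  have Z': "Z \<subseteq> J" "conn Z" "\<not> adj Z (J - Z)" using Z by (auto simp: comp_def)
  have Z3: "adj Z X3" using touch3[OF Z] .
  obtain C where C: "X3 \<subseteq> C" "C \<subseteq> I - Z" "conn C" "\<not> adj C (I - Z - C)" "cyc C 2" using around[OF Z'(1)] by blast
  have ZC: "adj Z C" using Z3 C(1) adj_mono by blast
  have dZ: "Z \<inter> A = {}" "Z \<inter> B = {}" "Z \<inter> X3 = {}" "Z \<inter> C = {}" "A \<inter> C = {}" "B \<inter> C = {}"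
    using Z'(1) C(2) d by auto
  \<comment> \<open>A set that is not heavy towards \<open>Z\<close> has another edge into
    \<open>I - Z\<close>. Its end there lies in \<open>C\<close>: otherwise its component in
    \<open>J\<close> would miss \<open>X3\<close> and touch both \<open>A\<close> and
    \<open>B\<close>, against \<open>touch3\<close>.\<close>
  have key: "adj Y C" if Y: "(Y = A \<and> Y' = B) \<or> (Y = B \<and> Y' = A)" "\<not> heavy Y Z" for Y Y'
  proof -
    have y: "Y \<subseteq> V" "V - Y = Y' \<union> I" "\<not> adj Y Y'" "conn (Y' \<union> I)" "Y' \<inter> I = {}" "conn Y'"
      using Y(1) sV x nAB cX d cA cB by auto
    have "heavy Y (V - Y)" using heavy_deg2[OF deg2_V y(1) finV] .
    then have "\<not> ec Y (V - Y) \<le> ec Y Z" using Y(2) by (auto simp: heavy_def)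
    then have "adj Y (Y' \<union> (I - Z))" using ec_reduce[of "V - Y" Z "Y' \<union> (I - Z)" Y] y(2) by blast
    then have "adj Y (I - Z)" using y(3) by (simp add: adj_Un)
    then obtain e q where e: "e \<in> E" "N e \<inter> Y \<noteq> {}" "q \<in> N e" "q \<in> I - Z" by (auto simp: adj_def)
    have "q \<in> C"
    proof (cases "q \<in> X3")
      case False
      then have qJ: "q \<in> J" using e(4) x(5) by blast
      obtain D where D: "comp J D" "q \<in> D" using comp_exists[of J q] qJ finI x(5) by auto
      have D': "D \<subseteq> J" "conn D" "\<not> adj D (J - D)" using D by (auto simp: comp_def)
      have DZ: "D \<inter> Z = {}" using comp_disjoint[OF D(1) Z(1)] D(2) e(4) by blast
      have DY: "adj D Y" using e D(2) unfolding adj_def by blast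
      have D3: "adj D X3"
      proof (rule ccontr)
        assume n: "\<not> adj D X3"
        have "D \<noteq> Y' \<union> I" using D'(1) x(5) d(4) conn_nonempty[OF X3(4)] by blast
        then have "adj D (Y' \<union> I - D)" using connD[OF y(4), of D] D'(1) D(2) x(5) by blast
        moreover have "\<not> adj D (X3 \<union> (J - D))" using n D'(3) by (simp add: adj_Un)
        ultimately have "adj D Y'" using adj_reduce[of D "Y' \<union> I - D" Y' "X3 \<union> (J - D)"] x(5) by blast
        then show False using touch3[OF D(1)] DY Y(1) n by blast
      qed
      then have "adj C D" using C(1) adj_mono[of D X3 D C] adj_sym by blast
      then have "D \<subseteq> C" using comp_absorb[OF C(3,4) D'(2)] D'(1) DZ x(5) by blast
      then show ?thesis using D(2) by blast
    qed (use C(1) in blast)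
    then show ?thesis using e unfolding adj_def by blast
  qed
  have sym: "adj Z A" "adj A Z" "adj Z B" "adj B Z" "adj X3 Z" using Z Z3 adj_sym by auto
  have h3: "heavy X3 Z" using X3(6) cyc_le by (auto simp: heavy_def)
  have bad
  proof (cases "heavy A Z"; cases "heavy B Z")
    assume "heavy A Z" "heavy B Z"
    then show ?thesis using bad_P2[OF Z'(2) cA cB X3(4)] dZ d sym h3 by simp
  next
    assume "\<not> heavy A Z" "heavy B Z"
    then show ?thesis using bad_R4[OF Z'(2) cA cB C(3)] key[of A B] dZ d sym ZC C(5) by simp
  next
    assume "heavy A Z" "\<not> heavy B Z"
    then show ?thesis using bad_R4[OF Z'(2) cB cA C(3)] key[of B A] dZ d sym ZC C(5) by (simp add: Int_commute)
  next
    assume "\<not> heavy A Z" "\<not> heavy B Z"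
    then show ?thesis using bad_R4_diamond[OF Z'(2) cA cB C(3)] key[of A B] key[of B A] dZ d sym ZC C(5) by simp
  qed
  then show False using not_bad by simp
qed

end

section \<open>Three pairwise incomparable pieces\<close>

context good_graph
begin

text \<open>The sets \<open>A\<close>, \<open>B\<close>, \<open>C\<close> play the role of complements of three pairwise incomparable pieces.\<close>

definition tripod :: "'b set \<Rightarrow> 'b set \<Rightarrow> 'b set \<Rightarrow> bool" where
  "tripod A B C \<longleftrightarrow> A \<subseteq> V \<and> B \<subseteq> V \<and> C \<subseteq> V \<and> conn A \<and> conn B \<and> conn C \<and>
     A \<inter> B = {} \<and> A \<inter> C = {} \<and> B \<inter> C = {} \<and> \<not> adj A B \<and> \<not> adj A C \<and> \<not> adj B C \<and>
     conn (V - A) \<and> conn (V - B) \<and> conn (V - C) \<and> deg2 (V - A) \<and> deg2 (V - B) \<and> deg2 (V - C) \<and>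
     cyc (V - A) 2 \<and> cyc (V - B) 2 \<and> cyc (V - C) 2"

lemma tripod_swap: "tripod A B C \<Longrightarrow> tripod B A C" "tripod A B C \<Longrightarrow> tripod A C B"
  unfolding tripod_def by (auto simp: Int_commute adj_sym)

lemma tripodD:
  assumes "tripod A B C"
  shows "A \<subseteq> V" "B \<subseteq> V" "C \<subseteq> V" "conn A" "conn B" "conn C"
    "A \<inter> B = {}" "A \<inter> C = {}" "B \<inter> C = {}" "\<not> adj A B" "\<not> adj A C" "\<not> adj B C"
    "conn (V - A)" "conn (V - B)" "conn (V - C)" "deg2 (V - A)" "deg2 (V - B)" "deg2 (V - C)"
    "cyc (V - A) 2" "cyc (V - B) 2" "cyc (V - C) 2"
  using assms unfolding tripod_def by simp_all

text \<open>Read inside \<open>V - B\<close>, which has minimum degree two: there the edges leaving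
  \<open>D\<close> can only go to \<open>A\<close>.\<close>

lemma tripod_comp_heavy:
  assumes t: "tripod A B C" and D: "comp (V - (A \<union> B \<union> C)) D" and n: "\<not> adj D C"
  shows "heavy D A"
proof -
  note T = tripodD[OF t]
  have D': "D \<subseteq> V - (A \<union> B \<union> C)" "\<not> adj D (V - (A \<union> B \<union> C) - D)" using D by (auto simp: comp_def)
  have "heavy D (V - B - D)" using heavy_deg2[OF T(17), of D] D'(1) finV by auto
  moreover have "V - B - D \<subseteq> A \<union> (C \<union> (V - (A \<union> B \<union> C) - D))" by blast
  moreover have "\<not> adj D (C \<union> (V - (A \<union> B \<union> C) - D))" using n D'(2) by (simp add: adj_Un)
  ultimately show ?thesis by (rule heavy_reduce)
qed

lemma tripod_comp_adj:
  assumes t: "tripod A B C" and D: "comp (V - (A \<union> B \<union> C)) D" and n: "\<not> adj D C"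
  shows "adj D A"
proof -
  note T = tripodD[OF t]
  have D': "D \<subseteq> V - (A \<union> B \<union> C)" "conn D" "\<not> adj D (V - (A \<union> B \<union> C) - D)" using D by (auto simp: comp_def)
  have "D \<noteq> V - B" using D'(1) T(1,7) conn_nonempty[OF T(4)] by blast
  then have "adj D (V - B - D)" using connD[OF T(14), of D] D'(1) conn_nonempty[OF D'(2)] by blast
  moreover have "V - B - D \<subseteq> A \<union> (C \<union> (V - (A \<union> B \<union> C) - D))" by blast
  moreover have "\<not> adj D (C \<union> (V - (A \<union> B \<union> C) - D))" using n D'(3) by (simp add: adj_Un)
  ultimately show ?thesis by (rule adj_reduce)
qed

text \<open>\<open>Z\<close> touches all three sets but \<open>D\<close> only \<open>A\<close> and
  \<open>B\<close>, so \<open>A\<close>, \<open>Z\<close>, \<open>B\<close>, \<open>D\<close> form a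
  four-cycle. The set \<open>M\<close>, which is \<open>C\<close> with everything attached to it
  outside \<open>Z\<close> and \<open>D\<close>, is a further arm at \<open>Z\<close>. Whether
  \<open>D\<close> has a surplus edge and which half of \<open>dich\<close> holds decide the
  minor.\<close>

lemma tripod_mixed:
  assumes t: "tripod A B C" and J: "J = V - (A \<union> B \<union> C)"
    and Z: "comp J Z" "adj Z A" "adj Z B" "adj Z C" and D: "comp J D" "\<not> adj D C"
  shows False
proof -
  note T = tripodD[OF t]
  have Z': "Z \<subseteq> J" "conn Z" "\<not> adj Z (J - Z)" using Z by (auto simp: comp_def)
  have D': "D \<subseteq> J" "conn D" "\<not> adj D (J - D)" using D by (auto simp: comp_def)
  have "Z \<noteq> D" using Z(4) D(2) by blast
  then have ZD: "Z \<inter> D = {}" using comp_disjoint[OF Z(1) D(1)] by blast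
  have hA: "heavy D A" "adj D A" using tripod_comp_heavy[OF t] tripod_comp_adj[OF t] D J by auto
  have "B \<union> A \<union> C = A \<union> B \<union> C" by blast
  then have hB: "heavy D B" "adj D B"
    using tripod_comp_heavy[OF tripod_swap(1)[OF t], of D] tripod_comp_adj[OF tripod_swap(1)[OF t], of D] D J by auto
  define S where "S = C \<union> (J - Z - D)"
  have finS: "finite S" unfolding S_def J using finV conn_finite[OF T(6)] by simp
  obtain M where M: "C \<subseteq> M" "M \<subseteq> S" "conn M" "\<not> adj M (S - M)"
    using conn_maximal[OF finS T(6)] unfolding S_def by blast
  have dis: "Z \<inter> A = {}" "Z \<inter> B = {}" "Z \<inter> M = {}" "D \<inter> A = {}" "D \<inter> B = {}" "D \<inter> M = {}" "A \<inter> M = {}" "B \<inter> M = {}"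
    using Z'(1) D'(1) M(2) T(8,9) ZD unfolding J S_def by auto
  have MZ: "adj Z M" "adj M Z" using Z(4) M(1) adj_mono[of Z C Z M] adj_sym by blast+
  have "\<not> adj D (C \<union> (J - D))" using D(2) D'(3) by (simp add: adj_Un)
  then have nMD: "\<not> adj M D" using M(2) adj_mono[of D M D "C \<union> (J - D)"] adj_sym unfolding S_def by blast
  have hM: "heavy M Z" if Y: "deg2 (V - Y')" "\<not> adj M Y" "(Y = A \<and> Y' = B) \<or> (Y = B \<and> Y' = A)" for Y Y'
  proof -
    have "M \<subseteq> V - Y'" using M(2) T(3,8,9) Y(3) unfolding S_def J by auto
    then have "heavy M (V - Y' - M)" using heavy_deg2[OF Y(1)] finV by auto
    moreover have "V - Y' - M \<subseteq> Z \<union> (Y \<union> D \<union> (S - M))" using Y(3) unfolding S_def J by auto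
    moreover have "\<not> adj M (Y \<union> D \<union> (S - M))" using Y(2) nMD M(4) by (simp add: adj_Un)
    ultimately show ?thesis by (rule heavy_reduce)
  qed
  \<comment> \<open>If \<open>M\<close> misses one of \<open>A\<close> and \<open>B\<close>, then
    minimum degree two in the complement of the other one gives \<open>M\<close> a surplus edge or
    two edges to \<open>Z\<close>.\<close>
  have dich: "heavy M Z \<or> (adj M A \<and> adj M B)" using hM[of B A] hM[of A B] T(16,17) by blast
  define N' where "N' = Z \<union> M"
  have cN: "conn N'" using conn_Un[OF Z'(2) M(3)] MZ by (simp add: N'_def)
  have dN: "N' \<inter> A = {}" "N' \<inter> B = {}" "N' \<inter> D = {}" using dis ZD by (auto simp: N'_def)
  have aN: "adj N' A" "adj N' B" using Z by (simp_all add: N'_def adj_Un2)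
  have two: "2 \<le> ec Y N'" if "adj M Y" "adj Z Y" "Y \<inter> Z = {}" "Y \<inter> M = {}" for Y
    using that dis(3) by (intro ec_two[of Y Z M]) (auto simp: N'_def adj_sym)
  have bad
  proof (cases "cyc D 1")
    case cD: True
    from dich show ?thesis
    proof
      assume "heavy M Z"
      then show ?thesis
        using bad_P2_C4[OF Z'(2) D'(2) T(4,5) M(3)] ZD dis T(7) Z(2,3) hA(2) hB(2) MZ(1) cD by simp
    next
      assume MA: "adj M A \<and> adj M B"
      have "heavy A N'" using two[of A] MA Z dis by (simp add: heavy_def Int_commute)
      then have w: "conn (A \<union> N')" "cyc (A \<union> N') 1"
        using conn_Un[OF T(4) cN] cyc_heavy[of A N'] T(4) cN aN dN adj_sym by (auto simp: Int_commute)
      have "2 \<le> ec B N'" using two[of B] MA Z dis by (simp add: Int_commute)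
      then have "heavy B (A \<union> N')" using ec_mono[of B B N' "A \<union> N'"] by (simp add: heavy_def)
      moreover have "heavy D (A \<union> N')" using cD by (simp add: heavy_def)
      ultimately show ?thesis
        by (intro bad_A3[OF D'(2) T(5) w(1) _ _ _ _ _ _ w(2)])
          (use dis dN T(7) hA(2) hB(2) aN adj_sym in \<open>auto simp: adj_Un\<close>)
    qed
  next
    case False
    then have e: "2 \<le> ec D A" "2 \<le> ec D B" using hA hB by (auto simp: heavy_def)
    have w: "conn (D \<union> A)" "cyc (D \<union> A) 1"
      using conn_Un[OF D'(2) T(4)] cyc_heavy[OF hA(1) D'(2) T(4) hA(2)] dis hA(2) by auto
    have "heavy B (D \<union> A)" using e(2) ec_mono[of B B D "D \<union> A"] by (simp add: heavy_def ec_sym[of B])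
    moreover have "heavy N' (D \<union> A)"
      using dich
    proof
      assume h: "heavy M Z"
      then have "cyc (M \<union> Z) 1" using cyc_heavy[OF h M(3) Z'(2) MZ(2)] dis by (simp add: Int_commute)
      then show ?thesis by (simp add: heavy_def N'_def Un_commute)
    next
      assume "adj M A \<and> adj M B"
      then have "2 \<le> ec A N'" using two[of A] Z dis by (simp add: Int_commute)
      then show ?thesis using ec_mono[of N' N' A "D \<union> A"] by (simp add: heavy_def ec_sym[of _ A])
    qed
    ultimately show ?thesis
      by (intro bad_A3[OF T(5) cN w(1) _ _ _ _ _ _ w(2)])
        (use dis dN T(7) hA(2) hB(2) aN adj_sym in \<open>auto simp: adj_Un\<close>)
  qed
  then show False using not_bad by simp
qed

text \<open>\<open>Z\<close> and \<open>Z'\<close> are two centres with the common arms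
  \<open>P\<close>, \<open>Q\<close>, \<open>W\<close>. If \<open>P\<close> and \<open>Q\<close> are
  heavy towards the same centre, merging it with \<open>P\<close> and \<open>W\<close> gives the
  apex of a triangle for \<open>bad_A3\<close>; if they are heavy only towards different centres,
  \<open>bad_S1\<close> applies.\<close>

lemma two_heavy:
  assumes c: "conn Z" "conn Z'" "Z \<inter> Z' = {}" "conn P" "conn Q" "conn W"
    and d: "P \<inter> Q = {}" "P \<inter> W = {}" "Q \<inter> W = {}"
      "Z \<inter> P = {}" "Z \<inter> Q = {}" "Z \<inter> W = {}" "Z' \<inter> P = {}" "Z' \<inter> Q = {}" "Z' \<inter> W = {}"
    and a: "adj Z P" "adj Z Q" "adj Z W" "adj Z' P" "adj Z' Q" "adj Z' W"
    and h: "heavy P Z \<or> heavy P Z'" "heavy Q Z \<or> heavy Q Z'"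
  shows bad
proof -
  have same: bad if c: "conn Z" "conn Z'" and d: "Z \<inter> Z' = {}"
      "Z \<inter> P = {}" "Z \<inter> Q = {}" "Z \<inter> W = {}" "Z' \<inter> P = {}" "Z' \<inter> Q = {}" "Z' \<inter> W = {}"
    and a: "adj Z P" "adj Z Q" "adj Z W" "adj Z' P" "adj Z' Q" "adj Z' W"
    and h: "heavy P Z" "heavy Q Z" for Z Z'
  proof -
    have s: "adj P Z" "adj Q Z" using a adj_sym by blast+
    have c1: "conn (P \<union> Z)" "cyc (P \<union> Z) 1"
      using conn_Un[OF assms(4) c(1)] cyc_heavy[OF h(1) assms(4) c(1)] s d by (auto simp: Int_commute)
    have c2: "conn (P \<union> Z \<union> W)" using conn_Un[OF c1(1) assms(6)] a by (simp add: adj_Un2)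
    have c3: "cyc (P \<union> Z \<union> W) 1" by (rule cyc_mono[OF c2 _ conn_nonempty[OF c1(1)] c1(2)]) auto
    have "heavy Q (P \<union> Z \<union> W)"
      by (rule heavy_mono[OF h(2) subset_refl _ assms(5) conn_nonempty[OF assms(5)]]) auto
    moreover have "2 \<le> ec Z' (P \<union> Z \<union> W)" using a d assms(8) by (intro ec_two[of Z' P W]) auto
    moreover have "adj Q Z'" using a adj_sym by blast
    ultimately show bad
      by (intro bad_A3[OF assms(5) c(2) c2 _ _ _ _ _ _ c3])
        (use d assms(7,9) a s in \<open>auto simp: heavy_def adj_Un\<close>)
  qed
  have opp: bad if c: "conn Z" "conn Z'" and d: "Z \<inter> Z' = {}"
      "Z \<inter> P = {}" "Z \<inter> Q = {}" "Z \<inter> W = {}" "Z' \<inter> P = {}" "Z' \<inter> Q = {}" "Z' \<inter> W = {}"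
    and a: "adj Z P" "adj Z Q" "adj Z W" "adj Z' P" "adj Z' Q" "adj Z' W"
    and h: "heavy P Z" "\<not> heavy P Z'" "heavy Q Z'" "\<not> heavy Q Z" for Z Z'
    using bad_S1[OF c(1,2) assms(4,5,6) d] assms(7,8,9) a h by (auto simp: heavy_def ec_sym[of Z] ec_sym[of Z'])
  have d': "Z' \<inter> Z = {}" using assms(3) by blast
  consider "heavy P Z" "heavy Q Z" | "heavy P Z'" "heavy Q Z'"
    | "heavy P Z" "\<not> heavy P Z'" "heavy Q Z'" "\<not> heavy Q Z"
    | "heavy P Z'" "\<not> heavy P Z" "heavy Q Z" "\<not> heavy Q Z'" using h by blast
  then show ?thesis
  proof cases
    case 1
    then show ?thesis using same[OF c(1,2)] c(3) d a by simp
  next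
    case 2
    then show ?thesis using same[OF c(2,1) d'] d a by simp
  next
    case 3
    then show ?thesis using opp[OF c(1,2)] c(3) d a by simp
  next
    case 4
    then show ?thesis using opp[OF c(2,1) d'] d a by simp
  qed
qed

text \<open>The cases follow the components of \<open>J\<close>, the part common to the three
  complements. If none touches all of \<open>A\<close>, \<open>B\<close>, \<open>C\<close>, three
  links give a triangle with a surplus edge at each corner. Otherwise, by
  \<open>tripod_mixed\<close>, every component touches all three: a single one gives
  \<open>bad_P2\<close>, three or more give \<open>bad_A3\<close>, and two are the centres in
  \<open>bad_P2_K23\<close> or \<open>two_heavy\<close>.\<close>

lemma no_tripod: "\<not> tripod A B C"
proof
  assume t: "tripod A B C"
  note T = tripodD[OF t]
  define J where "J = V - (A \<union> B \<union> C)"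
  have Jp: "J = V - (B \<union> A \<union> C)" "J = V - (A \<union> C \<union> B)" "J = V - (C \<union> A \<union> B)" "J = V - (B \<union> C \<union> A)" "J = V - (C \<union> B \<union> A)"
    by (auto simp: J_def)
  have tp: "tripod B A C" "tripod A C B" "tripod C A B" "tripod B C A" "tripod C B A"
    using t tripod_swap by blast+
  have finJ: "finite J" using finV by (simp add: J_def)
  have sub: "D \<subseteq> J" "conn D" if "comp J D" for D using that by (auto simp: comp_def)
  have dJ: "A \<inter> J = {}" "B \<inter> J = {}" "C \<inter> J = {}" by (auto simp: J_def)
  show False
  proof (cases "\<exists>Z. comp J Z \<and> adj Z A \<and> adj Z B \<and> adj Z C")
    case no: False
    have lk: "\<exists>D. comp J D \<and> adj D Y \<and> adj D Y'"
      if "tripod Y Y' W" "J = V - (Y \<union> Y' \<union> W)" for Y Y' W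
    proof -
      note S = tripodD[OF that(1)]
      have "\<exists>D. link J Y Y' D"
        using link_exists[OF S(4) conn_nonempty[OF S(5)] S(15) _ _ S(7) that(2)] S by blast
      then show ?thesis using S(10) by (auto simp: link_def)
    qed
    obtain D1 where D1: "comp J D1" "adj D1 A" "adj D1 B" using lk[OF t J_def] by blast
    obtain D2 where D2: "comp J D2" "adj D2 B" "adj D2 C" using lk[OF tp(4) Jp(4)] by blast
    obtain D3 where D3: "comp J D3" "adj D3 C" "adj D3 A" using lk[OF tp(3) Jp(3)] by blast
    have n: "\<not> adj D1 C" "\<not> adj D2 A" "\<not> adj D3 B" using no D1 D2 D3 by blast+
    have dis: "D1 \<inter> D2 = {}" "D1 \<inter> D3 = {}" "D2 \<inter> D3 = {}"
      using n comp_disjoint D1 D2 D3 by blast+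
    have h: "heavy D1 A" "heavy D2 B" "heavy D3 C"
      using tripod_comp_heavy[OF t] tripod_comp_heavy[OF tp(4)] tripod_comp_heavy[OF tp(3)] D1 D2 D3 n Jp J_def by auto
    have c: "conn (D1 \<union> A)" "conn (D2 \<union> B)" "conn (D3 \<union> C)"
      using conn_Un[OF sub(2)[OF D1(1)] T(4)] conn_Un[OF sub(2)[OF D2(1)] T(5)]
        conn_Un[OF sub(2)[OF D3(1)] T(6)] D1 D2 D3 by simp_all
    have d: "D1 \<inter> A = {}" "D2 \<inter> B = {}" "D3 \<inter> C = {}" using sub(1) D1(1) D2(1) D3(1) dJ by blast+
    have cy: "cyc (D1 \<union> A) 1" "cyc (D2 \<union> B) 1" "cyc (D3 \<union> C) 1"
      using cyc_heavy[OF h(1) sub(2)[OF D1(1)] T(4) D1(2) d(1)]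
        cyc_heavy[OF h(2) sub(2)[OF D2(1)] T(5) D2(2) d(2)]
        cyc_heavy[OF h(3) sub(2)[OF D3(1)] T(6) D3(2) d(3)] by simp_all
    have dd: "(D1 \<union> A) \<inter> (D2 \<union> B) = {}" "(D1 \<union> A) \<inter> (D3 \<union> C) = {}" "(D2 \<union> B) \<inter> (D3 \<union> C) = {}"
    proof -
      note sb = sub(1)[OF D1(1)] sub(1)[OF D2(1)] sub(1)[OF D3(1)]
      show "(D1 \<union> A) \<inter> (D2 \<union> B) = {}" using sb(1,2) dJ(1,2) dis(1) T(7) by blast
      show "(D1 \<union> A) \<inter> (D3 \<union> C) = {}" using sb(1,3) dJ(1,3) dis(2) T(8) by blast
      show "(D2 \<union> B) \<inter> (D3 \<union> C) = {}" using sb(2,3) dJ(2,3) dis(3) T(9) by blast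
    qed
    have "adj (D1 \<union> A) (D2 \<union> B)" "adj (D1 \<union> A) (D3 \<union> C)" "adj (D2 \<union> B) (D3 \<union> C)"
      using D1(3) D3(3) D2(3) adj_sym by (auto simp: adj_Un adj_Un2)
    then have bad using bad_A3[OF c dd] cy by (simp add: heavy_def)
    then show False using not_bad by simp
  next
    case True
    then obtain Z where Z: "comp J Z" "adj Z A" "adj Z B" "adj Z C" by blast
    have all: "adj D A" "adj D B" "adj D C" if "comp J D" for D
      using tripod_mixed[OF t J_def Z that] tripod_mixed[OF tp(2) Jp(2) Z(1,2,4,3) that]
        tripod_mixed[OF tp(4) Jp(4) Z(1,3,4,2) that] by blast+
    have Z': "Z \<subseteq> J" "conn Z" "\<not> adj Z (J - Z)" using Z by (auto simp: comp_def)
    have dZ: "Z \<inter> A = {}" "Z \<inter> B = {}" "Z \<inter> C = {}" using Z'(1) dJ by blast+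
    have bad
    proof (cases "J = Z")
      case JZ: True
      have hv: "heavy Y Z" if "tripod Y Y' W" "J = V - (Y \<union> Y' \<union> W)" for Y Y' W
      proof -
        note S = tripodD[OF that(1)]
        have "heavy Y (V - Y)" using heavy_deg2[OF deg2_V S(1) finV] .
        moreover have "V - Y \<subseteq> Z \<union> (Y' \<union> W)" using that(2) JZ S(2,3) by blast
        moreover have "\<not> adj Y (Y' \<union> W)" using S(10,11) by (simp add: adj_Un)
        ultimately show ?thesis by (rule heavy_reduce)
      qed
      show ?thesis
        using bad_P2[OF Z'(2) T(4,5,6) dZ T(7,8,9)] Z hv[OF t J_def] hv[OF tp(1) Jp(1)] hv[OF tp(3) Jp(3)] adj_sym by blast
    next
      case False
      then obtain x where x: "x \<in> J" "x \<notin> Z" using Z'(1) by blast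
      obtain Z2 where Z2: "comp J Z2" "x \<in> Z2" using comp_exists[OF finJ x(1)] by blast
      have ZZ: "Z \<inter> Z2 = {}" using comp_disjoint[OF Z(1) Z2(1)] Z2(2) x(2) by blast
      note a2 = all[OF Z2(1)]
      have c2: "conn Z2" "Z2 \<subseteq> J" using sub[OF Z2(1)] by auto
      have d2: "Z2 \<inter> A = {}" "Z2 \<inter> B = {}" "Z2 \<inter> C = {}" using c2(2) dJ by blast+
      show ?thesis
      proof (cases "J = Z \<union> Z2")
        case False
        then obtain y where y: "y \<in> J" "y \<notin> Z" "y \<notin> Z2" using Z'(1) c2(2) by blast
        obtain Z3 where Z3: "comp J Z3" "y \<in> Z3" using comp_exists[OF finJ y(1)] by blast
        have Z3d: "Z \<inter> Z3 = {}" "Z2 \<inter> Z3 = {}"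
          using comp_disjoint[OF Z(1) Z3(1)] comp_disjoint[OF Z2(1) Z3(1)] Z3(2) y by blast+
        note a3 = all[OF Z3(1)]
        have c3: "conn Z3" "Z3 \<subseteq> J" using sub[OF Z3(1)] by auto
        have d3: "Z3 \<inter> A = {}" "Z3 \<inter> B = {}" "Z3 \<inter> C = {}" using c3(2) dJ by blast+
        define U where "U = A \<union> Z3 \<union> B"
        have cU: "conn U"
        proof -
          have "adj A Z3" using a3 adj_sym by blast
          then have "conn (A \<union> Z3)" using conn_Un[OF T(4) c3(1)] by blast
          then show ?thesis unfolding U_def by (rule conn_Un[OF _ T(5)]) (simp add: adj_Un2 a3)
        qed
        have "2 \<le> ec Z U" using Z dZ T(7) by (intro ec_two[of Z A B]) (auto simp: U_def)
        then have hZ: "heavy Z U" by (simp add: heavy_def)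
        have ZU: "Z \<inter> U = {}" "adj Z U" using dZ Z3d Z by (auto simp: U_def adj_Un)
        have w: "conn (Z \<union> U)" "cyc (Z \<union> U) 1"
          using conn_Un[OF Z'(2) cU] cyc_heavy[OF hZ Z'(2) cU] ZU by auto
        have CZ: "adj C Z" "adj C Z3" "adj C Z2" using Z a2 a3 adj_sym by blast+
        have "2 \<le> ec C (Z \<union> U)" using CZ dZ d3 Z3d by (intro ec_two[of C Z Z3]) (auto simp: U_def)
        moreover have "2 \<le> ec Z2 (Z \<union> U)" using a2 d2 T(7) by (intro ec_two[of Z2 A B]) (auto simp: U_def)
        ultimately show ?thesis
          by (intro bad_A3[OF T(6) c2(1) w(1) _ _ _ _ _ _ w(2)])
            (use d2 dZ d3 T(8,9) ZZ Z3d CZ a2 in \<open>auto simp: U_def heavy_def adj_Un\<close>)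
      next
        case J2: True
        show ?thesis
        proof (cases "cyc Z 1 \<or> cyc Z2 1")
          case True
          then show ?thesis
          proof
            assume "cyc Z 1"
            then show ?thesis using bad_P2_K23[OF Z'(2) c2(1) T(4,5,6) ZZ dZ d2 T(7,8,9)] Z a2 by simp
          next
            assume "cyc Z2 1"
            then show ?thesis using bad_P2_K23[OF c2(1) Z'(2) T(4,5,6) _ d2 dZ T(7,8,9)] Z a2 ZZ
              by (simp add: Int_commute)
          qed
        next
          case nc: False
          have nZZ: "\<not> adj Z Z2" using Z'(3) J2 ZZ adj_mono[of Z Z2 Z "J - Z"] by blast
          \<comment> \<open>Four trees joined by at most four edges have surplus at most one, but
            \<open>V - X\<close> has surplus two. So among any two of the three sets one is heavy,
            which makes at least two of the three heavy.\<close>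
          have one: "heavy Y Z \<or> heavy Y Z2 \<or> heavy W Z \<or> heavy W Z2"
            if "tripod X Y W" "J = V - (X \<union> Y \<union> W)" for X Y W
          proof (rule ccontr)
            assume n: "\<not> ?thesis"
            note S = tripodD[OF that(1)]
            have d: "Y \<inter> J = {}" "W \<inter> J = {}" using that(2) by auto
            have e: "V - X = (Y \<union> W) \<union> (Z \<union> Z2)" using that(2) J2 S by blast
            have "ec Y W = 0" "ec Z Z2 = 0" using S(12) nZZ by (simp_all add: adj_ec)
            then have 1: "es (Y \<union> W) = es Y + es W" "es (Z \<union> Z2) = es Z + es Z2"
              using es_Un[OF S(9)] es_Un[OF ZZ] by auto
            have dd: "(Y \<union> W) \<inter> (Z \<union> Z2) = {}" using d J2 by blast
            have "ec (Y \<union> W) (Z \<union> Z2) = ec Y (Z \<union> Z2) + ec W (Z \<union> Z2)"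
              using dd S(9) by (intro ec_Un) auto
            also have "ec Y (Z \<union> Z2) = ec Y Z + ec Y Z2"
              using ec_Un[of Z Z2 Y] ZZ d J2 by (auto simp: ec_sym[of Y])
            also have "ec W (Z \<union> Z2) = ec W Z + ec W Z2"
              using ec_Un[of Z Z2 W] ZZ d J2 by (auto simp: ec_sym[of W])
            finally have 2: "ec (Y \<union> W) (Z \<union> Z2) \<le> 4" using n by (auto simp: heavy_def)
            have fin: "finite Y" "finite W" "finite Z" "finite Z2" using conn_finite S Z'(2) c2(1) by auto
            have "card (V - X) = card Y + card W + (card Z + card Z2)"
              unfolding e using fin dd S(9) ZZ by (simp add: card_Un_disjoint)
            moreover have "es (V - X) = es Y + es W + (es Z + es Z2) + ec (Y \<union> W) (Z \<union> Z2)"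
              unfolding e using es_Un[OF dd] 1 by simp
            moreover have "es Y + 1 \<le> card Y" "es W + 1 \<le> card W" "es Z + 1 \<le> card Z" "es Z2 + 1 \<le> card Z2"
              using n nc by (auto simp: heavy_def cyc_def)
            ultimately show False using S(19) 2 by (simp add: cyc_def)
          qed
          note p = two_heavy[OF Z'(2) c2(1) ZZ]
          have "bad" if "heavy A Z \<or> heavy A Z2" "heavy B Z \<or> heavy B Z2"
            using p[OF T(4,5,6,7,8,9)] dZ d2 Z a2 that by simp
          moreover have "bad" if "heavy A Z \<or> heavy A Z2" "heavy C Z \<or> heavy C Z2"
            using p[OF T(4,6,5,8,7)] dZ d2 Z a2 that T(9) by (simp add: Int_commute)
          moreover have "bad" if "heavy B Z \<or> heavy B Z2" "heavy C Z \<or> heavy C Z2"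
            using p[OF T(5,6,4,9)] dZ d2 Z a2 that T(7,8) by (simp add: Int_commute)
          ultimately show ?thesis
            using one[OF t J_def] one[OF tp(1) Jp(1)] one[OF tp(3) Jp(3)] by blast
        qed
      qed
    qed
    then show False using not_bad by simp
  qed
qed

text \<open>The third piece must also meet each of the other two in a single vertex and cover
  \<open>V\<close> with it. This leaves two vertices in every piece, and surplus two on two vertices
  without loops means three parallel edges: the graph contains a tripled triangle.\<close>

lemma no_antichain_point:
  assumes p: "piece X1 v1" "piece X2 v2" "piece X3 v3"
    and inc: "\<not> X1 \<subseteq> X2" "\<not> X2 \<subseteq> X1" "\<not> X1 \<subseteq> X3" "\<not> X3 \<subseteq> X1" "\<not> X2 \<subseteq> X3" "\<not> X3 \<subseteq> X2"
    and V: "V = X1 \<union> X2" and z: "X1 \<inter> X2 = {z}" and no: "\<And>e. e \<in> E \<Longrightarrow> \<not> N e \<subseteq> X1 \<inter> X2"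
  shows False
proof -
  note X1 = pieceD[OF p(1)] and X2 = pieceD[OF p(2)] and X3 = pieceD[OF p(3)]
  have step: "V = Y \<union> X3 \<and> (\<exists>z'. Y \<inter> X3 = {z'}) \<and> (\<forall>e\<in>E. \<not> N e \<subseteq> Y \<inter> X3)"
    if Y: "(Y = X1 \<and> Y' = X2 \<and> v = v1 \<and> v' = v2) \<or> (Y = X2 \<and> Y' = X1 \<and> v = v2 \<and> v' = v1)" for Y Y' v v'
  proof -
    have y: "piece Y v" "piece Y' v'" "\<not> Y \<subseteq> Y'" "\<not> Y' \<subseteq> Y" "\<not> Y \<subseteq> X3" "\<not> X3 \<subseteq> Y" "\<not> Y' \<subseteq> X3" "\<not> X3 \<subseteq> Y'"
        "V = Y \<union> Y'" "Y \<inter> Y' = {z}"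
      using Y p inc V z by auto
    have y11: "\<not> N e \<subseteq> Y \<inter> Y'" if "e \<in> E" for e using no[OF that] Y by (auto simp: Int_commute)
    have "X3 \<subseteq> Y \<union> Y'" using X3(1) y(9) by simp
    then have "Y \<inter> X3 \<noteq> {}" using y(8) by auto
    moreover have "\<not> (V = Y \<union> X3 \<and> \<not> adj (V - Y) (V - X3))"
    proof
      assume a: "V = Y \<union> X3 \<and> \<not> adj (V - Y) (V - X3)"
      have "2 \<le> ec {z} (Y' - Y)" using crossing_no_edge(3)[OF y(1,2,3,4) _ y11] y(10) by blast
      then have "adj {z} (Y' - Y)" by (simp add: adj_ec)
      then have "adj {z} (V - Y)" using adj_mono[of "{z}" "Y' - Y" "{z}" "V - Y"] y(9) by blast
      then have z: "z \<in> X3"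
        using a adj_mono[of "V - Y" "{z}" "V - Y" "V - X3"] adj_sym[of "{z}"] y(9,10) by blast
      have "Y' \<subseteq> V" "Y' \<inter> Y \<subseteq> {z}" using y(9,10) by auto
      then have "Y' \<subseteq> X3" using a z by blast
      then show False using y(7) by simp
    qed
    ultimately show ?thesis using pair_cases[OF y(1) p(3) y(5,6)] by argo
  qed
  have st: "V = X1 \<union> X3 \<and> (\<exists>z'. X1 \<inter> X3 = {z'}) \<and> (\<forall>e\<in>E. \<not> N e \<subseteq> X1 \<inter> X3)"
    "V = X2 \<union> X3 \<and> (\<exists>z'. X2 \<inter> X3 = {z'}) \<and> (\<forall>e\<in>E. \<not> N e \<subseteq> X2 \<inter> X3)"
    using step[of X1 X2 v1 v2] step[of X2 X1 v2 v1] by simp_all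
  obtain z1 where z1: "V = X1 \<union> X3" "X1 \<inter> X3 = {z1}" "\<And>e. e \<in> E \<Longrightarrow> \<not> N e \<subseteq> X1 \<inter> X3"
    using st(1) by (elim conjE exE) blast
  obtain z2 where z2: "V = X2 \<union> X3" "X2 \<inter> X3 = {z2}" "\<And>e. e \<in> E \<Longrightarrow> \<not> N e \<subseteq> X2 \<inter> X3"
    using st(2) by (elim conjE exE) blast
  have "X1 - X2 \<subseteq> X1 \<inter> X3" "X2 - X1 \<subseteq> X2 \<inter> X3" using X1(1) X2(1) z1(1) z2(1) by blast+
  then have sub: "X1 - X2 \<subseteq> {z1}" "X2 - X1 \<subseteq> {z2}" using z1(2) z2(2) by simp_all
  have mem: "z1 \<in> X1" "z2 \<in> X2" "z \<in> X1" "z \<in> X2" using z z1(2) z2(2) by auto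
  have "X1 = (X1 \<inter> X2) \<union> (X1 - X2)" "X2 = (X1 \<inter> X2) \<union> (X2 - X1)" by blast+
  then have eq: "X1 = {z, z1}" "X2 = {z, z2}" using sub mem z by auto
  have ne: "z \<noteq> z1" "z \<noteq> z2" "z1 \<noteq> z2" using eq inc(1,2) by auto
  have "X3 \<subseteq> {z, z1, z2}" using X3(1) V eq by auto
  moreover have "z1 \<in> X3" "z2 \<in> X3" "z \<notin> X3" using z1(2) z2(2) eq ne by auto
  ultimately have X3_eq: "X3 = {z1, z2}" by auto
  have single: "es {x} = 0" if "{x} = X1 \<inter> X2 \<or> {x} = X1 \<inter> X3 \<or> {x} = X2 \<inter> X3" for x
    using that no z1(3) z2(3) finE by (auto simp: es_def)
  have three: "3 \<le> ec {x} {y}" if "cyc {x, y} 2" "x \<noteq> y" "es {x} = 0" "es {y} = 0" for x y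
  proof -
    have "es ({x} \<union> {y}) = ec {x} {y}" using es_Un[of "{x}" "{y}"] that by simp
    then have "es {x, y} = ec {x} {y}" by (simp add: insert_commute)
    then show ?thesis using that(1,2) by (simp add: cyc_def)
  qed
  have s: "es {z} = 0" "es {z1} = 0" "es {z2} = 0" using single z z1(2) z2(2) by auto
  have "3 \<le> ec {z} {z1}" "3 \<le> ec {z} {z2}" "3 \<le> ec {z1} {z2}"
    using three X1(6) X2(6) X3(6) eq X3_eq ne s by auto
  then have bad using bad_3K3[of "{z}" "{z1}" "{z2}"] conn_singleton ne by auto
  then show False using not_bad by simp
qed

text \<open>If two pieces are disjoint, neither of them covers \<open>V\<close> together with the
  third, since the other would then lie in the third. So one disjoint pair makes all pairs disjoint,
  and \<open>triad\<close> gives \<open>bad_P2\<close> or a triangle with surplus at every corner.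
  Otherwise all pairs cover, and the complements form a tripod.\<close>

lemma no_antichain:
  assumes p: "piece X1 v1" "piece X2 v2" "piece X3 v3"
    and inc: "\<not> X1 \<subseteq> X2" "\<not> X2 \<subseteq> X1" "\<not> X1 \<subseteq> X3" "\<not> X3 \<subseteq> X1" "\<not> X2 \<subseteq> X3" "\<not> X3 \<subseteq> X2"
  shows False
proof -
  note X1 = pieceD[OF p(1)] and X2 = pieceD[OF p(2)] and X3 = pieceD[OF p(3)]
  have np: "\<not> (V = X1 \<union> X2 \<and> (\<exists>z. X1 \<inter> X2 = {z}) \<and> (\<forall>e\<in>E. \<not> N e \<subseteq> X1 \<inter> X2))"
    using no_antichain_point[OF p inc] by blast
  have np': "\<not> (V = X1 \<union> X3 \<and> (\<exists>z. X1 \<inter> X3 = {z}) \<and> (\<forall>e\<in>E. \<not> N e \<subseteq> X1 \<inter> X3))"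
    using no_antichain_point[OF p(1,3,2) inc(3,4,1,2,6,5)] by blast
  have np'': "\<not> (V = X2 \<union> X3 \<and> (\<exists>z. X2 \<inter> X3 = {z}) \<and> (\<forall>e\<in>E. \<not> N e \<subseteq> X2 \<inter> X3))"
    using no_antichain_point[OF p(2,3,1) inc(5,6,2,1,4,3)] by blast
  have c1: "X1 \<inter> X2 = {} \<or> (V = X1 \<union> X2 \<and> \<not> adj (V - X1) (V - X2))"
    using pair_cases[OF p(1,2) inc(1,2)] np by argo
  have c2: "X1 \<inter> X3 = {} \<or> (V = X1 \<union> X3 \<and> \<not> adj (V - X1) (V - X3))"
    using pair_cases[OF p(1,3) inc(3,4)] np' by argo
  have c3: "X2 \<inter> X3 = {} \<or> (V = X2 \<union> X3 \<and> \<not> adj (V - X2) (V - X3))"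
    using pair_cases[OF p(2,3) inc(5,6)] np'' by argo
  note c = c1 c2 c3
  show False
  proof (cases "X1 \<inter> X2 = {} \<or> X1 \<inter> X3 = {} \<or> X2 \<inter> X3 = {}")
    case True
    have s: False if "X \<inter> Y = {}" "V = X \<union> Z" "Y \<subseteq> V" "\<not> Y \<subseteq> Z" for X Y Z
      using that by blast
    have d: "X1 \<inter> X2 = {}" "X1 \<inter> X3 = {}" "X2 \<inter> X3 = {}"
      using True c1 c2 c3 s[of X1 X2 X3] s[of X2 X1 X3] s[of X1 X3 X2] s[of X3 X1 X2] s[of X2 X3 X1] s[of X3 X2 X1]
        inc X1(1) X2(1) X3(1) by (metis Int_commute Un_commute)+
    have h: "heavy X1 Y" "heavy X2 Y" "heavy X3 Y" for Y
      using cyc_le[OF X1(6), of 1] cyc_le[OF X2(6), of 1] cyc_le[OF X3(6), of 1] by (auto simp: heavy_def)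
    consider Z where "comp (V - (X1 \<union> X2 \<union> X3)) Z" "adj Z X1" "adj Z X2" "adj Z X3"
      | A B C where "X1 \<subseteq> A" "X2 \<subseteq> B" "X3 \<subseteq> C" "conn A" "conn B" "conn C" "A \<inter> B = {}" "A \<inter> C = {}" "B \<inter> C = {}"
        "adj A B" "adj A C" "adj B C"
      using triad[OF X1(4) X2(4) X3(4) conn_co_piece[OF p(1)] conn_co_piece[OF p(2)] conn_co_piece[OF p(3)]
          X1(1) X2(1) X3(1) d refl] by blast
    then have bad
    proof cases
      case 1
      have Z: "conn Z" "Z \<inter> X1 = {}" "Z \<inter> X2 = {}" "Z \<inter> X3 = {}" using 1(1) by (auto simp: comp_def)
      then show ?thesis using bad_P2[OF Z(1) X1(4) X2(4) X3(4)] d h 1 adj_sym by blast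
    next
      case 2
      have "cyc A 1" "cyc B 1" "cyc C 1"
        using cyc_mono[OF 2(4,1) conn_nonempty[OF X1(4)] cyc_le[OF X1(6)]]
          cyc_mono[OF 2(5,2) conn_nonempty[OF X2(4)] cyc_le[OF X2(6)]]
          cyc_mono[OF 2(6,3) conn_nonempty[OF X3(4)] cyc_le[OF X3(6)]] by auto
      then show ?thesis using bad_A3[OF 2(4-12)] by (simp add: heavy_def)
    qed
    then show False using not_bad by simp
  next
    case False
    then have V: "V = X1 \<union> X2" "V = X1 \<union> X3" "V = X2 \<union> X3" and
      n: "\<not> adj (V - X1) (V - X2)" "\<not> adj (V - X1) (V - X3)" "\<not> adj (V - X2) (V - X3)" using c by blast+
    have "V - (V - X1) = X1" "V - (V - X2) = X2" "V - (V - X3) = X3" using X1(1) X2(1) X3(1) by blast+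
    then have "tripod (V - X1) (V - X2) (V - X3)" unfolding tripod_def
      using n X1 X2 X3 conn_co_piece p V by auto
    then show False using no_tripod by blast
  qed
qed

end

section \<open>From pieces to a lattice path ordering\<close>

context mgraph
begin

text \<open>A smallest violator is connected, since otherwise one side of an uncrossed cut would
  violate; a vertex on a single edge could be removed with that edge; and more edges than vertices
  means surplus two over a spanning tree.\<close>

lemma minimal_dependent:
  assumes "X \<subseteq> E" "\<not> hall N X"
  shows "\<exists>D\<subseteq>X. card (\<Union>(N ` D)) < card D \<and> \<Union>(N ` D) \<subseteq> V \<and> conn (\<Union>(N ` D)) \<and> deg2 (\<Union>(N ` D)) \<and> cyc (\<Union>(N ` D)) 2"
proof -
  obtain D0 where "D0 \<subseteq> X \<and> card (\<Union>(N ` D0)) < card D0" using assms(2) by (auto simp: hall_def not_le)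
  from ex_has_least_nat[of "\<lambda>D. D \<subseteq> X \<and> card (\<Union>(N ` D)) < card D", OF this, of card]
  obtain D where D: "D \<subseteq> X" "card (\<Union>(N ` D)) < card D"
    and least: "\<And>D'. D' \<subseteq> X \<Longrightarrow> card (\<Union>(N ` D')) < card D' \<Longrightarrow> card D \<le> card D'" by auto
  define U where "U = \<Union>(N ` D)"
  have DE: "D \<subseteq> E" using D(1) assms(1) by blast
  have finD: "finite D" using DE finE finite_subset by blast
  have finU: "finite U" using finD DE N_finite by (auto simp: U_def)
  have small: "card D' \<le> card (\<Union>(N ` D'))" if "D' \<subset> D" for D'
  proof -
    have "card D' < card D" "D' \<subseteq> X" using psubset_card_mono[OF finD that] that D(1) by auto
    then show ?thesis using least[of D'] by linarith
  qed
  have ne: "D \<noteq> {}" using D(2) by auto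
  have "conn U" unfolding conn_def
  proof (intro conjI allI impI)
    show "U \<noteq> {}" using ne DE N_nonempty by (auto simp: U_def)
    fix A assume A: "A \<subset> U" "A \<noteq> {}"
    show "adj A (U - A)"
    proof (rule ccontr)
      assume n: "\<not> adj A (U - A)"
      define D1 where "D1 = {e \<in> D. N e \<subseteq> A}"
      define D2 where "D2 = {e \<in> D. N e \<subseteq> U - A}"
      have NU: "N e \<subseteq> U" if "e \<in> D" for e using that by (auto simp: U_def)
      have U12: "D = D1 \<union> D2" using n NU DE unfolding D1_def D2_def adj_def by blast
      have disj: "D1 \<inter> D2 = {}" using DE N_nonempty unfolding D1_def D2_def by blast
      have V1: "\<Union>(N ` D1) \<subseteq> A" and V2: "\<Union>(N ` D2) \<subseteq> U - A" by (auto simp: D1_def D2_def)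
      have "D1 \<noteq> D"
      proof
        assume "D1 = D"
        then have "U \<subseteq> A" using V1 by (simp add: U_def)
        then show False using A by blast
      qed
      moreover have "D2 \<noteq> D"
      proof
        assume "D2 = D"
        then have "U \<subseteq> U - A" using V2 by (simp add: U_def)
        then show False using A by blast
      qed
      ultimately have "card D1 \<le> card (\<Union>(N ` D1))" "card D2 \<le> card (\<Union>(N ` D2))"
        using small U12 by blast+
      moreover have "card (\<Union>(N ` D1)) \<le> card A" "card (\<Union>(N ` D2)) \<le> card (U - A)"
        using V1 V2 finU A by (auto intro!: card_mono intro: finite_subset)
      moreover have "card D = card D1 + card D2" using U12 disj finD by (metis card_Un_disjoint finite_Un)
      moreover have "card U = card A + card (U - A)"
        using A finU by (metis card_Diff_subset card_mono finite_subset le_add_diff_inverse psubset_imp_subset)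
      ultimately show False using D(2) by (simp add: U_def)
    qed
  qed (rule finU)
  moreover have "deg2 U" unfolding deg2_def
  proof
    fix x assume x: "x \<in> U"
    define F where "F = {e \<in> D. x \<in> N e}"
    have "2 \<le> card F"
    proof (rule ccontr)
      assume "\<not> 2 \<le> card F"
      moreover have "F \<noteq> {}" "finite F" using x finD by (auto simp: F_def U_def)
      ultimately have "card F = 1" by (metis One_nat_def Suc_leI card_gt_0_iff le_antisym not_less_eq_eq numeral_2_eq_2)
      then obtain e where e: "F = {e}" by (auto simp: card_1_singleton_iff)
      then have eD: "e \<in> D" by (auto simp: F_def)
      have "card (D - {e}) \<le> card (\<Union>(N ` (D - {e})))" using small[of "D - {e}"] eD by blast
      also have "\<dots> \<le> card (U - {x})" using e finU by (intro card_mono) (auto simp: F_def U_def)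
      finally have "card (D - {e}) < card U" using x finU by (metis card_Diff1_less le_less_trans)
      moreover have "card D = Suc (card (D - {e}))" using eD finD by (metis card.remove)
      ultimately show False using D(2) by (simp add: U_def)
    qed
    also have "card F \<le> card {e \<in> E. x \<in> N e \<and> N e \<subseteq> U}"
      using finE DE by (intro card_mono) (auto simp: F_def U_def)
    finally show "2 \<le> card {e \<in> E. x \<in> N e \<and> N e \<subseteq> U}" .
  qed
  moreover have "card D \<le> es U" unfolding es_def using finE DE by (intro card_mono) (auto simp: U_def)
  then have "cyc U 2" using D(2) by (simp add: cyc_def U_def)
  moreover have "U \<subseteq> V" using DE by (auto simp: U_def V_def)
  ultimately show ?thesis using D unfolding U_def by blast
qed

end

context good_graph
begin

theorem good_lattice_like: "lattice_like E (hall N)"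
proof -
  define \<P> where "\<P> = {X. \<exists>v. piece X v}"
  \<comment> \<open>\<open>X0\<close> is any piece; if there is none, both chains are empty. The
    pieces comparable with \<open>X0\<close> form a chain by \<open>up\<close> and
    \<open>down\<close>; two pieces incomparable with it are comparable with each other by
    \<open>no_antichain\<close>.\<close>
  define X0 where "X0 = (SOME X. X \<in> \<P>)"
  define \<L> where "\<L> = {X \<in> \<P>. X \<subseteq> X0 \<or> X0 \<subseteq> X}"
  define \<R> where "\<R> = \<P> - \<L>"
  have finP: "finite \<P>"
    by (rule finite_subset[of _ "Pow V"]) (use finV in \<open>auto simp: \<P>_def piece_def\<close>)
  have LR: "\<L> \<union> \<R> = \<P>" "\<L> \<inter> \<R> = {}" "finite \<L>" "finite \<R>" "\<L> \<subseteq> \<P>" "\<R> \<subseteq> \<P>"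
    using finP by (auto simp: \<L>_def \<R>_def)
  have X0: "X0 \<in> \<P>" if "X \<in> \<P>" for X unfolding X0_def using that by (rule someI)
  have up: "X \<subseteq> X' \<or> X' \<subseteq> X" if "X \<in> \<P>" "X' \<in> \<P>" "Y \<in> \<P>" "X \<subseteq> Y" "X' \<subseteq> Y" for X X' Y
  proof -
    obtain v v' w where "piece X v" "piece X' v'" "piece Y w" using \<open>X \<in> \<P>\<close> \<open>X' \<in> \<P>\<close> \<open>Y \<in> \<P>\<close> by (auto simp: \<P>_def)
    then show ?thesis using no_common_superpiece that(4,5) by blast
  qed
  have down: "X \<subseteq> X' \<or> X' \<subseteq> X" if "X \<in> \<P>" "X' \<in> \<P>" "Y \<in> \<P>" "Y \<subseteq> X" "Y \<subseteq> X'" for X X' Y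
  proof -
    obtain v v' w where "piece X v" "piece X' v'" "piece Y w" using \<open>X \<in> \<P>\<close> \<open>X' \<in> \<P>\<close> \<open>Y \<in> \<P>\<close> by (auto simp: \<P>_def)
    then show ?thesis using no_common_subpiece that(4,5) by blast
  qed
  have chainL: "X \<subseteq> X' \<or> X' \<subseteq> X" if X: "X \<in> \<L>" "X' \<in> \<L>" for X X'
  proof -
    have XP: "X \<in> \<P>" "X' \<in> \<P>" "X \<subseteq> X0 \<or> X0 \<subseteq> X" "X' \<subseteq> X0 \<or> X0 \<subseteq> X'" using X by (auto simp: \<L>_def)
    note X0P = X0[OF XP(1)]
    show ?thesis using XP up[OF XP(1,2) X0P] down[OF XP(1,2) X0P] by blast
  qed
  have cross: "\<not> X \<subseteq> X'" "\<not> X' \<subseteq> X" if X: "X \<in> \<L>" "X' \<in> \<R>" for X X'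
  proof -
    have XP: "X \<in> \<P>" "X' \<in> \<P>" "X \<subseteq> X0 \<or> X0 \<subseteq> X" "\<not> X' \<subseteq> X0" "\<not> X0 \<subseteq> X'"
      using X by (auto simp: \<L>_def \<R>_def)
    note X0P = X0[OF XP(1)]
    show "\<not> X \<subseteq> X'" using XP up[OF X0P XP(2,2)] down[OF X0P XP(2,1)] by blast
    show "\<not> X' \<subseteq> X" using XP up[OF X0P XP(2,1)] by blast
  qed
  have chainR: "X \<subseteq> X' \<or> X' \<subseteq> X" if X: "X \<in> \<R>" "X' \<in> \<R>" for X X'
  proof (rule ccontr)
    assume n: "\<not> ?thesis"
    have XP: "X \<in> \<P>" "X' \<in> \<P>" "\<not> X \<subseteq> X0" "\<not> X0 \<subseteq> X" "\<not> X' \<subseteq> X0" "\<not> X0 \<subseteq> X'"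
      using X by (auto simp: \<L>_def \<R>_def)
    obtain v v' v0 where "piece X v" "piece X' v'" "piece X0 v0" using XP(1,2) X0[OF XP(1)] by (auto simp: \<P>_def)
    then show False using no_antichain[of X v X' v' X0 v0] n XP by blast
  qed
  have KLR: "(\<forall>e\<in>E. \<not> (N e \<subseteq> X \<and> N e \<subseteq> X')) \<or> (\<forall>e\<in>E. N e \<subseteq> X \<or> N e \<subseteq> X')"
    if X: "X \<in> \<L>" "X' \<in> \<R>" for X X'
  proof -
    have "X \<in> \<P>" "X' \<in> \<P>" using X LR(5,6) by auto
    then obtain v v' where p: "piece X v" "piece X' v'" by (auto simp: \<P>_def)
    consider "X \<inter> X' = {}" | "\<forall>e\<in>E. \<not> N e \<subseteq> X \<inter> X'" | "\<not> adj (V - X) (V - X')"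
      using pair_cases[OF p cross[OF X]] by blast
    then show ?thesis
    proof cases
      case 1
      have "\<not> (N e \<subseteq> X \<and> N e \<subseteq> X')" if "e \<in> E" for e using N_nonempty[OF that] 1 by blast
      then show ?thesis by blast
    next
      case 3
      have "N e \<subseteq> X \<or> N e \<subseteq> X'" if "e \<in> E" for e using N_V[OF that] that 3 unfolding adj_def by blast
      then show ?thesis by blast
    qed blast
  qed
  \<comment> \<open>The pieces in \<open>\<L>\<close> become initial segments and those in
    \<open>\<R>\<close> final ones: an edge moves right with each piece of \<open>\<L>\<close> that
    misses it and each piece of \<open>\<R>\<close> that contains it. \<open>KLR\<close> ensures
    that the two counts never pull against each other.\<close>
  define pos where "pos e = card {X \<in> \<R>. N e \<subseteq> X} + card {X \<in> \<L>. \<not> N e \<subseteq> X}" for e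
  have posL: "pos x < pos y" if L: "L \<in> \<L>" "x \<in> E" "y \<in> E" "N x \<subseteq> L" "\<not> N y \<subseteq> L" for L x y
  proof -
    have "{X \<in> \<L>. \<not> N x \<subseteq> X} \<subset> {X \<in> \<L>. \<not> N y \<subseteq> X}" using chainL[OF _ L(1)] L by blast
    then have "card {X \<in> \<L>. \<not> N x \<subseteq> X} < card {X \<in> \<L>. \<not> N y \<subseteq> X}"
      using LR(3) by (intro psubset_card_mono) auto
    moreover have "{X \<in> \<R>. N x \<subseteq> X} \<subseteq> {X \<in> \<R>. N y \<subseteq> X}" using KLR[OF L(1)] L by blast
    then have "card {X \<in> \<R>. N x \<subseteq> X} \<le> card {X \<in> \<R>. N y \<subseteq> X}" using LR(4) by (intro card_mono) auto
    ultimately show ?thesis by (simp add: pos_def)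
  qed
  have posR: "pos x < pos y" if R: "R \<in> \<R>" "x \<in> E" "y \<in> E" "\<not> N x \<subseteq> R" "N y \<subseteq> R" for R x y
  proof -
    have "{X \<in> \<R>. N x \<subseteq> X} \<subset> {X \<in> \<R>. N y \<subseteq> X}" using chainR[OF _ R(1)] R by blast
    then have "card {X \<in> \<R>. N x \<subseteq> X} < card {X \<in> \<R>. N y \<subseteq> X}"
      using LR(4) by (intro psubset_card_mono) auto
    moreover have "{X \<in> \<L>. \<not> N x \<subseteq> X} \<subseteq> {X \<in> \<L>. \<not> N y \<subseteq> X}" using KLR[OF _ R(1)] R by blast
    then have "card {X \<in> \<L>. \<not> N x \<subseteq> X} \<le> card {X \<in> \<L>. \<not> N y \<subseteq> X}" using LR(3) by (intro card_mono) auto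
    ultimately show ?thesis by (simp add: pos_def)
  qed
  define K where "K X = {e \<in> E. N e \<subseteq> X}" for X
  have finK: "finite (K X)" for X using finE by (simp add: K_def)
  have Kne: "K X \<noteq> {}" if XP: "X \<in> \<P>" for X
  proof -
    obtain v where "piece X v" using XP by (auto simp: \<P>_def)
    then have "cyc X 2" by (rule pieceD)
    then have "es X \<noteq> 0" by (auto simp: cyc_def)
    then have "card (K X) \<noteq> 0" by (simp add: es_def K_def)
    then show ?thesis by auto
  qed
  \<comment> \<open>The exclusive right end of an initial segment, hence the \<open>Suc\<close>;
    \<open>tR\<close> is the inclusive left end of a final segment.\<close>
  define tL where "tL X = Max ((\<lambda>e. Suc (pos e)) ` K X)" for X
  define tR where "tR X = Min (pos ` K X)" for X
  have tL: "N x \<subseteq> X \<longleftrightarrow> pos x < tL X" if "X \<in> \<L>" "x \<in> E" for X x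
  proof -
    have ne: "K X \<noteq> {}" using Kne that LR(5) by blast
    show ?thesis
    proof
      assume "N x \<subseteq> X"
      then have "Suc (pos x) \<le> tL X" unfolding tL_def using finK that(2) by (intro Max_ge) (auto simp: K_def)
      then show "pos x < tL X" by simp
    next
      assume lt: "pos x < tL X"
      show "N x \<subseteq> X"
      proof (rule ccontr)
        assume "\<not> N x \<subseteq> X"
        then have "Suc (pos e) \<le> pos x" if "e \<in> K X" for e
          using posL[OF \<open>X \<in> \<L>\<close>, of e x] that \<open>x \<in> E\<close> by (auto simp: K_def)
        then have "tL X \<le> pos x" unfolding tL_def using finK ne by (simp add: Max_le_iff)
        then show False using lt by simp
      qed
    qed
  qed
  have tR: "N x \<subseteq> X \<longleftrightarrow> tR X \<le> pos x" if "X \<in> \<R>" "x \<in> E" for X x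
  proof -
    have ne: "K X \<noteq> {}" using Kne that LR(6) by blast
    show ?thesis
    proof
      assume "N x \<subseteq> X"
      then show "tR X \<le> pos x" unfolding tR_def using finK that(2) by (intro Min_le) (auto simp: K_def)
    next
      assume le: "tR X \<le> pos x"
      show "N x \<subseteq> X"
      proof (rule ccontr)
        assume "\<not> N x \<subseteq> X"
        then have "pos x < pos e" if "e \<in> K X" for e
          using posR[OF \<open>X \<in> \<R>\<close>, of x e] that \<open>x \<in> E\<close> by (auto simp: K_def)
        then have "pos x < tR X" unfolding tR_def using finK ne by (simp add: Min_gr_iff)
        then show False using le by simp
      qed
    qed
  qed
  have tL_mono: "tL X \<le> tL X'" if "X \<subseteq> X'" "X \<in> \<P>" for X X'
    unfolding tL_def using that Kne[OF that(2)] finK by (intro Max_mono image_mono) (auto simp: K_def)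
  have tR_mono: "tR X' \<le> tR X" if "X \<subseteq> X'" "X \<in> \<P>" for X X'
    unfolding tR_def using that Kne[OF that(2)] finK by (intro Min_antimono image_mono) (auto simp: K_def)
  \<comment> \<open>A bound above all positions, used as the right end \<open>b v\<close> when no
    piece at \<open>v\<close> lies in \<open>\<R>\<close>; 0 plays the same part for
    \<open>a v\<close>.\<close>
  define m where "m = Suc (card \<R> + card \<L>)"
  have posm: "pos e < m" for e
  proof -
    have "card {X \<in> \<R>. N e \<subseteq> X} \<le> card \<R>" "card {X \<in> \<L>. \<not> N e \<subseteq> X} \<le> card \<L>"
      using LR by (auto intro: card_mono)
    then show ?thesis by (simp add: m_def pos_def)
  qed
  define a where "a v = Max (insert 0 (tL ` {X \<in> \<L>. piece X v}))" for v
  define b where "b v = Min (insert m (tR ` {X \<in> \<R>. piece X v}))" for v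
  have finLv: "finite {X \<in> \<L>. piece X v}" "finite {X \<in> \<R>. piece X v}" for v using LR by auto
  have win: "(a v \<le> pos x \<and> pos x < b v) \<longleftrightarrow> (\<forall>X. piece X v \<longrightarrow> \<not> N x \<subseteq> X)" if x: "x \<in> E" for v x
  proof -
    have "a v \<le> pos x \<longleftrightarrow> (\<forall>X\<in>{X \<in> \<L>. piece X v}. tL X \<le> pos x)"
      unfolding a_def using finLv(1)[of v] by (subst Max_le_iff) auto
    also have "\<dots> \<longleftrightarrow> (\<forall>X. X \<in> \<L> \<longrightarrow> piece X v \<longrightarrow> \<not> N x \<subseteq> X)"
      using tL[OF _ x] by (auto simp: not_less)
    finally have 1: "a v \<le> pos x \<longleftrightarrow> (\<forall>X. X \<in> \<L> \<longrightarrow> piece X v \<longrightarrow> \<not> N x \<subseteq> X)" .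
    have "pos x < b v \<longleftrightarrow> (\<forall>X\<in>{X \<in> \<R>. piece X v}. pos x < tR X)"
      unfolding b_def using finLv(2)[of v] posm[of x] by (subst Min_gr_iff) auto
    also have "\<dots> \<longleftrightarrow> (\<forall>X. X \<in> \<R> \<longrightarrow> piece X v \<longrightarrow> \<not> N x \<subseteq> X)"
      using tR[OF _ x] by (auto simp: not_le)
    finally have 2: "pos x < b v \<longleftrightarrow> (\<forall>X. X \<in> \<R> \<longrightarrow> piece X v \<longrightarrow> \<not> N x \<subseteq> X)" .
    have "piece X v \<Longrightarrow> X \<in> \<L> \<or> X \<in> \<R>" for X using LR(1) by (auto simp: \<P>_def)
    then show ?thesis unfolding 1 2 by blast
  qed
  \<comment> \<open>A window strictly inside another has both ends set by pieces at
    \<open>w\<close>, one from each chain. These are disjoint, as they would otherwise be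
    comparable, so \<open>v\<close> misses one of them; a piece at \<open>v\<close> contains that
    one and bounds the window of \<open>v\<close> on the same side.\<close>
  have noinside: False if vw: "v \<in> V" "w \<in> V" "a v < a w" "b w < b v" for v w
  proof -
    have "a w \<in> insert 0 (tL ` {X \<in> \<L>. piece X w})" unfolding a_def using finLv(1) by (intro Max_in) auto
    then obtain X where X: "X \<in> \<L>" "piece X w" "tL X = a w" using vw(3) by auto
    have "b w \<in> insert m (tR ` {X \<in> \<R>. piece X w})" unfolding b_def using finLv(2) by (intro Min_in) auto
    moreover have "b v \<le> m" unfolding b_def using finLv(2) by (intro Min_le) auto
    ultimately obtain X' where X': "X' \<in> \<R>" "piece X' w" "tR X' = b w" using vw(4) by auto
    have "X \<inter> X' = {}" using piece_subset[OF X(2) X'(2)] pieceD(3)[OF X(2)] cross[OF X(1) X'(1)] by blast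
    then consider "v \<notin> X" | "v \<notin> X'" by blast
    then show False
    proof cases
      case 1
      note p = pieceD[OF X(2)]
      obtain Y where Y: "piece Y v" "X \<subseteq> Y" using piece_extends[OF p(1) vw(1) 1 p(4,5,6)] by blast
      have YP: "Y \<in> \<P>" using Y by (auto simp: \<P>_def)
      then have "Y \<in> \<L>" using cross(1)[OF X(1), of Y] Y(2) LR(1) by blast
      then have "tL Y \<le> a v" unfolding a_def using finLv(1) Y(1) by (intro Max_ge) auto
      moreover have "tL X \<le> tL Y" using tL_mono[OF Y(2)] X(1) LR(5) by blast
      ultimately show False using X(3) vw(3) by simp
    next
      case 2
      note p = pieceD[OF X'(2)]
      obtain Y where Y: "piece Y v" "X' \<subseteq> Y" using piece_extends[OF p(1) vw(1) 2 p(4,5,6)] by blast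
      have YP: "Y \<in> \<P>" using Y by (auto simp: \<P>_def)
      then have "Y \<in> \<R>" using cross(2)[OF _ X'(1), of Y] Y(2) LR(1) by blast
      then have "b v \<le> tR Y" unfolding b_def using finLv(2) Y(1) by (intro Min_le) auto
      moreover have "tR Y \<le> tR X'" using tR_mono[OF Y(2)] X'(1) LR(6) by blast
      ultimately show False using X'(3) vw(4) by simp
    qed
  qed
  show ?thesis
  proof (rule lattice_likeI[of V a b _ _ pos])
    show "finite V" by (rule finV)
    fix v w assume "v \<in> V" "w \<in> V"
    then have "\<not> (a v < a w \<and> b w < b v)" "\<not> (a w < a v \<and> b v < b w)" using noinside by blast+
    then show "a v \<le> a w \<and> b v \<le> b w \<or> a w \<le> a v \<and> b w \<le> b v"
      by linarith
  next
    fix X assume X: "X \<subseteq> E"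
    show "hall N X \<longleftrightarrow> (\<exists>\<phi>. inj_on \<phi> X \<and> (\<forall>x\<in>X. \<phi> x \<in> V \<and> a (\<phi> x) \<le> pos x \<and> pos x < b (\<phi> x)))"
    proof
      assume h: "hall N X"
      have "finite X" using X finE finite_subset by blast
      then obtain \<phi> where \<phi>: "inj_on \<phi> X" "\<forall>x\<in>X. \<phi> x \<in> N x"
        using hall_matching[of X N] h X N_finite unfolding hall_def by blast
      have "\<phi> x \<in> V \<and> a (\<phi> x) \<le> pos x \<and> pos x < b (\<phi> x)" if x: "x \<in> X" for x
      proof -
        have xE: "x \<in> E" "\<phi> x \<in> N x" using x X \<phi> by auto
        have "\<not> N x \<subseteq> Y" if "piece Y (\<phi> x)" for Y using pieceD(3)[OF that] xE(2) by blast
        then show ?thesis using win[OF xE(1)] N_V[OF xE(1)] xE(2) by blast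
      qed
      then show "\<exists>\<phi>. inj_on \<phi> X \<and> (\<forall>x\<in>X. \<phi> x \<in> V \<and> a (\<phi> x) \<le> pos x \<and> pos x < b (\<phi> x))"
        using \<phi>(1) by blast
    next
      assume "\<exists>\<phi>. inj_on \<phi> X \<and> (\<forall>x\<in>X. \<phi> x \<in> V \<and> a (\<phi> x) \<le> pos x \<and> pos x < b (\<phi> x))"
      then obtain \<phi> where \<phi>: "inj_on \<phi> X" "\<And>x. x \<in> X \<Longrightarrow> \<phi> x \<in> V \<and> a (\<phi> x) \<le> pos x \<and> pos x < b (\<phi> x)" by blast
      show "hall N X"
      proof (rule ccontr)
        assume "\<not> hall N X"
        then obtain D where D: "D \<subseteq> X" "card (\<Union>(N ` D)) < card D" "\<Union>(N ` D) \<subseteq> V" "conn (\<Union>(N ` D))"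
            "deg2 (\<Union>(N ` D))" "cyc (\<Union>(N ` D)) 2"
          using minimal_dependent[OF X] by blast
        have "\<phi> x \<in> \<Union>(N ` D)" if x: "x \<in> D" for x
        proof (rule ccontr)
          assume n: "\<phi> x \<notin> \<Union>(N ` D)"
          have xX: "x \<in> X" "x \<in> E" using x D(1) X by auto
          obtain Y where "piece Y (\<phi> x)" "\<Union>(N ` D) \<subseteq> Y"
            using piece_extends[OF D(3) _ n D(4,5,6)] \<phi>(2)[OF xX(1)] by blast
          moreover have "N x \<subseteq> \<Union>(N ` D)" using x by blast
          ultimately show False using win[OF xX(2), of "\<phi> x"] \<phi>(2)[OF xX(1)] by blast
        qed
        then have "\<phi> ` D \<subseteq> \<Union>(N ` D)" by blast
        then have "card (\<phi> ` D) \<le> card (\<Union>(N ` D))" using conn_finite[OF D(4)] by (rule card_mono[rotated])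
        moreover have "card (\<phi> ` D) = card D" using \<phi>(1) D(1) by (meson card_image inj_on_subset)
        ultimately show False using D(2) by simp
      qed
    qed
  qed
qed

end

section \<open>The excluded minors are not lattice path matroids\<close>

text \<open>Here \<open>C\<close> is to be a circuit, \<open>y\<close> an element outside its span,
  and \<open>I\<close> an independent set spanning \<open>y\<close>, all of which
  \<open>side_check\<close> tests by evaluation. Elements of \<open>I\<close> in \<open>C\<close>
  cannot be the witness; if only one element is left, it is forced to the side of
  \<open>y\<close>.\<close>

definition sided :: "(nat \<Rightarrow> nat) \<Rightarrow> nat list \<Rightarrow> nat \<Rightarrow> nat list \<Rightarrow> bool" where
  "sided pos C y I \<longleftrightarrow>
     ((\<forall>x\<in>set C. pos x < pos y) \<and> (\<exists>i\<in>set I. \<forall>x\<in>set C. pos x < pos i)) \<or>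
     ((\<forall>x\<in>set C. pos y < pos x) \<and> (\<exists>i\<in>set I. \<forall>x\<in>set C. pos i < pos x))"

definition side_check :: "(nat \<times> nat) list \<Rightarrow> nat list \<Rightarrow> nat \<Rightarrow> nat list \<Rightarrow> bool" where
  "side_check xs C y I \<longleftrightarrow> (let ind = (\<lambda>l. matches [] (map ((!) xs) l)) in
     distinct C \<and> distinct I \<and> y \<notin> set C \<and> y \<notin> set I \<and> (\<forall>p\<in>set (y # C @ I). p < length xs) \<and>
     \<not> ind C \<and> (\<forall>c\<in>set C. ind (remove1 c C)) \<and> (\<exists>c\<in>set C. ind (y # remove1 c C)) \<and>
     ind I \<and> \<not> ind (y # I))"

lemma lattice_like_sided:
  assumes "lattice_like {..<length xs} (hall (list_ends xs))"
  shows "\<exists>pos. \<forall>C y I. side_check xs C y I \<longrightarrow> sided pos C y I"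
proof -
  let ?E = "{..<length xs}" and ?P = "hall (list_ends xs)"
  from lattice_like_circuits[OF assms] obtain pos :: "nat \<Rightarrow> nat" where pos:
    "\<forall>C y. circuit_in ?E ?P C \<longrightarrow> y \<in> ?E \<longrightarrow> off_span ?P C y \<longrightarrow>
    ((\<forall>x\<in>C. pos x < pos y) \<and> (\<forall>I\<subseteq>?E. ?P I \<longrightarrow> \<not> ?P (insert y I) \<longrightarrow> (\<exists>i\<in>I. \<forall>x\<in>C. pos x < pos i))) \<or>
    ((\<forall>x\<in>C. pos y < pos x) \<and> (\<forall>I\<subseteq>?E. ?P I \<longrightarrow> \<not> ?P (insert y I) \<longrightarrow> (\<exists>i\<in>I. \<forall>x\<in>C. pos i < pos x)))"
    ..
  have "sided pos C y I" if "side_check xs C y I" for C y I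
  proof -
    have c: "distinct C" "distinct I" "y \<notin> set C" "y \<notin> set I" "y < length xs" "set C \<subseteq> ?E" "set I \<subseteq> ?E"
      "\<not> matches [] (map ((!) xs) C)" "\<And>c. c \<in> set C \<Longrightarrow> matches [] (map ((!) xs) (remove1 c C))"
      "\<exists>c\<in>set C. matches [] (map ((!) xs) (y # remove1 c C))"
      "matches [] (map ((!) xs) I)" "\<not> matches [] (map ((!) xs) (y # I))"
      using that by (auto simp: side_check_def Let_def)
    have rm: "set (remove1 c C) = set C - {c}" "distinct (remove1 c C)" for c using c(1) by simp_all
    have ind: "?P (set l) \<longleftrightarrow> matches [] (map ((!) xs) l)" if "distinct l" "set l \<subseteq> ?E" for l
      using hall_list_ends that by blast
    have 1: "circuit_in ?E ?P (set C)" unfolding circuit_in_def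
      using c(6,8,9) ind[of C] c(1) ind[OF rm(2)] rm(1) by auto
    obtain d where d: "d \<in> set C" "matches [] (map ((!) xs) (y # remove1 d C))" using c(10) by blast
    have "?P (set (y # remove1 d C))" using ind[of "y # remove1 d C"] d(2) rm c(3,5,6) by auto
    then have 2: "off_span ?P (set C) y" unfolding off_span_def using d(1) c(3) rm(1) by auto
    have 3: "?P (set I)" "\<not> ?P (insert y (set I))"
      using ind[of I] ind[of "y # I"] c by auto
    show ?thesis unfolding sided_def using pos[rule_format, OF 1 _ 2] c(5,7) 3 by auto
  qed
  then show ?thesis by blast
qed

text \<open>Each of the three parallel pairs would have to lie on one side of the other two pairs,
  which fails for the one in the middle.\<close>

lemma not_like_P2: "\<not> lattice_like {..<length ex_P2} (hall (list_ends ex_P2))"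
proof
  assume "lattice_like {..<length ex_P2} (hall (list_ends ex_P2))"
  then obtain pos where pos: "\<And>C y I. side_check ex_P2 C y I \<Longrightarrow> sided pos C y I"
    using lattice_like_sided by blast
  have "sided pos [0,1,2,3] 4 [0,1,2,5]" "sided pos [0,1,4,5] 2 [0,1,4,3]" "sided pos [2,3,4,5] 0 [2,3,4,1]"
    by (rule pos, code_simp)+
  then show False unfolding sided_def by simp linarith
qed

text \<open>Up to reflection, 1 and 4 come before 3 and 5. Then 0 and 3 come after 5, and so 1 and 5
  would have to come before 4.\<close>

lemma not_like_W: "\<not> lattice_like {..<length ex_W} (hall (list_ends ex_W))"
proof
  assume "lattice_like {..<length ex_W} (hall (list_ends ex_W))"
  then obtain pos where pos: "\<And>C y I. side_check ex_W C y I \<Longrightarrow> sided pos C y I"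
    using lattice_like_sided by blast
  have "sided pos [3,2,5] 4 [3,5,1]" "sided pos [4,1,5] 3 [4,5,0]" "sided pos [3,0,4] 5 [3,4,1]"
    by (rule pos, code_simp)+
  then show False unfolding sided_def by simp linarith
qed

text \<open>Edges 1 and 2 lie on one side of edge 5 and edges 3 and 4 on the other; the first two
  conditions put edge 0 on both sides of 5.\<close>

lemma not_like_A3: "\<not> lattice_like {..<length ex_A3} (hall (list_ends ex_A3))"
proof
  assume "lattice_like {..<length ex_A3} (hall (list_ends ex_A3))"
  then obtain pos where pos: "\<And>C y I. side_check ex_A3 C y I \<Longrightarrow> sided pos C y I"
    using lattice_like_sided by blast
  have "sided pos [1,2,5] 0 [3,4,1]" "sided pos [3,4,5] 0 [1,2,3]"
    "sided pos [1,2,5] 3 [1,2,4]" "sided pos [1,2,5] 4 [1,2,3]"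
    "sided pos [3,4,5] 1 [3,4,2]" "sided pos [3,4,5] 2 [3,4,1]"
    by (rule pos, code_simp)+
  then show False unfolding sided_def by simp linarith
qed

text \<open>Edges 1 and 2 lie on the same side of 3 and 5. In that direction the loop 3 would lie
  beyond 5, and the loop 5 beyond 3.\<close>

lemma not_like_R3: "\<not> lattice_like {..<length ex_R3} (hall (list_ends ex_R3))"
proof
  assume "lattice_like {..<length ex_R3} (hall (list_ends ex_R3))"
  then obtain pos where pos: "\<And>C y I. side_check ex_R3 C y I \<Longrightarrow> sided pos C y I"
    using lattice_like_sided by blast
  have "sided pos [5,6] 3 [5,1,2]" "sided pos [3,4] 5 [3,1,2]" "sided pos [0,3,5] 1 [2,3,5]" "sided pos [0,3,5] 2 [1,3,5]"
    by (rule pos, code_simp)+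
  then show False unfolding sided_def by simp linarith
qed

text \<open>Edges 3, 4 and edges 0, 2 lie on opposite sides of edge 5, and edge 1 would have to lie
  on both sides of 5.\<close>

lemma not_like_R4: "\<not> lattice_like {..<length ex_R4} (hall (list_ends ex_R4))"
proof
  assume "lattice_like {..<length ex_R4} (hall (list_ends ex_R4))"
  then obtain pos where pos: "\<And>C y I. side_check ex_R4 C y I \<Longrightarrow> sided pos C y I"
    using lattice_like_sided by blast
  have "sided pos [0,1,2,5] 3 [0,1,2,4]" "sided pos [0,1,2,5] 4 [0,1,2,3]"
    "sided pos [1,3,4,5] 0 [1,3,4,2]" "sided pos [1,3,4,5] 2 [1,3,4,0]"
    "sided pos [5,6] 1 [3,4,5]" "sided pos [5,6] 1 [0,2,5]"
    by (rule pos, code_simp)+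
  then show False unfolding sided_def by simp linarith
qed

text \<open>As for \<open>ex_R3\<close>: edges 6 and 7 lie on one side of 0 and 3, and in that
  direction 3 would lie beyond 0 and 0 beyond 3.\<close>

lemma not_like_D4: "\<not> lattice_like {..<length ex_D4} (hall (list_ends ex_D4))"
proof
  assume "lattice_like {..<length ex_D4} (hall (list_ends ex_D4))"
  then obtain pos where pos: "\<And>C y I. side_check ex_D4 C y I \<Longrightarrow> sided pos C y I"
    using lattice_like_sided by blast
  have "sided pos [0,1,3,4] 6 [0,1,3,7]" "sided pos [0,1,2] 3 [0,1,6,7]" "sided pos [3,4,5] 0 [3,4,6,7]"
    by (rule pos, code_simp)+
  then show False unfolding sided_def by simp linarith
qed

text \<open>Each parallel class needs members of both other classes on the same side of it, so no
  class could be the middle one.\<close>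

lemma not_like_3K3: "\<not> lattice_like {..<length ex_3K3} (hall (list_ends ex_3K3))"
proof
  assume "lattice_like {..<length ex_3K3} (hall (list_ends ex_3K3))"
  then obtain pos where pos: "\<And>C y I. side_check ex_3K3 C y I \<Longrightarrow> sided pos C y I"
    using lattice_like_sided by blast
  have "sided pos [0,1,2] 3 [6,7,0]" "sided pos [3,4,5] 6 [0,1,3]" "sided pos [6,7,8] 0 [3,4,6]"
    by (rule pos, code_simp)+
  then show False unfolding sided_def by simp linarith
qed

text \<open>The pairs 0, 6 and 1, 4 and 2, 3 would each have to lie on one side of the other two, as
  for \<open>ex_P2\<close>.\<close>

lemma not_like_S1: "\<not> lattice_like {..<length ex_S1} (hall (list_ends ex_S1))"
proof
  assume "lattice_like {..<length ex_S1} (hall (list_ends ex_S1))"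
  then obtain pos where pos: "\<And>C y I. side_check ex_S1 C y I \<Longrightarrow> sided pos C y I"
    using lattice_like_sided by blast
  have "sided pos [1,2,3,4,5] 0 [1,2,3,4,6]" "sided pos [0,2,3,6,7] 1 [0,2,3,6,4]" "sided pos [0,1,4,5,6] 2 [0,1,4,5,3]"
    by (rule pos, code_simp)+
  then show False unfolding sided_def by simp linarith
qed

lemma excluded_not_like:
  assumes "ys \<in> excluded"
  shows "\<not> lattice_like {..<length ys} (hall (list_ends ys))"
  using assms not_like_P2 not_like_W not_like_A3 not_like_R3 not_like_R4 not_like_D4 not_like_3K3 not_like_S1
  unfolding excluded_def by blast

section \<open>The characterisation\<close>

lemma lattice_like_sum:
  assumes l1: "lattice_like E1 P1" and l2: "lattice_like E2 P2" and fin: "finite E1" and dis: "E1 \<inter> E2 = {}"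
    and P: "\<And>X. X \<subseteq> E1 \<union> E2 \<Longrightarrow> P X \<longleftrightarrow> P1 (X \<inter> E1) \<and> P2 (X \<inter> E2)"
  shows "lattice_like (E1 \<union> E2) P"
proof -
  obtain p1 k1 a1 b1 where s1: "sorted_windows k1 a1 b1"
    and P1: "\<And>X. X \<subseteq> E1 \<Longrightarrow> P1 X \<longleftrightarrow> transversal_of k1 (win p1 a1 b1) X"
    using l1 unfolding lattice_like_def by auto
  obtain p2 k2 a2 b2 where s2: "sorted_windows k2 a2 b2"
    and P2: "\<And>X. X \<subseteq> E2 \<Longrightarrow> P2 X \<longleftrightarrow> transversal_of k2 (win p2 a2 b2) X"
    using l2 unfolding lattice_like_def by auto
  \<comment> \<open>All positions of \<open>E1\<close> lie below \<open>M\<close>, and the second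
    system is moved up by \<open>M\<close>. Cutting the first windows off at \<open>M\<close> keeps
    them away from \<open>E2\<close> and makes the combined ends sorted.\<close>
  define M where "M = Suc (Max (insert 0 (p1 ` E1)))"
  have M: "p1 x < M" if "x \<in> E1" for x
    using Max_ge[of "insert 0 (p1 ` E1)" "p1 x"] that fin unfolding M_def
    by (simp add: less_Suc_eq_le del: Max_insert)
  define pos where "pos x = (if x \<in> E1 then p1 x else M + p2 x)" for x
  define a where "a i = (if i < k1 then min (a1 i) M else M + a2 (i - k1))" for i
  define b where "b i = (if i < k1 then min (b1 i) M else M + b2 (i - k1))" for i
  have "sorted_windows (k1 + k2) a b"
    unfolding sorted_windows_def
  proof (intro allI impI)
    fix i j assume ij: "i \<le> j" "j < k1 + k2"
    consider "j < k1" | "i < k1" "k1 \<le> j" | "k1 \<le> i" by linarith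
    then show "a i \<le> a j \<and> b i \<le> b j"
    proof cases
      case 1
      then have "a1 i \<le> a1 j" "b1 i \<le> b1 j" using s1 ij unfolding sorted_windows_def by blast+
      then show ?thesis using 1 ij by (simp add: a_def b_def min.coboundedI1)
    next
      case 2
      then show ?thesis by (simp add: a_def b_def min.coboundedI2)
    next
      case 3
      then have "a2 (i - k1) \<le> a2 (j - k1)" "b2 (i - k1) \<le> b2 (j - k1)"
        using s2 ij unfolding sorted_windows_def by (metis add.commute diff_le_mono less_diff_conv2 order_trans)+
      then show ?thesis using 3 ij by (simp add: a_def b_def)
    qed
  qed
  moreover have "P X \<longleftrightarrow> transversal_of (k1 + k2) (win pos a b) X" if X: "X \<subseteq> E1 \<union> E2" for X
  proof -
    have w1: "x \<in> win pos a b i \<longleftrightarrow> i < k1 \<and> x \<in> win p1 a1 b1 i" if "x \<in> E1" for x i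
      using M[OF that] that by (auto simp: win_def pos_def a_def b_def)
    have w2: "x \<in> win pos a b i \<longleftrightarrow> k1 \<le> i \<and> x \<in> win p2 a2 b2 (i - k1)" if "x \<in> E2" for x i
      using dis that by (auto simp: win_def pos_def a_def b_def)
    have "transversal_of (k1 + k2) (win pos a b) X \<longleftrightarrow>
      transversal_of k1 (win p1 a1 b1) (X \<inter> E1) \<and> transversal_of k2 (win p2 a2 b2) (X \<inter> E2)"
    proof
      assume "transversal_of (k1 + k2) (win pos a b) X"
      then obtain \<phi> where \<phi>: "inj_on \<phi> X" "\<And>x. x \<in> X \<Longrightarrow> \<phi> x < k1 + k2 \<and> x \<in> win pos a b (\<phi> x)"
        unfolding transversal_of_def by auto
      have "inj_on \<phi> (X \<inter> E1)" using \<phi>(1) by (rule inj_on_subset) blast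
      then have "transversal_of k1 (win p1 a1 b1) (X \<inter> E1)"
        unfolding transversal_of_def using \<phi>(2) w1 by (intro exI[of _ \<phi>]) auto
      moreover have g: "k1 \<le> \<phi> x \<and> x \<in> win p2 a2 b2 (\<phi> x - k1) \<and> \<phi> x - k1 < k2" if "x \<in> X \<inter> E2" for x
        using \<phi>(2)[of x] w2[of x] that by auto
      then have "inj_on (\<lambda>x. \<phi> x - k1) (X \<inter> E2)"
        using \<phi>(1) by (auto simp: inj_on_def) (metis IntI eq_diff_iff)
      then have "transversal_of k2 (win p2 a2 b2) (X \<inter> E2)"
        unfolding transversal_of_def using g by (intro exI[of _ "\<lambda>x. \<phi> x - k1"]) auto
      ultimately show "transversal_of k1 (win p1 a1 b1) (X \<inter> E1) \<and> transversal_of k2 (win p2 a2 b2) (X \<inter> E2)" ..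
    next
      assume t: "transversal_of k1 (win p1 a1 b1) (X \<inter> E1) \<and> transversal_of k2 (win p2 a2 b2) (X \<inter> E2)"
      obtain \<phi> where \<phi>: "inj_on \<phi> (X \<inter> E1)" "\<And>x. x \<in> X \<inter> E1 \<Longrightarrow> \<phi> x < k1 \<and> x \<in> win p1 a1 b1 (\<phi> x)"
        using t unfolding transversal_of_def by auto
      obtain \<psi> where \<psi>: "inj_on \<psi> (X \<inter> E2)" "\<And>x. x \<in> X \<inter> E2 \<Longrightarrow> \<psi> x < k2 \<and> x \<in> win p2 a2 b2 (\<psi> x)"
        using t unfolding transversal_of_def by auto
      define \<chi> where "\<chi> x = (if x \<in> E1 then \<phi> x else k1 + \<psi> x)" for x
      have "inj_on \<chi> X"
      proof (rule inj_onI)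
        fix x y assume xy: "x \<in> X" "y \<in> X" "\<chi> x = \<chi> y"
        have *: "z \<in> E1 \<or> z \<in> X \<inter> E2 \<and> z \<notin> E1" if "z \<in> X" for z using that X by blast
        show "x = y"
          using xy *[of x] *[of y] \<phi>(2)[of x] \<phi>(2)[of y] inj_onD[OF \<phi>(1), of x y] inj_onD[OF \<psi>(1), of x y]
          by (auto simp: \<chi>_def split: if_splits)
      qed
      moreover have "\<chi> x < k1 + k2 \<and> x \<in> win pos a b (\<chi> x)" if x: "x \<in> X" for x
      proof (cases "x \<in> E1")
        case True
        then show ?thesis using \<phi>(2)[of x] w1[of x] x by (auto simp: \<chi>_def)
      next
        case False
        then have "x \<in> X \<inter> E2" using x X by blast
        then show ?thesis using \<psi>(2)[of x] w2[of x] False by (auto simp: \<chi>_def)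
      qed
      ultimately show "transversal_of (k1 + k2) (win pos a b) X" unfolding transversal_of_def by blast
    qed
    then show ?thesis using P[OF X] P1[of "X \<inter> E1"] P2[of "X \<inter> E2"] by simp
  qed
  ultimately show ?thesis unfolding lattice_like_def by blast
qed

lemma mgraph_subset: "mgraph E N \<Longrightarrow> F \<subseteq> E \<Longrightarrow> mgraph F N"
  unfolding mgraph_def using finite_subset by blast

lemma bad_subset:
  assumes "mgraph E N" "F \<subseteq> E" "mgraph.bad F N"
  shows "mgraph.bad E N"
  using assms emb_subset[OF assms(2)]
  unfolding mgraph.bad_def[OF assms(1)] mgraph.bad_def[OF mgraph_subset[OF assms(1,2)]] by blast

lemma not_bad_imp_lattice_like:
  fixes E :: "'e set" and N :: "'e \<Rightarrow> 'v set"
  assumes "mgraph E N" "\<not> mgraph.bad E N"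
  shows "lattice_like E (hall N)"
  using assms
proof (induction "card E" arbitrary: E rule: less_induct)
  case less
  interpret mgraph E N by (rule less.prems(1))
  have IH: "lattice_like F (hall N)" if "F \<subset> E" for F
  proof (rule less.hyps)
    show "card F < card E" using that finE by (simp add: psubset_card_mono)
    show "mgraph F N" using mgraph_subset[OF less.prems(1)] that by blast
    show "\<not> mgraph.bad F N" using bad_subset[OF less.prems(1)] that less.prems(2) by blast
  qed
  consider "E = {}" | "E \<noteq> {}" "\<not> conn V" | "\<not> deg2 V" | "conn V" "deg2 V" by blast
  then show ?case
  proof cases
    case 1
    then show ?thesis unfolding lattice_like_def
      by (intro exI[of _ "\<lambda>_. 0"] exI[of _ 0]) (auto simp: sorted_windows_def transversal_of_def hall_def)
  next
    case 2
    have "V \<noteq> {}" using 2(1) N_nonempty by (auto simp: V_def)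
    then obtain A where A: "A \<subset> V" "A \<noteq> {}" "\<not> adj A (V - A)" using 2(2) finV unfolding conn_def by blast
    define E1 where "E1 = {e \<in> E. N e \<subseteq> A}"
    define E2 where "E2 = {e \<in> E. N e \<subseteq> V - A}"
    have split: "N e \<subseteq> A \<or> N e \<subseteq> V - A" if "e \<in> E" for e using A(3) N_V[OF that] that unfolding adj_def by blast
    then have E12: "E1 \<union> E2 = E" by (auto simp: E1_def E2_def)
    have dis: "E1 \<inter> E2 = {}" using N_nonempty by (auto simp: E1_def E2_def)
    have "E2 \<noteq> {}"
    proof -
      obtain x where "x \<in> V" "x \<notin> A" using A(1) by blast
      then obtain e where "e \<in> E" "x \<in> N e" by (auto simp: V_def)
      then show ?thesis using split[of e] \<open>x \<notin> A\<close> by (auto simp: E2_def)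
    qed
    moreover have "E1 \<noteq> {}"
    proof -
      obtain x where "x \<in> V" "x \<in> A" using A(1,2) by blast
      then obtain e where "e \<in> E" "x \<in> N e" by (auto simp: V_def)
      then show ?thesis using split[of e] \<open>x \<in> A\<close> by (auto simp: E1_def)
    qed
    ultimately have ps: "E1 \<subset> E" "E2 \<subset> E" using E12 dis by blast+
    have "lattice_like (E1 \<union> E2) (hall N)"
    proof (rule lattice_like_sum[OF IH[OF ps(1)] IH[OF ps(2)] _ dis])
      show "finite E1" using finE by (simp add: E1_def)
      fix X assume X: "X \<subseteq> E1 \<union> E2"
      show "hall N X \<longleftrightarrow> hall N (X \<inter> E1) \<and> hall N (X \<inter> E2)"
      proof
        show "hall N X \<Longrightarrow> hall N (X \<inter> E1) \<and> hall N (X \<inter> E2)" using hall_subset[of N X] by blast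
        assume h: "hall N (X \<inter> E1) \<and> hall N (X \<inter> E2)"
        show "hall N X" unfolding hall_def
        proof (intro allI impI)
          fix J assume J: "J \<subseteq> X"
          have JE: "J \<subseteq> E" "J = (J \<inter> E1) \<union> (J \<inter> E2)" using J X E12 by auto
          have finJ: "finite J" using JE(1) finE finite_subset by blast
          have finN: "finite (\<Union>(N ` J))" using JE(1) finJ N_finite by blast
          have "card J = card (J \<inter> E1) + card (J \<inter> E2)"
            using card_Un_disjoint[of "J \<inter> E1" "J \<inter> E2"] finJ dis JE(2)[symmetric]
            by (simp add: Int_assoc Int_left_commute)
          also have "\<dots> \<le> card (\<Union>(N ` (J \<inter> E1))) + card (\<Union>(N ` (J \<inter> E2)))"
          proof (rule add_mono)
            have "J \<inter> E1 \<subseteq> X \<inter> E1" "J \<inter> E2 \<subseteq> X \<inter> E2" using J by blast+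
            then show "card (J \<inter> E1) \<le> card (\<Union>(N ` (J \<inter> E1)))"
              "card (J \<inter> E2) \<le> card (\<Union>(N ` (J \<inter> E2)))" using h by (simp_all add: hall_def)
          qed
          also have "\<dots> = card (\<Union>(N ` (J \<inter> E1)) \<union> \<Union>(N ` (J \<inter> E2)))"
          proof (rule card_Un_disjoint[symmetric])
            have "\<Union>(N ` (J \<inter> E1)) \<subseteq> \<Union>(N ` J)" "\<Union>(N ` (J \<inter> E2)) \<subseteq> \<Union>(N ` J)" by auto
            then show "finite (\<Union>(N ` (J \<inter> E1)))" "finite (\<Union>(N ` (J \<inter> E2)))"
              using finN finite_subset by blast+
            show "\<Union>(N ` (J \<inter> E1)) \<inter> \<Union>(N ` (J \<inter> E2)) = {}"
              unfolding E1_def E2_def by blast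
          qed
          also have "\<Union>(N ` (J \<inter> E1)) \<union> \<Union>(N ` (J \<inter> E2)) = \<Union>(N ` J)"
            by (subst (3) JE(2)) (simp add: image_Un)
          finally show "card J \<le> card (\<Union>(N ` J))" .
        qed
      qed
    qed
    then show ?thesis using E12 by simp
  next
    case 3
    then obtain x where x: "x \<in> V" "card {e \<in> E. x \<in> N e \<and> N e \<subseteq> V} < 2" by (auto simp: deg2_def not_le)
    have eq: "{e \<in> E. x \<in> N e \<and> N e \<subseteq> V} = {e \<in> E. x \<in> N e}" using N_V by blast
    have "{e \<in> E. x \<in> N e} \<noteq> {}" using x(1) by (auto simp: V_def)
    then have "card {e \<in> E. x \<in> N e} \<noteq> 0" using finE by simp
    then have "card {e \<in> E. x \<in> N e} = 1" using x(2) eq by simp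
    then obtain e where e: "{e \<in> E. x \<in> N e} = {e}" by (auto simp: card_1_singleton_iff)
    then have eE: "e \<in> E" "x \<in> N e" by auto
    define E' where "E' = E - {e}"
    have ps: "E' \<subset> E" "E' \<union> {e} = E" "E' \<inter> {e} = {}" using eE by (auto simp: E'_def)
    \<comment> \<open>The only edge at \<open>x\<close> is a coloop, since it can always be matched
      to \<open>x\<close>. So \<open>E\<close> is the direct sum of \<open>E'\<close> and a free
      element.\<close>
    have one: "lattice_like {e} (\<lambda>_. True)" unfolding lattice_like_def
      by (intro exI[of _ "\<lambda>_. 0"] exI[of _ "1 :: nat"] exI[of _ "\<lambda>_. 0"] exI[of _ "\<lambda>_. 1"])
        (auto simp: sorted_windows_def transversal_of_def win_def inj_on_def intro!: exI[of _ "\<lambda>_. 0"])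
    have "lattice_like (E' \<union> {e}) (hall N)"
    proof (rule lattice_like_sum[OF IH[OF ps(1)] one _ ps(3)])
      show "finite E'" using finE by (simp add: E'_def)
      fix X assume X: "X \<subseteq> E' \<union> {e}"
      show "hall N X \<longleftrightarrow> hall N (X \<inter> E') \<and> True"
      proof
        show "hall N X \<Longrightarrow> hall N (X \<inter> E') \<and> True" using hall_subset[of N X] by blast
        assume h: "hall N (X \<inter> E') \<and> True"
        show "hall N X" unfolding hall_def
        proof (intro allI impI)
          fix J assume J: "J \<subseteq> X"
          have JE: "J \<subseteq> E" using J X ps(2) by simp
          have finJ: "finite J" using JE finE finite_subset by blast
          have finN: "finite (\<Union>(N ` J))" using JE finJ N_finite by blast
          have le: "card (J - {e}) \<le> card (\<Union>(N ` (J - {e})))"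
          proof -
            have "J - {e} \<subseteq> X \<inter> E'" using J JE unfolding E'_def by blast
            then show ?thesis using h by (simp add: hall_def)
          qed
          show "card J \<le> card (\<Union>(N ` J))"
          proof (cases "e \<in> J")
            case False
            then show ?thesis using le by simp
          next
            case True
            have "card J = Suc (card (J - {e}))" using True finJ by (metis card.remove)
            also have "\<dots> \<le> Suc (card (\<Union>(N ` (J - {e}))))" using le by simp
            also have "\<dots> = card (insert x (\<Union>(N ` (J - {e}))))"
            proof -
              have "x \<notin> N f" if "f \<in> J - {e}" for f
              proof
                assume "x \<in> N f"
                then have "f \<in> {e \<in> E. x \<in> N e}" using \<open>f \<in> J - {e}\<close> JE by auto
                then show False using e \<open>f \<in> J - {e}\<close> by simp
              qed
              then have "x \<notin> \<Union>(N ` (J - {e}))" by simp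
              moreover have "finite (\<Union>(N ` (J - {e})))" by (rule finite_subset[OF _ finN]) auto
              ultimately show ?thesis by simp
            qed
            also have "\<dots> \<le> card (\<Union>(N ` J))" using True eE(2) finN by (intro card_mono) auto
            finally show ?thesis .
          qed
        qed
      qed
    qed
    then show ?thesis using ps(2) by simp
  next
    case 4
    interpret good_graph E N using 4 less.prems(2) by unfold_locales
    show ?thesis by (rule good_lattice_like)
  qed
qed

definition list_matroid :: "nat matroid \<Rightarrow> (nat \<times> nat) list \<Rightarrow> bool" where
  "list_matroid K ys \<longleftrightarrow> ground K = {..<length ys} \<and>
     (\<forall>X\<subseteq>{..<length ys}. X \<in> indeps K \<longleftrightarrow> hall (list_ends ys) X)"

lemma list_matroid_multigraph_of:
  assumes "\<forall>p\<in>set ys. fst p < n \<and> snd p < n"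
  shows "list_matroid (B_matroid (multigraph_of n ys)) ys"
proof -
  have "finite_multigraph (multigraph_of n ys)"
    unfolding finite_multigraph_def multigraph_of_def using assms
    by (auto simp: card_insert_if)
  then have "bicircular_indep (multigraph_of n ys) I \<longleftrightarrow>
      I \<subseteq> {..<length ys} \<and> hall (list_ends ys) I" for I
    using bicircular_indep_iff_hall[of "multigraph_of n ys" I]
    by (simp add: multigraph_of_def list_ends_def[abs_def])
  then show ?thesis by (auto simp: list_matroid_def B_matroid_def multigraph_of_def)
qed

lemma list_matroid_excluded:
  "list_matroid (B_matroid graph_P2) ex_P2" "list_matroid (B_matroid graph_W) ex_W"
  "list_matroid (B_matroid graph_A3) ex_A3" "list_matroid (B_matroid graph_R3) ex_R3"
  "list_matroid (B_matroid graph_R4) ex_R4" "list_matroid (B_matroid graph_D4) ex_D4"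
  "list_matroid (B_matroid graph_3K3) ex_3K3" "list_matroid (B_matroid graph_S1) ex_S1"
  unfolding graph_P2_def graph_W_def graph_A3_def graph_R3_def graph_R4_def graph_D4_def graph_3K3_def graph_S1_def
  unfolding ex_P2_def[symmetric] ex_W_def[symmetric] ex_A3_def[symmetric] ex_R3_def[symmetric]
    ex_R4_def[symmetric] ex_D4_def[symmetric] ex_3K3_def[symmetric] ex_S1_def[symmetric]
  by (rule list_matroid_multigraph_of;
      simp add: ex_P2_def ex_W_def ex_A3_def ex_R3_def ex_R4_def ex_D4_def ex_3K3_def ex_S1_def)+

theorem theorem2:
  fixes M :: "'a matroid"
  assumes "bicircular_matroid M"
  shows "lattice_path_matroid M \<longleftrightarrow>
    \<not> (\<exists>N \<in> {B_matroid graph_P2, B_matroid graph_W, B_matroid graph_A3, B_matroid graph_R3,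
              B_matroid graph_R4, B_matroid graph_D4, B_matroid graph_3K3, B_matroid graph_S1}.
          has_minor_isomorphic_to M N)"
proof -
  let ?Ex = "{B_matroid graph_P2, B_matroid graph_W, B_matroid graph_A3, B_matroid graph_R3,
              B_matroid graph_R4, B_matroid graph_D4, B_matroid graph_3K3, B_matroid graph_S1}"
  have M: "is_matroid M" using assms by (simp add: bicircular_matroid_def)
  obtain G :: "(nat, nat) multigraph" where G: "finite_multigraph G" "matroid_iso M (B_matroid G)"
    using assms by (auto simp: bicircular_matroid_def)
  define E where "E = edges G"
  define N where "N = ends G"
  interpret mgraph E N
    using G(1) unfolding mgraph_def E_def N_def finite_multigraph_def by blast
  obtain f where f: "bij_betw f (ground M) E"
    and fX: "\<And>X. X \<subseteq> ground M \<Longrightarrow> X \<in> indeps M \<longleftrightarrow> bicircular_indep G (f ` X)"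
    using G(2) by (auto simp: matroid_iso_def B_matroid_def E_def)
  have hallM: "X \<in> indeps M \<longleftrightarrow> hall N (f ` X)" if X: "X \<subseteq> ground M" for X
  proof -
    have "f ` X \<subseteq> E" using f X by (auto simp: bij_betw_def)
    then show ?thesis using fX[OF X] bicircular_indep_iff_hall[OF G(1)] by (simp add: E_def N_def)
  qed
  show ?thesis
  proof
    assume "lattice_path_matroid M"
    then have likeM: "like_matroid M" by (rule lattice_path_imp_like)
    show "\<not> (\<exists>N \<in> ?Ex. has_minor_isomorphic_to M N)"
    proof
      assume "\<exists>N \<in> ?Ex. has_minor_isomorphic_to M N"
      then obtain K L where K: "K \<in> ?Ex" "minor_of L M" "matroid_iso L K"
        unfolding has_minor_isomorphic_to_def by blast
      have "like_matroid K"
        using like_matroid_iso[OF matroid_iso_sym[OF K(3)]] like_matroid_minor[OF M likeM K(2)] .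
      moreover obtain ys where ys: "ys \<in> excluded" "list_matroid K ys"
        using K(1) list_matroid_excluded unfolding excluded_def by blast
      ultimately have "lattice_like {..<length ys} (\<lambda>X. X \<in> indeps K)" by (simp add: list_matroid_def)
      then have "lattice_like {..<length ys} (hall (list_ends ys))"
        using ys(2) lattice_like_cong[of "{..<length ys}" "\<lambda>X. X \<in> indeps K" "hall (list_ends ys)"]
        by (simp add: list_matroid_def)
      then show False using excluded_not_like[OF ys(1)] by simp
    qed
  next
    assume nominor: "\<not> (\<exists>N \<in> ?Ex. has_minor_isomorphic_to M N)"
    have "\<not> bad"
    proof
      assume bad
      then obtain ys where ys: "ys \<in> excluded" "emb E (hall N) {..<length ys} (hall (list_ends ys))"
        by (auto simp: bad_def)
      obtain K where K: "K \<in> ?Ex" "list_matroid K ys"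
        using ys(1) list_matroid_excluded unfolding excluded_def by blast
      have "emb (ground M) (\<lambda>X. X \<in> indeps M) E (hall N)"
        using emb_bij[OF f, of "\<lambda>X. X \<in> indeps M" "hall N"] hallM matroidD(2)[OF M] by blast
      then have "emb (ground M) (\<lambda>X. X \<in> indeps M) {..<length ys} (hall (list_ends ys))"
        using ys(2) by (rule emb_trans)
      then have "emb (ground M) (\<lambda>X. X \<in> indeps M) (ground K) (\<lambda>X. X \<in> indeps K)"
        using K(2) by (simp add: emb_def list_matroid_def)
      then have "has_minor_isomorphic_to M K" by (rule emb_has_minor[OF M])
      then show False using nominor K(1) by blast
    qed
    then have "lattice_like E (hall N)" by (rule not_bad_imp_lattice_like[OF mgraph_axioms])
    then have "like_matroid M"
      using f hallM by (intro lattice_like_image[of E "hall N" f]) (auto simp: bij_betw_def)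
    then show "lattice_path_matroid M" by (rule like_imp_lattice_path[OF M])
  qed
qed

end
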